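(* Let $(M,g,\eta,\nabla)$ be a semi-Weyl manifold admitting torsion (SWMT) and let $M'$ be a pseudo-Riemannian (non-degenerate) submanifold of $(M,g)$. Let $g'$ and $\eta'$ be the tensors induced on $M'$ by $g$ and $\eta$, and for $X,Y\in\Gamma^\infty(TM')$ let $\nabla'_XY$ be the component of $\nabla_XY$ tangent to $M'$. Then $(M',g',\eta',\nabla')$ is also a SWMT. Moreover, the semi-dual connection $(\nabla')^*$ of $\nabla'$ with respect to $(g',\eta')$ equals the induced connection $(\nabla^* )'$ of the semi-dual connection $\nabla^*$ of $\nabla$ with respect to $(g,\eta)$, i.e. $(\nabla')^*_XY$ is the component of $\nabla^*_XY$ tangent to $M'$ for all $X,Y\in\Gamma^\infty(TM')$.
   Context: A smooth submanifold $M'$ of a pseudo-Riemannian manifold $(M,g)$ is a pseudo-Riemannian (non-degenerate) submanifold if $g'=g|_{TM'\times TM'}$ is a pseudo-Riemannian metric on $M'$; then $T_xM=T_xM'\oplus T_x^\perp M'$ ($g$-orthogonally) for $x\in M'$, and tangent components are taken with respect to this decomposition. For an affine connection $\nabla$ on $M$ (possibly with torsion), $T^\nabla(X,Y)=\nabla_XY-\nabla_YX-[X,Y]$ and $(\nabla_Xg)(Y,Z)=X(g(Y,Z))-g(\nabla_XY,Z)-g(Y,\nabla_XZ)$. For a $1$-form $\eta$, $(M,g,\eta,\nabla)$ is a SWMT if $(\nabla_Xg)(Y,Z)+\eta(X)g(Y,Z)=(\nabla_Yg)(X,Z)+\eta(Y)g(X,Z)-g(T^\nabla(X,Y),Z)$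 for all vector fields $X,Y,Z$. The semi-dual connection $\nabla^*$ of $\nabla$ with respect to $(g,\eta)$ is defined by $X(g(Y,Z))=g(\nabla_XY,Z)+g(Y,\nabla^*_XZ)-\eta(X)g(Y,Z)$ for all vector fields $X,Y,Z$. *)

theory Defs
  imports "HOL-Analysis.Analysis"
begin

text \<open>
  On an open subset of a finite-dimensional space, having continuous iterated directional
  derivatives of the total derivative up to order \<open>k\<close> is the usual \<open>C\<^sup>k\<close> property.
\<close>

primrec Ck_on :: "nat \<Rightarrow> 'e::real_normed_vector set \<Rightarrow> ('e \<Rightarrow> 'f::real_normed_vector) \<Rightarrow> bool" where
  "Ck_on 0 S f \<longleftrightarrow> continuous_on S f"
| "Ck_on (Suc k) S f \<longleftrightarrow>
     (\<forall>x\<in>S. f differentiable (at x)) \<and> (\<forall>v. Ck_on k S (\<lambda>x. frechet_derivative f (at x) v))"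

definition smooth_on :: "'e::real_normed_vector set \<Rightarrow> ('e \<Rightarrow> 'f::real_normed_vector) \<Rightarrow> bool" where
  "smooth_on S f \<longleftrightarrow> (\<forall>k. Ck_on k S f)"

text \<open>
  A manifold is a topology together with a (not necessarily maximal) smooth atlas. The model space
  is a finite-dimensional real inner product space \<open>'e\<close>; unlike \<open>euclidean_space\<close>, this does
  not exclude dimension zero.
\<close>

record ('a, 'e) manifold =
  mtop :: "'a topology"
  charts :: "('a set \<times> ('a \<Rightarrow> 'e)) set"

definition smooth_manifold :: "('a, 'e::real_inner) manifold \<Rightarrow> bool" where
  "smooth_manifold M \<longleftrightarrow>
     (\<exists>B::'e set. finite B \<and> span B = UNIV) \<and>
     Hausdorff_space (mtop M) \<and>
     second_countable (mtop M) \<and>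
     (\<forall>(U, \<phi>)\<in>charts M. openin (mtop M) U \<and> open (\<phi> ` U) \<and>
        homeomorphic_map (subtopology (mtop M) U) (top_of_set (\<phi> ` U)) \<phi>) \<and>
     (\<Union>(U, \<phi>)\<in>charts M. U) = topspace (mtop M) \<and>
     (\<forall>(U, \<phi>)\<in>charts M. \<forall>(V, \<psi>)\<in>charts M.
        smooth_on (\<phi> ` (U \<inter> V)) (\<psi> \<circ> inv_into U \<phi>))"

definition smooth_map ::
  "('a, 'e::real_inner) manifold \<Rightarrow> ('b, 'f::real_inner) manifold \<Rightarrow> ('a \<Rightarrow> 'b) \<Rightarrow> bool" where
  "smooth_map M N F \<longleftrightarrow>
     continuous_map (mtop M) (mtop N) F \<and>
     (\<forall>(U, \<phi>)\<in>charts M. \<forall>(V, \<psi>)\<in>charts N.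
        smooth_on (\<phi> ` (U \<inter> F -` V)) (\<psi> \<circ> F \<circ> inv_into U \<phi>))"

definition open_interval_manifold :: "real \<Rightarrow> (real, real) manifold" where
  "open_interval_manifold e =
     \<lparr>mtop = top_of_set {-e<..<e}, charts = {({-e<..<e}, \<lambda>t. t)}\<rparr>"

definition real_manifold :: "(real, real) manifold" where
  "real_manifold = \<lparr>mtop = euclidean, charts = {(UNIV, \<lambda>t. t)}\<rparr>"

text \<open>
  The algebra \<open>C\<^sup>\<infinity>(M)\<close>. Its elements are total functions of which only the values on \<open>M\<close> matter.
\<close>

definition smooth_functions :: "('a, 'e::real_inner) manifold \<Rightarrow> ('a \<Rightarrow> real) set" where
  "smooth_functions M = {f. smooth_map M real_manifold f}"

text \<open>
  Tangent vectors are velocities of smooth curves, regarded as functionals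
  \<open>f \<mapsto> (f \<circ> c)'(0)\<close> on \<open>C\<^sup>\<infinity>(M)\<close>. So that equality of tangent vectors is
  equality of HOL functions, they vanish by convention on arguments outside \<open>C\<^sup>\<infinity>(M)\<close>;
  likewise vector fields vanish at points outside \<open>M\<close>. The linear operations on tangent
  vectors are the pointwise ones.
\<close>

type_synonym 'a tangent = "('a \<Rightarrow> real) \<Rightarrow> real"
type_synonym 'a vfield = "'a \<Rightarrow> 'a tangent"

definition tangent_space :: "('a, 'e::real_inner) manifold \<Rightarrow> 'a \<Rightarrow> 'a tangent set" where
  "tangent_space M p =
     {(\<lambda>f. if f \<in> smooth_functions M then deriv (\<lambda>t. f (c t)) 0 else 0) | c.
        \<exists>e>0. smooth_map (open_interval_manifold e) M c \<and> c 0 = p}"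

definition vector_fields :: "('a, 'e::real_inner) manifold \<Rightarrow> 'a vfield set" where
  "vector_fields M = {X.
     (\<forall>p\<in>topspace (mtop M). X p \<in> tangent_space M p) \<and>
     (\<forall>p. p \<notin> topspace (mtop M) \<longrightarrow> X p = (\<lambda>f. 0)) \<and>
     (\<forall>f\<in>smooth_functions M. (\<lambda>p. X p f) \<in> smooth_functions M)}"

definition lie_bracket :: "('a, 'e::real_inner) manifold \<Rightarrow> 'a vfield \<Rightarrow> 'a vfield \<Rightarrow> 'a vfield" where
  "lie_bracket M X Y = (\<lambda>p f.
     if f \<in> smooth_functions M then X p (\<lambda>q. Y q f) - Y p (\<lambda>q. X q f) else 0)"

definition pseudo_riemannian_metric ::
  "('a, 'e::real_inner) manifold \<Rightarrow> ('a \<Rightarrow> 'a tangent \<Rightarrow> 'a tangent \<Rightarrow> real) \<Rightarrow> bool" where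
  "pseudo_riemannian_metric M g \<longleftrightarrow>
     (\<forall>p\<in>topspace (mtop M).
        (\<forall>u\<in>tangent_space M p. \<forall>v\<in>tangent_space M p. g p u v = g p v u) \<and>
        (\<forall>u\<in>tangent_space M p. \<forall>v\<in>tangent_space M p. \<forall>w\<in>tangent_space M p. \<forall>a b.
           g p (\<lambda>f. a * u f + b * v f) w = a * g p u w + b * g p v w) \<and>
        (\<forall>u\<in>tangent_space M p. (\<forall>v\<in>tangent_space M p. g p u v = 0) \<longrightarrow> u = (\<lambda>f. 0))) \<and>
     (\<forall>X\<in>vector_fields M. \<forall>Y\<in>vector_fields M. (\<lambda>p. g p (X p) (Y p)) \<in> smooth_functions M)"

definition one_form ::
  "('a, 'e::real_inner) manifold \<Rightarrow> ('a \<Rightarrow> 'a tangent \<Rightarrow> real) \<Rightarrow> bool" where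
  "one_form M \<eta> \<longleftrightarrow>
     (\<forall>p\<in>topspace (mtop M). \<forall>u\<in>tangent_space M p. \<forall>v\<in>tangent_space M p. \<forall>a b.
        \<eta> p (\<lambda>f. a * u f + b * v f) = a * \<eta> p u + b * \<eta> p v) \<and>
     (\<forall>X\<in>vector_fields M. (\<lambda>p. \<eta> p (X p)) \<in> smooth_functions M)"

definition affine_connection ::
  "('a, 'e::real_inner) manifold \<Rightarrow> ('a vfield \<Rightarrow> 'a vfield \<Rightarrow> 'a vfield) \<Rightarrow> bool" where
  "affine_connection M D \<longleftrightarrow>
     (\<forall>X\<in>vector_fields M. \<forall>Y\<in>vector_fields M. D X Y \<in> vector_fields M) \<and>
     (\<forall>X\<in>vector_fields M. \<forall>Y\<in>vector_fields M. \<forall>Z\<in>vector_fields M.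
        D (\<lambda>p f. X p f + Y p f) Z = (\<lambda>p f. D X Z p f + D Y Z p f) \<and>
        D X (\<lambda>p f. Y p f + Z p f) = (\<lambda>p f. D X Y p f + D X Z p f)) \<and>
     (\<forall>h\<in>smooth_functions M. \<forall>X\<in>vector_fields M. \<forall>Y\<in>vector_fields M.
        D (\<lambda>p f. h p * X p f) Y = (\<lambda>p f. h p * D X Y p f) \<and>
        D X (\<lambda>p f. h p * Y p f) = (\<lambda>p f. X p h * Y p f + h p * D X Y p f))"

definition torsion ::
  "('a, 'e::real_inner) manifold \<Rightarrow> ('a vfield \<Rightarrow> 'a vfield \<Rightarrow> 'a vfield) \<Rightarrow>
     'a vfield \<Rightarrow> 'a vfield \<Rightarrow> 'a vfield" where
  "torsion M D X Y = (\<lambda>p f. D X Y p f - D Y X p f - lie_bracket M X Y p f)"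

definition nabla_metric ::
  "('a \<Rightarrow> 'a tangent \<Rightarrow> 'a tangent \<Rightarrow> real) \<Rightarrow> ('a vfield \<Rightarrow> 'a vfield \<Rightarrow> 'a vfield) \<Rightarrow>
     'a vfield \<Rightarrow> 'a vfield \<Rightarrow> 'a vfield \<Rightarrow> 'a \<Rightarrow> real" where
  "nabla_metric g D X Y Z p =
     X p (\<lambda>q. g q (Y q) (Z q)) - g p (D X Y p) (Z p) - g p (Y p) (D X Z p)"

definition semi_weyl_manifold_with_torsion ::
  "('a, 'e::real_inner) manifold \<Rightarrow> ('a \<Rightarrow> 'a tangent \<Rightarrow> 'a tangent \<Rightarrow> real) \<Rightarrow>
     ('a \<Rightarrow> 'a tangent \<Rightarrow> real) \<Rightarrow> ('a vfield \<Rightarrow> 'a vfield \<Rightarrow> 'a vfield) \<Rightarrow> bool" where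
  "semi_weyl_manifold_with_torsion M g \<eta> D \<longleftrightarrow>
     smooth_manifold M \<and> pseudo_riemannian_metric M g \<and> one_form M \<eta> \<and> affine_connection M D \<and>
     (\<forall>X\<in>vector_fields M. \<forall>Y\<in>vector_fields M. \<forall>Z\<in>vector_fields M. \<forall>p\<in>topspace (mtop M).
        nabla_metric g D X Y Z p + \<eta> p (X p) * g p (Y p) (Z p) =
        nabla_metric g D Y X Z p + \<eta> p (Y p) * g p (X p) (Z p) - g p (torsion M D X Y p) (Z p))"

text \<open>
  The vector field \<open>semi_dual M g \<eta> D X Z\<close> is the unique one that can stand for \<open>\<nabla>\<^sup>*\<^sub>X Z\<close> in the
  defining identity, for all \<open>Y\<close>; uniqueness and existence come from non-degeneracy of \<open>g\<close>.
\<close>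

definition semi_dual ::
  "('a, 'e::real_inner) manifold \<Rightarrow> ('a \<Rightarrow> 'a tangent \<Rightarrow> 'a tangent \<Rightarrow> real) \<Rightarrow>
     ('a \<Rightarrow> 'a tangent \<Rightarrow> real) \<Rightarrow> ('a vfield \<Rightarrow> 'a vfield \<Rightarrow> 'a vfield) \<Rightarrow>
     'a vfield \<Rightarrow> 'a vfield \<Rightarrow> 'a vfield" where
  "semi_dual M g \<eta> D X Z = (THE W. W \<in> vector_fields M \<and>
     (\<forall>Y\<in>vector_fields M. \<forall>p\<in>topspace (mtop M).
        X p (\<lambda>q. g q (Y q) (Z q)) =
          g p (D X Y p) (Z p) + g p (Y p) (W p) - \<eta> p (X p) * g p (Y p) (Z p)))"

text \<open>
  The differential of the inclusion of a submanifold. If the inclusion is smooth, then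
  \<open>C\<^sup>\<infinity>(M)\<close> is a subset of \<open>C\<^sup>\<infinity>(M')\<close> (functions being total), so
  \<open>v (f \<circ> inclusion)\<close> is just \<open>v f\<close>.
\<close>

definition incl_diff :: "('a, 'e::real_inner) manifold \<Rightarrow> 'a tangent \<Rightarrow> 'a tangent" where
  "incl_diff M v = (\<lambda>f. if f \<in> smooth_functions M then v f else 0)"

text \<open>
  Immersed submanifolds: the topology of \<open>M'\<close> may be finer than the subspace topology. Embedded
  submanifolds are the case \<open>mtop M' = subtopology (mtop M) (topspace (mtop M'))\<close>.
\<close>

definition submanifold ::
  "('a, 'k::real_inner) manifold \<Rightarrow> ('a, 'm::real_inner) manifold \<Rightarrow> bool" where
  "submanifold M' M \<longleftrightarrow>
     smooth_manifold M' \<and> smooth_manifold M \<and> topspace (mtop M') \<subseteq> topspace (mtop M) \<and>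
     smooth_map M' M (\<lambda>x. x) \<and>
     (\<forall>p\<in>topspace (mtop M'). inj_on (incl_diff M) (tangent_space M' p))"

definition induced_metric ::
  "('a, 'm::real_inner) manifold \<Rightarrow> ('a \<Rightarrow> 'a tangent \<Rightarrow> 'a tangent \<Rightarrow> real) \<Rightarrow>
     'a \<Rightarrow> 'a tangent \<Rightarrow> 'a tangent \<Rightarrow> real" where
  "induced_metric M g = (\<lambda>p u v. g p (incl_diff M u) (incl_diff M v))"

definition induced_form ::
  "('a, 'm::real_inner) manifold \<Rightarrow> ('a \<Rightarrow> 'a tangent \<Rightarrow> real) \<Rightarrow> 'a \<Rightarrow> 'a tangent \<Rightarrow> real" where
  "induced_form M \<eta> = (\<lambda>p u. \<eta> p (incl_diff M u))"

definition pseudo_riemannian_submanifold ::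
  "('a, 'k::real_inner) manifold \<Rightarrow> ('a, 'm::real_inner) manifold \<Rightarrow>
     ('a \<Rightarrow> 'a tangent \<Rightarrow> 'a tangent \<Rightarrow> real) \<Rightarrow> bool" where
  "pseudo_riemannian_submanifold M' M g \<longleftrightarrow>
     submanifold M' M \<and> pseudo_riemannian_metric M' (induced_metric M g)"

definition normal_space ::
  "('a, 'k::real_inner) manifold \<Rightarrow> ('a, 'm::real_inner) manifold \<Rightarrow>
     ('a \<Rightarrow> 'a tangent \<Rightarrow> 'a tangent \<Rightarrow> real) \<Rightarrow> 'a \<Rightarrow> 'a tangent set" where
  "normal_space M' M g p =
     {n \<in> tangent_space M p. \<forall>u\<in>tangent_space M' p. g p n (incl_diff M u) = 0}"

definition tangent_component ::
  "('a, 'k::real_inner) manifold \<Rightarrow> ('a, 'm::real_inner) manifold \<Rightarrow>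
     ('a \<Rightarrow> 'a tangent \<Rightarrow> 'a tangent \<Rightarrow> real) \<Rightarrow> 'a \<Rightarrow> 'a tangent \<Rightarrow> 'a tangent" where
  "tangent_component M' M g p w = (THE u. u \<in> tangent_space M' p \<and>
     (\<exists>n\<in>normal_space M' M g p. w = (\<lambda>f. incl_diff M u f + n f)))"

text \<open>
  For vector fields \<open>X\<close>, \<open>Y\<close> on \<open>M'\<close>, the value of \<open>\<nabla>\<^sub>X Y\<close> at a point \<open>p\<close> of \<open>M'\<close> is, as usual,
  that of \<open>\<nabla>\<^sub>S T\<close> for any vector fields \<open>S\<close>, \<open>T\<close> on \<open>M\<close> extending \<open>X\<close>, \<open>Y\<close> near \<open>p\<close>.
\<close>

definition extends_near ::
  "('a, 'k::real_inner) manifold \<Rightarrow> ('a, 'm::real_inner) manifold \<Rightarrow>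
     'a \<Rightarrow> 'a vfield \<Rightarrow> 'a vfield \<Rightarrow> bool" where
  "extends_near M' M p X S \<longleftrightarrow> S \<in> vector_fields M \<and>
     (\<exists>W. openin (mtop M') W \<and> p \<in> W \<and> (\<forall>q\<in>W. S q = incl_diff M (X q)))"

definition connection_along ::
  "('a, 'k::real_inner) manifold \<Rightarrow> ('a, 'm::real_inner) manifold \<Rightarrow>
     ('a vfield \<Rightarrow> 'a vfield \<Rightarrow> 'a vfield) \<Rightarrow> 'a vfield \<Rightarrow> 'a vfield \<Rightarrow> 'a vfield" where
  "connection_along M' M D X Y p =
     (THE w. \<exists>S T. extends_near M' M p X S \<and> extends_near M' M p Y T \<and> w = D S T p)"

definition induced_connection ::
  "('a, 'k::real_inner) manifold \<Rightarrow> ('a, 'm::real_inner) manifold \<Rightarrow>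
     ('a \<Rightarrow> 'a tangent \<Rightarrow> 'a tangent \<Rightarrow> real) \<Rightarrow> ('a vfield \<Rightarrow> 'a vfield \<Rightarrow> 'a vfield) \<Rightarrow>
     'a vfield \<Rightarrow> 'a vfield \<Rightarrow> 'a vfield" where
  "induced_connection M' M g D X Y = (\<lambda>p.
     if p \<in> topspace (mtop M') then tangent_component M' M g p (connection_along M' M D X Y p)
     else (\<lambda>f. 0))"

end

theory Submission
  imports Defs
begin

text \<open>
  By the local retraction of an immersion, functions and vector fields on \<open>M'\<close> extend near each point
  to \<open>M\<close>, and \<open>\<nabla>\<^sub>S T\<close> at points of \<open>M'\<close> does not depend on the extensions \<open>S\<close>, \<open>T\<close> of fields \<open>X\<close>, \<open>Y\<close>
  tangent to \<open>M'\<close>. Hence \<open>g'(\<nabla>'\<^sub>X Y, Z)\<close> is the restriction of \<open>g(\<nabla>\<^sub>S T, R)\<close>. As brackets of extensions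
  extend brackets, each term of the identities defining a SWMT and the semi-dual connection on \<open>M'\<close>
  is the restriction of the same term on \<open>M\<close>. Smoothness of \<open>\<nabla>'\<^sub>X Y\<close>, and the existence of
  semi-dual connections, follow since a vector field is smooth as soon as its products with all
  smooth fields are: its components solve a linear system whose matrix is the Gram matrix.
\<close>

section \<open>Calculus of \<open>C\<^sup>k\<close> maps\<close>

text \<open>An affine connection acts on global fields of \<open>M\<close>, while an immersed
  \<open>M'\<close> may carry a topology finer than the subspace topology. A field on
  \<open>M'\<close> then need not be the restriction of a field on \<open>M\<close>, not even
  locally in the topology of \<open>M\<close>. Extensions are therefore global fields, cut off by
  bump functions, that agree with the given field only on a set open in \<open>M'\<close> around one
  point. This weak agreement suffices: a vector tangent to \<open>M'\<close> differentiates
  functions through their germs along \<open>M'\<close>, and an extension near \<open>p\<close> is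
  one near all neighbouring points of \<open>M'\<close> as well.

  Two facts that look like bookkeeping carry weight. A metric is linear on tangent vectors only, so
  expanding the torsion term presupposes that a bracket, a priori a second-order operator, is a
  tangent vector; this rests on the symmetry of second derivatives. And the values of the connection
  induced by the semi-dual connection are independent of extensions because the latter is itself an
  affine connection, which presupposes its existence as a smooth field.\<close>

lemma Ck_on_cong_imp:
  assumes "open S" "\<And>x. x \<in> S \<Longrightarrow> f x = g x" "Ck_on k S f"
  shows "Ck_on k S g"
  using assms(2,3)
proof (induction k arbitrary: f g)
  case 0
  then show ?case by (simp cong: continuous_on_cong)
next
  case (Suc k)
  have d: "f differentiable (at x)" if "x \<in> S" for x
    using Suc.prems that by simp
  have "g differentiable (at x) \<and> frechet_derivative f (at x) = frechet_derivative g (at x)"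
    if "x \<in> S" for x
  proof -
    have "(f has_derivative frechet_derivative f (at x)) (at x)"
      using d that frechet_derivative_works by blast
    then have "(g has_derivative frechet_derivative f (at x)) (at x)"
      using has_derivative_transform_within_open assms(1) that Suc.prems(1) by blast
    then show ?thesis
      by (simp add: differentiableI frechet_derivative_at)
  qed
  then show ?case
    using Suc.IH[of "\<lambda>x. frechet_derivative f (at x) _" "\<lambda>x. frechet_derivative g (at x) _"] Suc.prems
    by simp
qed

lemma Ck_on_subset: "Ck_on k S f \<Longrightarrow> T \<subseteq> S \<Longrightarrow> Ck_on k T f"
  by (induction k arbitrary: f) (auto intro: continuous_on_subset)

lemma Ck_on_locally:
  assumes "\<And>x. x \<in> S \<Longrightarrow> \<exists>N. open N \<and> x \<in> N \<and> Ck_on k N f"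
  shows "Ck_on k S f"
  using assms
proof (induction k arbitrary: f)
  case 0
  show ?case
  proof (unfold Ck_on.simps, rule continuous_at_imp_continuous_on, rule ballI)
    fix x assume "x \<in> S"
    then obtain N where "open N" "x \<in> N" "continuous_on N f" using 0 by auto
    then show "isCont f x" using continuous_on_eq_continuous_at by blast
  qed
next
  case (Suc k)
  show ?case unfolding Ck_on.simps
  proof (intro conjI ballI allI)
    show "f differentiable at x" if "x \<in> S" for x using Suc.prems[OF that] by auto
    show "Ck_on k S (\<lambda>x. frechet_derivative f (at x) v)" for v
      using Suc.prems by (intro Suc.IH) (metis Ck_on.simps(2))
  qed
qed

lemma Ck_on_SucD: "Ck_on (Suc k) S f \<Longrightarrow> Ck_on k S f"
proof (induction k arbitrary: f)
  case 0
  then show ?case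
    by (auto intro!: continuous_at_imp_continuous_on differentiable_imp_continuous_within)
next
  case (Suc k)
  then show ?case by (subst Ck_on.simps) (metis Ck_on.simps(2))
qed

text \<open>Allows an explicit derivative \<open>f'\<close> in place of
  \<open>frechet_derivative\<close>. In this form the closure rules are proved by induction on
  \<open>k\<close>.\<close>

lemma Ck_on_SucI:
  assumes "open S" "\<And>x. x \<in> S \<Longrightarrow> (f has_derivative f' x) (at x)" "\<And>v. Ck_on k S (\<lambda>x. f' x v)"
  shows "Ck_on (Suc k) S f"
proof -
  have "f' x = frechet_derivative f (at x)" if "x \<in> S" for x
    using assms(2) frechet_derivative_at that by blast
  then show ?thesis
    using assms(2,3) Ck_on_cong_imp[OF assms(1), of "\<lambda>x. f' x _"] by (auto intro: differentiableI)
qed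

lemma Ck_on_Suc_has_derivative:
  "Ck_on (Suc k) S f \<Longrightarrow> x \<in> S \<Longrightarrow> (f has_derivative frechet_derivative f (at x)) (at x)"
  using frechet_derivative_works by auto

lemma Ck_on_const: "Ck_on k S (\<lambda>x. c)"
  by (induction k arbitrary: c) auto

lemma Ck_on_linear_compose:
  assumes L: "bounded_linear L" and "open S" "Ck_on k S f"
  shows "Ck_on k S (\<lambda>x. L (f x))"
  using assms(3)
proof (induction k arbitrary: f)
  case 0
  then show ?case using bounded_linear.continuous_on[OF L] by auto
next
  case (Suc k)
  show ?case
  proof (rule Ck_on_SucI[OF \<open>open S\<close>])
    show "((\<lambda>x. L (f x)) has_derivative (\<lambda>v. L (frechet_derivative f (at x) v))) (at x)" if "x \<in> S" for x
      using bounded_linear.has_derivative[OF L Ck_on_Suc_has_derivative] Suc.prems that by blast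
  qed (use Suc in simp)
qed

lemma Ck_on_ident: "open S \<Longrightarrow> Ck_on k S (\<lambda>x. x)"
  by (cases k) (auto intro!: Ck_on_SucI[where f' = "\<lambda>x v. v"] Ck_on_const)

lemma Ck_on_add:
  assumes "open S" "Ck_on k S f" "Ck_on k S g"
  shows "Ck_on k S (\<lambda>x. f x + g x)"
  using assms(2,3)
proof (induction k arbitrary: f g)
  case 0
  then show ?case by (auto intro: continuous_intros)
next
  case (Suc k)
  show ?case
    by (rule Ck_on_SucI[OF \<open>open S\<close>, where
          f' = "\<lambda>x v. frechet_derivative f (at x) v + frechet_derivative g (at x) v"])
      (use Suc in \<open>auto intro!: has_derivative_add simp: frechet_derivative_works[symmetric]\<close>)
qed

lemma Ck_on_scaleR:
  assumes "open S" "Ck_on k S f" "Ck_on k S g"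
  shows "Ck_on k S (\<lambda>x. f x *\<^sub>R g x)"
  using assms(2,3)
proof (induction k arbitrary: f g)
  case 0
  then show ?case by (auto intro: continuous_intros)
next
  case (Suc k)
  show ?case
  proof (rule Ck_on_SucI[OF \<open>open S\<close>, where
          f' = "\<lambda>x v. f x *\<^sub>R frechet_derivative g (at x) v + frechet_derivative f (at x) v *\<^sub>R g x"])
    show "((\<lambda>x. f x *\<^sub>R g x) has_derivative
        (\<lambda>v. f x *\<^sub>R frechet_derivative g (at x) v + frechet_derivative f (at x) v *\<^sub>R g x)) (at x)"
      if "x \<in> S" for x
      using that Suc.prems by (intro has_derivative_scaleR Ck_on_Suc_has_derivative) auto
    show "Ck_on k S (\<lambda>x. f x *\<^sub>R frechet_derivative g (at x) v + frechet_derivative f (at x) v *\<^sub>R g x)" for v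
      using Suc.prems Ck_on_SucD[OF Suc.prems(1)] Ck_on_SucD[OF Suc.prems(2)]
      by (intro Ck_on_add Suc.IH \<open>open S\<close>) auto
  qed
qed

lemma Ck_on_mult:
  fixes f g :: "'e::real_normed_vector \<Rightarrow> real"
  shows "open S \<Longrightarrow> Ck_on k S f \<Longrightarrow> Ck_on k S g \<Longrightarrow> Ck_on k S (\<lambda>x. f x * g x)"
  using Ck_on_scaleR[of S k f g] by simp

lemma Ck_on_minus:
  assumes "open S" "Ck_on k S f"
  shows "Ck_on k S (\<lambda>x. - f x)"
  using Ck_on_linear_compose[OF bounded_linear_minus[OF bounded_linear_ident] assms] .

lemma Ck_on_diff:
  "open S \<Longrightarrow> Ck_on k S f \<Longrightarrow> Ck_on k S g \<Longrightarrow> Ck_on k S (\<lambda>x. f x - g x)"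
  using Ck_on_add[OF _ _ Ck_on_minus, of S k f g] by simp

lemma Ck_on_sum:
  assumes "open S" "\<And>i. i \<in> I \<Longrightarrow> Ck_on k S (f i)"
  shows "Ck_on k S (\<lambda>x. \<Sum>i\<in>I. f i x)"
  using assms(2) by (induction I rule: infinite_finite_induct) (auto intro: Ck_on_const Ck_on_add assms(1))

text \<open>The derivative of the reciprocal is a product that contains \<open>inverse (f x)\<close>
  again, but one order lower, where the induction hypothesis applies.\<close>

lemma Ck_on_inverse:
  fixes f :: "'e::real_normed_vector \<Rightarrow> real"
  assumes "open S" "Ck_on k S f" "\<And>x. x \<in> S \<Longrightarrow> f x \<noteq> 0"
  shows "Ck_on k S (\<lambda>x. inverse (f x))"
  using assms(2)
proof (induction k)
  case 0
  then show ?case using assms(3) by (auto intro: continuous_intros)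
next
  case (Suc k)
  show ?case
  proof (rule Ck_on_SucI[OF \<open>open S\<close>])
    show "((\<lambda>x. inverse (f x)) has_derivative
        (\<lambda>v. - (inverse (f x) * frechet_derivative f (at x) v * inverse (f x)))) (at x)" if "x \<in> S" for x
      using that Suc.prems assms(3) by (intro Deriv.has_derivative_inverse Ck_on_Suc_has_derivative) auto
    show "Ck_on k S (\<lambda>x. - (inverse (f x) * frechet_derivative f (at x) v * inverse (f x)))" for v
      using Suc.prems Ck_on_SucD[OF Suc.prems(1)] Suc.IH
      by (intro Ck_on_minus Ck_on_mult \<open>open S\<close>) auto
  qed
qed

lemma Ck_on_divide:
  fixes f g :: "'e::real_normed_vector \<Rightarrow> real"
  assumes "open S" "Ck_on k S f" "Ck_on k S g" "\<And>x. x \<in> S \<Longrightarrow> g x \<noteq> 0"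
  shows "Ck_on k S (\<lambda>x. f x / g x)"
  using Ck_on_mult[OF assms(1,2) Ck_on_inverse[OF assms(1,3,4)]] by (simp add: divide_inverse)

text \<open>The solution of a linear system is found by elimination: the column of some unknown contains
  an entry that does not vanish at the point, hence not near it.\<close>

lemma Ck_on_linear_solution_local:
  fixes A :: "'i \<Rightarrow> 'j \<Rightarrow> 'e::real_normed_vector \<Rightarrow> real"
  assumes "finite J" "open N" "x0 \<in> N"
    and "\<And>i j. i \<in> I \<Longrightarrow> j \<in> J \<Longrightarrow> Ck_on k N (A i j)" "\<And>i. i \<in> I \<Longrightarrow> Ck_on k N (b i)"
    and "\<And>x i. x \<in> N \<Longrightarrow> i \<in> I \<Longrightarrow> (\<Sum>j\<in>J. A i j x * w j x) = b i x"
    and "\<And>c j. (\<And>i. i \<in> I \<Longrightarrow> (\<Sum>j\<in>J. A i j x0 * c j) = 0) \<Longrightarrow> j \<in> J \<Longrightarrow> c j = 0"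
  shows "\<exists>N'. open N' \<and> x0 \<in> N' \<and> N' \<subseteq> N \<and> (\<forall>j\<in>J. Ck_on k N' (w j))"
  using assms
proof (induction J arbitrary: A b N rule: finite_induct)
  case empty
  then show ?case by blast
next
  case (insert l J)
  have "\<exists>i\<in>I. A i l x0 \<noteq> 0"
  proof (rule ccontr)
    assume *: "\<not> ?thesis"
    \<comment> \<open>If the column of \<open>l\<close> vanished at \<open>x0\<close>, the unit
      vector at \<open>l\<close> would solve the homogeneous system there.\<close>
    have "(if l = l then 1::real else 0) = 0"
      by (rule insert.prems(6)[of "\<lambda>j. if j = l then 1 else 0" l])
        (use * insert.hyps in \<open>auto simp: if_distrib cong: if_cong intro: sum.neutral\<close>)
    then show False by simp
  qed
  then obtain r where r: "r \<in> I" "A r l x0 \<noteq> 0" by blast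
  define N1 where "N1 = {x \<in> N. A r l x \<noteq> 0}"
  have contA: "continuous_on N (A r l)"
    using insert.prems(3)[OF r(1)] by (induction k) (auto dest: Ck_on_SucD simp del: Ck_on.simps(2))
  have "open ((A r l) -` (- {0}) \<inter> N)"
    using contA insert.prems(1) open_Compl continuous_on_open_vimage by blast
  then have N1: "open N1" "x0 \<in> N1" "N1 \<subseteq> N"
    using r insert.prems(2) by (auto simp: N1_def vimage_def Int_def conj_commute)
  \<comment> \<open>Gaussian elimination of the unknown \<open>l\<close> with pivot row
    \<open>r\<close>. Row \<open>r\<close> stays in the system, where it turns into 0 = 0, so the
    index set \<open>I\<close> is the same throughout the induction.\<close>
  define A' where "A' i j x = A i j x - A i l x * A r j x / A r l x" for i j x
  define b' where "b' i x = b i x - A i l x * b r x / A r l x" for i x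
  have on1: "Ck_on k N1 (A i j)" if "i \<in> I" "j \<in> insert l J" for i j
    using insert.prems(3) that N1(3) Ck_on_subset by blast
  have on2: "Ck_on k N1 (b i)" if "i \<in> I" for i
    using insert.prems(4) that N1(3) Ck_on_subset by blast
  have nz: "A r l x \<noteq> 0" if "x \<in> N1" for x using that by (simp add: N1_def)
  have row: "A i l x * w l x + (\<Sum>j\<in>J. A i j x * w j x) = b i x" if "x \<in> N1" "i \<in> I" for i x
    using insert.prems(5)[of x i] that N1(3) insert.hyps by auto
  have pivot: "w l x = (b r x - (\<Sum>j\<in>J. A r j x * w j x)) / A r l x" if "x \<in> N1" for x
    using row[OF that r(1)] nz[OF that] by (simp add: field_simps)
  have "\<exists>N'. open N' \<and> x0 \<in> N' \<and> N' \<subseteq> N1 \<and> (\<forall>j\<in>J. Ck_on k N' (w j))"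
  proof (rule insert.IH[of N1 A' b'])
    show "open N1" "x0 \<in> N1" by fact+
    show "Ck_on k N1 (A' i j)" if "i \<in> I" "j \<in> J" for i j
      unfolding A'_def using that r nz on1 N1(1)
      by (intro Ck_on_diff Ck_on_divide Ck_on_mult) auto
    show "Ck_on k N1 (b' i)" if "i \<in> I" for i
      unfolding b'_def using that r nz on1 on2 N1(1)
      by (intro Ck_on_diff Ck_on_divide Ck_on_mult) auto
    show "(\<Sum>j\<in>J. A' i j x * w j x) = b' i x" if "x \<in> N1" "i \<in> I" for x i
    proof -
      have "(\<Sum>j\<in>J. A' i j x * w j x)
          = (\<Sum>j\<in>J. A i j x * w j x) - A i l x / A r l x * (\<Sum>j\<in>J. A r j x * w j x)"
        by (simp add: A'_def sum_subtractf sum_distrib_left algebra_simps)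
      also have "\<dots> = (b i x - A i l x * w l x) - A i l x / A r l x * (b r x - A r l x * w l x)"
        by (simp only: row[OF that(1) that(2), symmetric] row[OF that(1) r(1), symmetric] add_diff_cancel_left')
      also have "\<dots> = b' i x" using nz[OF that(1)] by (simp add: b'_def field_simps)
      finally show ?thesis .
    qed
    show "c j = 0" if c: "\<And>i. i \<in> I \<Longrightarrow> (\<Sum>j\<in>J. A' i j x0 * c j) = 0" and j: "j \<in> J" for c j
    proof -
      \<comment> \<open>A kernel vector of the reduced system is prolonged to one of the full
        system; the pivot row forces its entry at \<open>l\<close>.\<close>
      define d where "d = c(l := - (\<Sum>j\<in>J. A r j x0 * c j) / A r l x0)"
      have dJ: "(\<Sum>j\<in>J. A i j x0 * d j) = (\<Sum>j\<in>J. A i j x0 * c j)" for i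
        using insert.hyps by (intro sum.cong) (auto simp: d_def)
      have "(\<Sum>j\<in>insert l J. A i j x0 * d j) = 0" if "i \<in> I" for i
      proof -
        have "0 = (\<Sum>j\<in>J. A i j x0 * c j) - A i l x0 / A r l x0 * (\<Sum>j\<in>J. A r j x0 * c j)"
          using c[OF that] by (simp add: A'_def sum_subtractf sum_distrib_left algebra_simps)
        then show ?thesis using insert.hyps by (simp add: dJ) (simp add: d_def)
      qed
      then have "d j = 0" using insert.prems(6)[of d j] j by blast
      then show ?thesis using j insert.hyps by (auto simp: d_def split: if_splits)
    qed
  qed
  then obtain N' where N': "open N'" "x0 \<in> N'" "N' \<subseteq> N1" "\<And>j. j \<in> J \<Longrightarrow> Ck_on k N' (w j)"
    by blast
  have "Ck_on k N' (\<lambda>x. (b r x - (\<Sum>j\<in>J. A r j x * w j x)) / A r l x)"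
    using N' r nz Ck_on_subset[OF on1 N'(3)] Ck_on_subset[OF on2 N'(3)]
    by (intro Ck_on_divide Ck_on_diff Ck_on_sum Ck_on_mult) auto
  then have "Ck_on k N' (w l)"
    by (rule Ck_on_cong_imp[OF N'(1), rotated]) (use pivot N'(3) in auto)
  then show ?case using N' N1(3) by blast
qed

lemma Ck_on_linear_solution:
  fixes A :: "'i \<Rightarrow> 'j \<Rightarrow> 'e::real_normed_vector \<Rightarrow> real"
  assumes "finite J" "open N" 
    and "\<And>i j. i \<in> I \<Longrightarrow> j \<in> J \<Longrightarrow> Ck_on k N (A i j)" "\<And>i. i \<in> I \<Longrightarrow> Ck_on k N (b i)"
    and "\<And>x i. x \<in> N \<Longrightarrow> i \<in> I \<Longrightarrow> (\<Sum>j\<in>J. A i j x * w j x) = b i x"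
    and "\<And>x c j. x \<in> N \<Longrightarrow> (\<And>i. i \<in> I \<Longrightarrow> (\<Sum>j\<in>J. A i j x * c j) = 0) \<Longrightarrow> j \<in> J \<Longrightarrow> c j = 0"
    and "j \<in> J"
  shows "Ck_on k N (w j)"
proof (rule Ck_on_locally)
  fix x assume x: "x \<in> N"
  have "\<exists>N'. open N' \<and> x \<in> N' \<and> N' \<subseteq> N \<and> (\<forall>j\<in>J. Ck_on k N' (w j))"
    by (rule Ck_on_linear_solution_local[where A = A and I = I and b = b]; use assms x in blast)
  then show "\<exists>N'. open N' \<and> x \<in> N' \<and> Ck_on k N' (w j)" using assms(7) by blast
qed

section \<open>Finite-dimensional inner product spaces\<close>

text \<open>An orthonormal basis. The last clause expresses spanning by the Fourier expansion, so
  that coordinates are inner products. In dimension zero the basis is \<open>{}\<close>.\<close>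

definition onb :: "'e::real_inner set \<Rightarrow> bool" where
  "onb B \<longleftrightarrow> finite B \<and> (\<forall>b\<in>B. \<forall>c\<in>B. b \<bullet> c = (if b = c then 1 else 0)) \<and>
     (\<forall>x. x = (\<Sum>b\<in>B. (x \<bullet> b) *\<^sub>R b))"

lemma onb_finite: "onb B \<Longrightarrow> finite B"
  by (simp add: onb_def)

lemma onb_inner: "onb B \<Longrightarrow> b \<in> B \<Longrightarrow> c \<in> B \<Longrightarrow> b \<bullet> c = (if b = c then 1 else 0)"
  by (simp add: onb_def)

lemma onb_expand: "onb B \<Longrightarrow> (\<Sum>b\<in>B. (x \<bullet> b) *\<^sub>R b) = x"
  by (metis onb_def)

lemma onb_coord:
  assumes "onb B" "c \<in> B"
  shows "(\<Sum>b\<in>B. u b *\<^sub>R b) \<bullet> c = u c"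
proof -
  have "(\<Sum>b\<in>B. u b *\<^sub>R b) \<bullet> c = (\<Sum>b\<in>B. if b = c then u b else 0)"
    unfolding inner_sum_left using assms by (intro sum.cong) (auto simp: onb_inner)
  then show ?thesis using onb_finite[OF assms(1)] assms(2) by simp
qed

lemma onb_eqI: "onb B \<Longrightarrow> (\<And>b. b \<in> B \<Longrightarrow> x \<bullet> b = y \<bullet> b) \<Longrightarrow> x = y"
  by (metis (no_types, lifting) onb_expand sum.cong)

lemma onb_real: "onb {1::real}"
  by (simp add: onb_def)

lemma onb_exists:
  assumes "\<exists>B::'e::real_inner set. finite B \<and> span B = UNIV"
  shows "\<exists>B::'e set. onb B"
proof -
  obtain B C :: "'e set" where "span B = UNIV" "finite C" "span C = span B" "pairwise orthogonal C"
    using assms basis_orthogonal by metis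
  \<comment> \<open>An orthogonal spanning set may contain 0, which cannot be normalised.\<close>
  define E where "E = (\<lambda>c. c /\<^sub>R norm c) ` (C - {0})"
  have on: "b \<bullet> c = (if b = c then 1 else 0)" if bc: "b \<in> E" "c \<in> E" for b c
  proof -
    obtain b' c' where b': "b' \<in> C" "b' \<noteq> 0" "b = b' /\<^sub>R norm b'" and c': "c' \<in> C" "c' \<noteq> 0" "c = c' /\<^sub>R norm c'"
      using bc unfolding E_def by blast
    show ?thesis
    proof (cases "b' = c'")
      case True
      then show ?thesis using b' c' by (simp add: dot_square_norm power2_eq_square)
    next
      case False
      then have "b' \<bullet> c' = 0" using b' c' \<open>pairwise orthogonal C\<close> by (auto simp: pairwise_def orthogonal_def)
      then have "b \<bullet> c = 0" using b' c' by simp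
      moreover have "b \<bullet> b = 1" using b' by (simp add: dot_square_norm power2_eq_square)
      ultimately show ?thesis by auto
    qed
  qed
  have "finite E" using \<open>finite C\<close> by (simp add: E_def)
  have "c \<in> span E" if "c \<in> C" for c
  proof (cases "c = 0")
    case False
    then have "norm c *\<^sub>R (c /\<^sub>R norm c) \<in> span E"
      using that by (intro span_scale span_base) (auto simp: E_def)
    then show ?thesis using False by simp
  qed (simp add: span_zero)
  then have "span C \<subseteq> span E" by (simp add: span_minimal subsetI)
  then have span: "span E = UNIV" using \<open>span C = span B\<close> \<open>span B = UNIV\<close> by auto
  have "x = (\<Sum>b\<in>E. (x \<bullet> b) *\<^sub>R b)" for x
  proof -
    have "x \<in> span E" using span by simp
    then obtain u where u: "x = (\<Sum>b\<in>E. u b *\<^sub>R b)"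
      using span_finite[OF \<open>finite E\<close>] by auto
    have "x \<bullet> c = u c" if "c \<in> E" for c
    proof -
      have "x \<bullet> c = (\<Sum>b\<in>E. if b = c then u b else 0)"
        unfolding u inner_sum_left using that by (intro sum.cong) (auto simp: on)
      then show ?thesis using that \<open>finite E\<close> by simp
    qed
    then show ?thesis using u by simp
  qed
  then have "onb E" using \<open>finite E\<close> on by (auto simp: onb_def)
  then show ?thesis by blast
qed

lemma onb_linear_expand:
  fixes f :: "'e::real_inner \<Rightarrow> 'f::real_vector"
  assumes "onb (B :: 'e set)" "linear f"
  shows "f x = (\<Sum>b\<in>B. (x \<bullet> b) *\<^sub>R f b)"
proof -
  have "f x = f (\<Sum>b\<in>B. (x \<bullet> b) *\<^sub>R b)" using onb_expand[OF assms(1)] by simp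
  then show ?thesis by (simp add: linear_sum[OF assms(2)] linear_scale[OF assms(2)])
qed

lemma onb_linear_imp_bounded_linear:
  fixes f :: "'e::real_inner \<Rightarrow> 'f::real_normed_vector"
  assumes "onb (B :: 'e set)" "linear f"
  shows "bounded_linear f"
proof -
  have "bounded_linear (\<lambda>x. \<Sum>b\<in>B. (x \<bullet> b) *\<^sub>R f b)"
    by (intro bounded_linear_sum bounded_linear_scaleR_const bounded_linear_inner_left)
  moreover have "f = (\<lambda>x. \<Sum>b\<in>B. (x \<bullet> b) *\<^sub>R f b)"
    by (rule ext) (rule onb_linear_expand[OF assms])
  ultimately show ?thesis by (rule forw_subst[rotated])
qed

text \<open>The ball is a closed part of the image of a box of coefficients, and that image is a
  finite sum of compact segments. Compactness serves twice: as completeness for the Banach fixed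
  point theorem, and to make supports of bump functions closed in a manifold.\<close>

lemma onb_compact_cball:
  fixes x :: "'e::real_inner"
  assumes "onb (B :: 'e set)"
  shows "compact (cball x r)"
proof -
  have "compact ((\<lambda>f. \<Sum>b\<in>F. f b *\<^sub>R b) ` {f. \<forall>b\<in>F. \<bar>f b\<bar> \<le> R})" if "finite F" for F :: "'e set" and R
    using that
  proof (induction F)
    case empty
    show ?case by (simp add: image_constant_conv)
  next
    case (insert c F)
    let ?K = "(\<lambda>f. \<Sum>b\<in>F. f b *\<^sub>R b) ` {f. \<forall>b\<in>F. \<bar>f b\<bar> \<le> R}"
    have "compact ((\<lambda>t. t *\<^sub>R c) ` {-R..R})"
      by (intro compact_continuous_image continuous_intros) auto
    then have *: "compact {y + z |y z. y \<in> (\<lambda>t. t *\<^sub>R c) ` {-R..R} \<and> z \<in> ?K}"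
      using compact_sums insert.IH by blast
    have "{y + z |y z. y \<in> (\<lambda>t. t *\<^sub>R c) ` {-R..R} \<and> z \<in> ?K}
        = (\<lambda>f. \<Sum>b\<in>insert c F. f b *\<^sub>R b) ` {f. \<forall>b\<in>insert c F. \<bar>f b\<bar> \<le> R}" (is "?L = ?R")
    proof (intro equalityI subsetI)
      fix w assume "w \<in> ?L"
      then obtain t f where tf: "t \<in> {-R..R}" "\<forall>b\<in>F. \<bar>f b\<bar> \<le> R" "w = t *\<^sub>R c + (\<Sum>b\<in>F. f b *\<^sub>R b)"
        by auto
      have "(\<Sum>b\<in>F. (f(c := t)) b *\<^sub>R b) = (\<Sum>b\<in>F. f b *\<^sub>R b)"
        using insert.hyps by (intro sum.cong) auto
      then have "w = (\<Sum>b\<in>insert c F. (f(c := t)) b *\<^sub>R b)"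
        using tf insert.hyps by simp
      then show "w \<in> ?R" using tf by (intro image_eqI[of _ _ "f(c := t)"]) (auto simp: abs_le_iff)
    next
      fix w assume "w \<in> ?R"
      then obtain f where f: "\<forall>b\<in>insert c F. \<bar>f b\<bar> \<le> R" "w = f c *\<^sub>R c + (\<Sum>b\<in>F. f b *\<^sub>R b)"
        using insert.hyps by auto
      then have "f c *\<^sub>R c \<in> (\<lambda>t. t *\<^sub>R c) ` {-R..R}" "(\<Sum>b\<in>F. f b *\<^sub>R b) \<in> ?K"
        by (auto simp: abs_le_iff)
      then show "w \<in> ?L" using f(2) by blast
    qed
    then show ?case using * by simp
  qed
  \<comment> \<open>Coordinates in an orthonormal basis are bounded by the norm, and points of the
    ball have norm at most \<open>norm x + \<bar>r\<bar>\<close>.\<close>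
  from this[OF onb_finite[OF assms], of "norm x + \<bar>r\<bar>"]
  have K: "compact ((\<lambda>f. \<Sum>b\<in>B. f b *\<^sub>R b) ` {f. \<forall>b\<in>B. \<bar>f b\<bar> \<le> norm x + \<bar>r\<bar>})" (is "compact ?K") .
  have "cball x r \<subseteq> ?K"
  proof
    fix y assume "y \<in> cball x r"
    then have "norm y \<le> norm x + \<bar>r\<bar>"
      using norm_triangle_ineq2[of y x] by (simp add: dist_norm norm_minus_commute)
    moreover have "\<bar>y \<bullet> b\<bar> \<le> norm y" if "b \<in> B" for b
    proof -
      have "norm b = 1" using onb_inner[OF assms that that] by (simp add: norm_eq_1)
      then show ?thesis using Cauchy_Schwarz_ineq2[of y b] by simp
    qed
    ultimately show "y \<in> ?K"
      using onb_expand[OF assms, of y] by (intro image_eqI[of _ _ "\<lambda>b. y \<bullet> b"]) force+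
  qed
  then show ?thesis using K compact_Int_closed[OF K closed_cball, of x r] by (simp add: Int_absorb1)
qed

text \<open>\<open>Ck_on\<close> speaks of derivatives in fixed directions, whereas in the chain
  rule the direction fed to the derivative of \<open>f\<close> varies with \<open>x\<close>.
  Expanding that direction in an orthonormal basis turns the derivative into a finite sum of
  products to which the induction hypothesis applies.\<close>

lemma Ck_on_compose:
  fixes g :: "'e::real_normed_vector \<Rightarrow> 'f::real_inner"
  assumes "onb (B :: 'f set)" "open S" "open T" "g ` S \<subseteq> T" "Ck_on k T f" "Ck_on k S g"
  shows "Ck_on k S (\<lambda>x. f (g x))"
  using assms(5,6)
proof (induction k arbitrary: f)
  case 0
  then show ?case using assms(4) by (auto intro: continuous_on_compose2)
next
  case (Suc k)
  have der: "((\<lambda>x. f (g x)) has_derivative (\<lambda>v. \<Sum>b\<in>B. (frechet_derivative g (at x) v \<bullet> b) *\<^sub>R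
      frechet_derivative f (at (g x)) b)) (at x)" if x: "x \<in> S" for x
  proof -
    have f: "(f has_derivative frechet_derivative f (at (g x))) (at (g x))"
      using Suc.prems assms(4) x by (intro Ck_on_Suc_has_derivative) auto
    have D: "((\<lambda>x. f (g x)) has_derivative (\<lambda>v. frechet_derivative f (at (g x)) (frechet_derivative g (at x) v))) (at x)"
      using has_derivative_compose[OF Ck_on_Suc_has_derivative[OF Suc.prems(2) x] f] .
    have E: "(\<lambda>v. frechet_derivative f (at (g x)) (frechet_derivative g (at x) v)) =
        (\<lambda>v. \<Sum>b\<in>B. (frechet_derivative g (at x) v \<bullet> b) *\<^sub>R frechet_derivative f (at (g x)) b)"
      by (rule ext, rule onb_linear_expand[OF assms(1) has_derivative_linear[OF f]])
    show ?thesis using D unfolding E .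
  qed
  show ?case
  proof (rule Ck_on_SucI[OF \<open>open S\<close>, where f' = "\<lambda>x v. \<Sum>b\<in>B.
      (frechet_derivative g (at x) v \<bullet> b) *\<^sub>R frechet_derivative f (at (g x)) b"])
    fix v
    have g: "Ck_on k S (\<lambda>x. frechet_derivative g (at x) v)"
      using Suc.prems(2) by (simp only: Ck_on.simps)
    have f: "Ck_on k T (\<lambda>y. frechet_derivative f (at y) b)" for b
      using Suc.prems(1) by (simp only: Ck_on.simps)
    have "Ck_on k S (\<lambda>x. frechet_derivative g (at x) v \<bullet> b)" for b
      using Ck_on_linear_compose[OF bounded_linear_inner_left assms(2) g] .
    moreover have "Ck_on k S (\<lambda>x. frechet_derivative f (at (g x)) b)" for b
      using Suc.IH[OF f] Ck_on_SucD[OF Suc.prems(2)] by blast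
    ultimately show "Ck_on k S (\<lambda>x. \<Sum>b\<in>B. (frechet_derivative g (at x) v \<bullet> b) *\<^sub>R frechet_derivative f (at (g x)) b)"
      by (intro Ck_on_sum Ck_on_scaleR assms(2))
  qed (fact der)
qed

lemma Ck_on_components:
  assumes "onb B" "open S" "\<And>b. b \<in> B \<Longrightarrow> Ck_on k S (\<lambda>x. f x \<bullet> b)"
  shows "Ck_on k S f"
proof -
  have "Ck_on k S (\<lambda>x. \<Sum>b\<in>B. (f x \<bullet> b) *\<^sub>R b)"
    using assms by (intro Ck_on_sum Ck_on_scaleR Ck_on_const) auto
  then show ?thesis using onb_expand[OF assms(1)] by simp
qed

section \<open>Symmetry of second derivatives\<close>

text \<open>The mean value theorem is applied twice: along \<open>u\<close> to the difference of
  \<open>f\<close> on two parallel segments, then along \<open>v\<close> to the derivative in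
  direction \<open>u\<close>. The left-hand side is symmetric in \<open>u\<close> and
  \<open>v\<close>, which is the point of the lemma.\<close>

lemma Ck_on_mixed_difference:
  fixes f :: "'e::real_normed_vector \<Rightarrow> real"
  assumes "Ck_on 2 S f" "s > 0" and S: "\<And>a b. a \<in> {0..s} \<Longrightarrow> b \<in> {0..s} \<Longrightarrow> x + a *\<^sub>R u + b *\<^sub>R v \<in> S"
  shows "\<exists>a\<in>{0..s}. \<exists>b\<in>{0..s}. f (x + s *\<^sub>R u + s *\<^sub>R v) - f (x + s *\<^sub>R u) - f (x + s *\<^sub>R v) + f x =
    s * s * frechet_derivative (\<lambda>y. frechet_derivative f (at y) u) (at (x + a *\<^sub>R u + b *\<^sub>R v)) v"
proof -
  let ?fu = "\<lambda>y. frechet_derivative f (at y) u"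
  have C: "Ck_on (Suc (Suc 0)) S f" using assms(1) by (simp add: numeral_2_eq_2)
  have d: "(f has_derivative frechet_derivative f (at y)) (at y)" if "y \<in> S" for y
    using Ck_on_Suc_has_derivative[OF C that] .
  have Cu: "Ck_on (Suc 0) S ?fu" using C by (metis Ck_on.simps(2))
  have du: "(?fu has_derivative frechet_derivative ?fu (at y)) (at y)" if "y \<in> S" for y
    using Ck_on_Suc_has_derivative[OF Cu that] .
  have lin: "linear (frechet_derivative f (at y))" "linear (frechet_derivative ?fu (at y))" if "y \<in> S" for y
    using has_derivative_linear d du that by blast+
  have line: "((\<lambda>a. f (y + a *\<^sub>R u)) has_real_derivative ?fu (y + a *\<^sub>R u)) (at a)" if "y + a *\<^sub>R u \<in> S" for y a
  proof -
    have "((\<lambda>a. f (y + a *\<^sub>R u)) has_derivative (\<lambda>t. frechet_derivative f (at (y + a *\<^sub>R u)) (t *\<^sub>R u))) (at a)"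
      using that by (intro has_derivative_compose[of "\<lambda>a. y + a *\<^sub>R u" "\<lambda>t. t *\<^sub>R u" a UNIV f] d) (auto intro!: derivative_eq_intros)
    then show ?thesis
      using linear_scale[OF lin(1)[OF that]] by (simp add: has_field_derivative_def mult_commute_abs)
  qed
  have linev: "((\<lambda>b. ?fu (y + b *\<^sub>R v)) has_real_derivative frechet_derivative ?fu (at (y + b *\<^sub>R v)) v) (at b)"
    if "y + b *\<^sub>R v \<in> S" for y b
  proof -
    have "((\<lambda>b. ?fu (y + b *\<^sub>R v)) has_derivative (\<lambda>t. frechet_derivative ?fu (at (y + b *\<^sub>R v)) (t *\<^sub>R v))) (at b)"
      using that by (intro has_derivative_compose[of "\<lambda>b. y + b *\<^sub>R v" "\<lambda>t. t *\<^sub>R v" b UNIV ?fu] du) (auto intro!: derivative_eq_intros)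
    then show ?thesis
      using linear_scale[OF lin(2)[OF that]] by (simp add: has_field_derivative_def mult_commute_abs)
  qed
  have "\<exists>a>0. a < s \<and> (f (x + s *\<^sub>R v + s *\<^sub>R u) - f (x + s *\<^sub>R u)) - (f (x + s *\<^sub>R v + 0 *\<^sub>R u) - f (x + 0 *\<^sub>R u))
      = (s - 0) * (?fu (x + s *\<^sub>R v + a *\<^sub>R u) - ?fu (x + a *\<^sub>R u))"
  proof (rule MVT2[OF \<open>s > 0\<close>])
    fix a assume a: "0 \<le> a" "a \<le> s"
    show "((\<lambda>a. f (x + s *\<^sub>R v + a *\<^sub>R u) - f (x + a *\<^sub>R u)) has_real_derivative
        (?fu (x + s *\<^sub>R v + a *\<^sub>R u) - ?fu (x + a *\<^sub>R u))) (at a)"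
    proof (rule DERIV_diff[OF line line])
      show "x + s *\<^sub>R v + a *\<^sub>R u \<in> S" "x + a *\<^sub>R u \<in> S"
        using S[of a s] S[of a 0] a \<open>s > 0\<close> by (simp_all add: add_ac)
    qed
  qed
  then obtain a where a: "0 < a" "a < s"
    "f (x + s *\<^sub>R u + s *\<^sub>R v) - f (x + s *\<^sub>R u) - f (x + s *\<^sub>R v) + f x
      = s * (?fu (x + a *\<^sub>R u + s *\<^sub>R v) - ?fu (x + a *\<^sub>R u))"
    by (auto simp: algebra_simps)
  have "\<exists>b>0. b < s \<and> ?fu (x + a *\<^sub>R u + s *\<^sub>R v) - ?fu (x + a *\<^sub>R u + 0 *\<^sub>R v)
      = (s - 0) * frechet_derivative ?fu (at (x + a *\<^sub>R u + b *\<^sub>R v)) v"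
    using S[of a] a by (intro MVT2[OF \<open>s > 0\<close>] linev) auto
  then obtain b where b: "0 < b" "b < s" "?fu (x + a *\<^sub>R u + s *\<^sub>R v) - ?fu (x + a *\<^sub>R u)
      = s * frechet_derivative ?fu (at (x + a *\<^sub>R u + b *\<^sub>R v)) v" by auto
  show ?thesis
    using a b by (intro bexI[of _ a] bexI[of _ b]) auto
qed

text \<open>The same second difference over a small parallelogram equals \<open>s * s\<close> times
  either mixed derivative, each taken at some point of the parallelogram; continuity of both at
  \<open>x\<close> forces equality.\<close>

lemma frechet_derivative_commute:
  fixes f :: "'e::real_normed_vector \<Rightarrow> real"
  assumes "open S" "x \<in> S" "Ck_on 2 S f"
  shows "frechet_derivative (\<lambda>y. frechet_derivative f (at y) u) (at x) v =
    frechet_derivative (\<lambda>y. frechet_derivative f (at y) v) (at x) u" (is "?P x = ?Q x")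
proof (rule ccontr)
  assume ne: "?P x \<noteq> ?Q x"
  \<comment> \<open>Half the gap: if \<open>?P\<close> and \<open>?Q\<close> take a common value at
    two points where each is closer than \<open>e\<close> to its value at \<open>x\<close>, the
    triangle inequality makes the gap smaller than itself.\<close>
  define e where "e = \<bar>?P x - ?Q x\<bar> / 2"
  have "e > 0" using ne by (simp add: e_def)
  have C: "Ck_on (Suc (Suc 0)) S f" using assms(3) by (simp add: numeral_2_eq_2)
  have "continuous_on S ?P" "continuous_on S ?Q"
    using C by auto
  then have "isCont ?P x" "isCont ?Q x" using assms(1,2) continuous_on_eq_continuous_at by blast+
  then have ev: "eventually (\<lambda>y. dist (?P y) (?P x) < e) (nhds x)" "eventually (\<lambda>y. dist (?Q y) (?Q x) < e) (nhds x)"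
    using \<open>e > 0\<close> by (metis isCont_def tendsto_at_iff_tendsto_nhds tendstoD)+
  have "eventually (\<lambda>y. y \<in> S) (nhds x)" using assms(1,2) eventually_nhds_in_open by blast
  with ev have "eventually (\<lambda>y. dist (?P y) (?P x) < e \<and> dist (?Q y) (?Q x) < e \<and> y \<in> S) (nhds x)"
    by eventually_elim simp
  then obtain r where r: "r > 0" "\<And>y. dist y x < r \<Longrightarrow> dist (?P y) (?P x) < e \<and> dist (?Q y) (?Q x) < e \<and> y \<in> S"
    by (auto simp: eventually_nhds_metric)
  \<comment> \<open>With \<open>s = r / 2 / K\<close> the parallelogram spanned by
    \<open>s *\<^sub>R u\<close> and \<open>s *\<^sub>R v\<close> stays within distance
    \<open>r / 2\<close> of \<open>x\<close>; the summand 1 keeps \<open>K\<close> positive.\<close>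
  define K where "K = norm u + norm v + 1"
  define s where "s = r / 2 / K"
  have pos: "K > 0" using norm_ge_zero[of u] norm_ge_zero[of v] unfolding K_def by linarith
  have "s > 0" using r pos by (simp add: s_def)
  have near: "dist (x + a *\<^sub>R u + b *\<^sub>R v) x < r" if "a \<in> {0..s}" "b \<in> {0..s}" for a b
  proof -
    have "dist (x + a *\<^sub>R u + b *\<^sub>R v) x = norm (a *\<^sub>R u + b *\<^sub>R v)" by (simp add: dist_norm)
    also have "\<dots> \<le> s * norm u + s * norm v"
      using that norm_triangle_ineq[of "a *\<^sub>R u" "b *\<^sub>R v"]
        mult_right_mono[of a s "norm u"] mult_right_mono[of b s "norm v"] by auto
    also have "\<dots> \<le> s * K" using \<open>s > 0\<close> by (simp add: K_def algebra_simps)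
    also have "\<dots> = r / 2" using pos by (simp add: s_def)
    also have "\<dots> < r" using r(1) by simp
    finally show ?thesis .
  qed
  have eq: "x + b *\<^sub>R v + a *\<^sub>R u = x + a *\<^sub>R u + b *\<^sub>R v" for a b by simp
  obtain a b where ab: "a \<in> {0..s}" "b \<in> {0..s}"
    "f (x + s *\<^sub>R u + s *\<^sub>R v) - f (x + s *\<^sub>R u) - f (x + s *\<^sub>R v) + f x = s * s * ?P (x + a *\<^sub>R u + b *\<^sub>R v)"
    using Ck_on_mixed_difference[OF assms(3) \<open>s > 0\<close>, of x u v] near r(2) by blast
  obtain c d where cd: "c \<in> {0..s}" "d \<in> {0..s}"
    "f (x + s *\<^sub>R v + s *\<^sub>R u) - f (x + s *\<^sub>R v) - f (x + s *\<^sub>R u) + f x = s * s * ?Q (x + c *\<^sub>R v + d *\<^sub>R u)"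
    using Ck_on_mixed_difference[OF assms(3) \<open>s > 0\<close>, of x v u] near r(2) eq by metis
  have "s * s * ?P (x + a *\<^sub>R u + b *\<^sub>R v) = s * s * ?Q (x + c *\<^sub>R v + d *\<^sub>R u)"
    using ab(3) cd(3) unfolding eq by linarith
  then have "?P (x + a *\<^sub>R u + b *\<^sub>R v) = ?Q (x + d *\<^sub>R u + c *\<^sub>R v)"
    using \<open>s > 0\<close> eq[of c d] by simp
  moreover have "dist (?P (x + a *\<^sub>R u + b *\<^sub>R v)) (?P x) < e" "dist (?Q (x + d *\<^sub>R u + c *\<^sub>R v)) (?Q x) < e"
    using r(2) near ab cd by blast+
  ultimately have "dist (?P x) (?Q x) < e + e"
    using dist_triangle2[of "?P x" "?Q x" "?P (x + a *\<^sub>R u + b *\<^sub>R v)"] by (simp add: dist_commute)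
  then show False by (simp add: e_def dist_real_def)
qed

section \<open>Smooth maps between inner product spaces\<close>

lemma smooth_on_cong:
  "open S \<Longrightarrow> (\<And>x. x \<in> S \<Longrightarrow> f x = g x) \<Longrightarrow> smooth_on S f \<Longrightarrow> smooth_on S g"
  unfolding smooth_on_def using Ck_on_cong_imp by blast

lemma smooth_on_subset: "smooth_on S f \<Longrightarrow> T \<subseteq> S \<Longrightarrow> smooth_on T f"
  unfolding smooth_on_def using Ck_on_subset by blast

lemma smooth_on_locally:
  "(\<And>x. x \<in> S \<Longrightarrow> \<exists>N. open N \<and> x \<in> N \<and> smooth_on N f) \<Longrightarrow> smooth_on S f"
  unfolding smooth_on_def by (intro allI Ck_on_locally) metis

lemma smooth_on_const: "smooth_on S (\<lambda>x. c)"
  by (simp add: smooth_on_def Ck_on_const)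

lemma smooth_on_ident: "open S \<Longrightarrow> smooth_on S (\<lambda>x. x)"
  by (simp add: smooth_on_def Ck_on_ident)

lemma smooth_on_linear_compose:
  "bounded_linear L \<Longrightarrow> open S \<Longrightarrow> smooth_on S f \<Longrightarrow> smooth_on S (\<lambda>x. L (f x))"
  by (simp add: smooth_on_def Ck_on_linear_compose)

lemma smooth_on_add: "open S \<Longrightarrow> smooth_on S f \<Longrightarrow> smooth_on S g \<Longrightarrow> smooth_on S (\<lambda>x. f x + g x)"
  by (simp add: smooth_on_def Ck_on_add)

lemma smooth_on_diff: "open S \<Longrightarrow> smooth_on S f \<Longrightarrow> smooth_on S g \<Longrightarrow> smooth_on S (\<lambda>x. f x - g x)"
  by (simp add: smooth_on_def Ck_on_diff)

lemma smooth_on_mult: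
  fixes f g :: "'e::real_normed_vector \<Rightarrow> real"
  shows "open S \<Longrightarrow> smooth_on S f \<Longrightarrow> smooth_on S g \<Longrightarrow> smooth_on S (\<lambda>x. f x * g x)"
  by (simp add: smooth_on_def Ck_on_mult)

lemma smooth_on_divide:
  fixes f g :: "'e::real_normed_vector \<Rightarrow> real"
  shows "open S \<Longrightarrow> smooth_on S f \<Longrightarrow> smooth_on S g \<Longrightarrow> (\<And>x. x \<in> S \<Longrightarrow> g x \<noteq> 0) \<Longrightarrow>
    smooth_on S (\<lambda>x. f x / g x)"
  by (simp add: smooth_on_def Ck_on_divide)

lemma smooth_on_compose:
  fixes g :: "'e::real_normed_vector \<Rightarrow> 'f::real_inner"
  shows "onb (B :: 'f set) \<Longrightarrow> open S \<Longrightarrow> open T \<Longrightarrow> g ` S \<subseteq> T \<Longrightarrow> smooth_on T f \<Longrightarrow> smooth_on S g \<Longrightarrow>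
    smooth_on S (\<lambda>x. f (g x))"
  by (simp add: smooth_on_def Ck_on_compose[where f = f and g = g and T = T])

lemma smooth_on_continuous_on: "smooth_on S f \<Longrightarrow> continuous_on S f"
  unfolding smooth_on_def by (metis Ck_on.simps(1))

lemma smooth_on_has_derivative:
  "smooth_on S f \<Longrightarrow> x \<in> S \<Longrightarrow> (f has_derivative frechet_derivative f (at x)) (at x)"
  unfolding smooth_on_def using Ck_on_Suc_has_derivative by blast

lemma smooth_on_frechet_derivative:
  "smooth_on S f \<Longrightarrow> smooth_on S (\<lambda>x. frechet_derivative f (at x) v)"
  unfolding smooth_on_def by (metis Ck_on.simps(2))

lemma smooth_on_norm_square:
  fixes a :: "'e::real_inner"
  shows "smooth_on UNIV (\<lambda>x. (x - a) \<bullet> (x - a))"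
proof -
  have "Ck_on (Suc k) UNIV (\<lambda>x. (x - a) \<bullet> (x - a))" for k
  proof (rule Ck_on_SucI[where f' = "\<lambda>x v. 2 * ((x - a) \<bullet> v)"])
    show "((\<lambda>x. (x - a) \<bullet> (x - a)) has_derivative (\<lambda>v. 2 * ((x - a) \<bullet> v))) (at x)" for x
      by (auto intro!: derivative_eq_intros simp: inner_commute)
    have "Ck_on k UNIV (\<lambda>x. (x - a) \<bullet> v)" for v
      by (rule Ck_on_linear_compose[OF bounded_linear_inner_left]; (rule Ck_on_diff)?)
        (simp_all add: Ck_on_ident Ck_on_const)
    then show "Ck_on k UNIV (\<lambda>x. 2 * ((x - a) \<bullet> v))" for v
      by (intro Ck_on_mult Ck_on_const) auto
  qed auto
  then show ?thesis unfolding smooth_on_def using Ck_on_SucD by blast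
qed

subsection \<open>Bump functions\<close>

text \<open>For \<open>p = [:1:]\<close> this is the classical function that is smooth but not
  analytic at 0. The polynomial factor is what repeated differentiation produces.\<close>

definition flat :: "real poly \<Rightarrow> real \<Rightarrow> real" where
  "flat p t = (if t > 0 then poly p (1 / t) * exp (- (1 / t)) else 0)"

text \<open>The functions \<open>flat p\<close> are closed under differentiation, hence all smooth.\<close>

lemma flat_at_0: "((\<lambda>t. flat p t / t) \<longlongrightarrow> 0) (at 0)"
proof (rule filterlim_split_at)
  have "((\<lambda>s. poly q s * exp (- s)) \<longlongrightarrow> 0) at_top" for q :: "real poly"
  proof -
    have "((\<lambda>s. \<Sum>i\<le>degree q. coeff q i * (s ^ i / exp s)) \<longlongrightarrow> (\<Sum>i\<le>degree q. coeff q i * 0)) at_top"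
      by (intro tendsto_sum tendsto_mult tendsto_const tendsto_power_div_exp_0)
    moreover have "(\<Sum>i\<le>degree q. coeff q i * (s ^ i / exp s)) = poly q s * exp (- s)" for s
      by (simp add: poly_altdef exp_minus sum_distrib_right divide_inverse mult.assoc)
    ultimately show ?thesis by simp
  qed
  \<comment> \<open>Division by \<open>t\<close> is multiplication by the variable
    \<open>s = 1 / t\<close> of the polynomial, hence the shift \<open>pCons 0 p\<close>.\<close>
  then have "((\<lambda>t. poly (pCons 0 p) (inverse t) * exp (- inverse t)) \<longlongrightarrow> 0) (at_right 0)"
    using filterlim_compose filterlim_inverse_at_top_right by blast
  then show "((\<lambda>t. flat p t / t) \<longlongrightarrow> 0) (at_right 0)"
    by (rule Lim_transform_eventually)
      (auto simp: flat_def eventually_at_filter divide_inverse mult_ac intro!: always_eventually)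
  show "((\<lambda>t. flat p t / t) \<longlongrightarrow> 0) (at_left 0)"
    by (rule Lim_transform_eventually[OF tendsto_const])
      (auto simp: flat_def eventually_at_filter intro!: always_eventually)
qed

text \<open>With \<open>s = 1 / t\<close>, differentiating \<open>poly p s * exp (- s)\<close> gives
  the factor \<open>s * s\<close> from the inner derivative, which is \<open>[:0, 0, 1:]\<close>,
  times \<open>p - pderiv p\<close>. At 0 the difference quotient is handled by
  \<open>flat_at_0\<close>.\<close>

lemma flat_has_derivative:
  "(flat p has_real_derivative flat ([:0, 0, 1:] * (p - pderiv p)) t) (at t)"
proof (cases "t = 0")
  case True
  have "((\<lambda>h. (flat p (0 + h) - flat p 0) / h) \<longlongrightarrow> 0) (at 0)"
    using flat_at_0[of p] by (simp add: flat_def)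
  then show ?thesis using True by (simp add: DERIV_def flat_def)
next
  case False
  show ?thesis
  proof (cases "t > 0")
    case True
    have "((\<lambda>t. poly p (1 / t) * exp (- (1 / t))) has_real_derivative
        flat ([:0, 0, 1:] * (p - pderiv p)) t) (at t)"
      using True by (auto intro!: derivative_eq_intros DERIV_chain2[OF poly_DERIV]
          simp: flat_def field_simps power2_eq_square)
    then show ?thesis
      by (rule has_field_derivative_transform_within_open[where S = "{0<..}"])
        (use True in \<open>auto simp: flat_def\<close>)
  next
    case F: False
    have "((\<lambda>t::real. 0::real) has_real_derivative flat ([:0, 0, 1:] * (p - pderiv p)) t) (at t)"
      using F by (simp add: flat_def)
    then show ?thesis
      by (rule has_field_derivative_transform_within_open[where S = "{..<0}"])
        (use F False in \<open>auto simp: flat_def\<close>)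
  qed
qed

lemma flat_smooth: "smooth_on UNIV (flat p)"
proof -
  have "Ck_on k UNIV (flat p)" for k
  proof (induction k arbitrary: p)
    case 0
    have "isCont (flat p) t" for t using flat_has_derivative by (rule DERIV_isCont)
    then show ?case by (simp add: continuous_at_imp_continuous_on)
  next
    case (Suc k)
    show ?case
    proof (rule Ck_on_SucI[where f' = "\<lambda>t v. flat ([:0, 0, 1:] * (p - pderiv p)) t * v"])
      show "(flat p has_derivative (\<lambda>v. flat ([:0, 0, 1:] * (p - pderiv p)) t * v)) (at t)" for t
        using flat_has_derivative[of p t] by (simp only: has_field_derivative_def)
      show "Ck_on k UNIV (\<lambda>t. flat ([:0, 0, 1:] * (p - pderiv p)) t * v)" for v
        by (intro Ck_on_mult Suc.IH Ck_on_const) auto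
    qed auto
  qed
  then show ?thesis by (simp add: smooth_on_def)
qed

lemma bump_function:
  fixes a :: "'e::real_inner"
  assumes "r > 0"
  shows "\<exists>\<beta> :: 'e \<Rightarrow> real. smooth_on UNIV \<beta> \<and> (\<forall>x\<in>cball a r. \<beta> x = 1) \<and> (\<forall>x. x \<notin> cball a (2 * r) \<longrightarrow> \<beta> x = 0)"
proof -
  let ?f = "flat [:1:]"
  \<comment> \<open>A smooth step: 0 for \<open>t \<le> 0\<close> and 1 for
    \<open>t \<ge> 1\<close>. The denominator never vanishes, since \<open>t\<close> and
    \<open>1 - t\<close> are not both non-positive.\<close>
  define h where "h t = ?f t / (?f t + ?f (1 - t))" for t
  have pos: "?f t + ?f (1 - t) \<noteq> 0" for t
    using exp_gt_zero[of "- (1 / t)"] exp_gt_zero[of "- (1 / (1 - t))"]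
    by (auto simp: flat_def add_nonneg_eq_0_iff)
  have "smooth_on UNIV (\<lambda>t. ?f (1 - t))"
    by (rule smooth_on_compose[OF onb_real, where T = UNIV and f = ?f])
      (simp_all add: flat_smooth smooth_on_diff smooth_on_ident smooth_on_const)
  then have h: "smooth_on UNIV h"
    unfolding h_def using pos by (intro smooth_on_divide smooth_on_add flat_smooth) auto
  have h0: "h t = 0" if "t \<le> 0" for t using that by (simp add: h_def flat_def)
  have h1: "h t = 1" if "t \<ge> 1" for t using that pos[of t] by (simp add: h_def flat_def)
  \<comment> \<open>The squared distance is smooth also at the centre. The argument of
    \<open>h\<close> is at least 1 on the ball of radius \<open>r\<close> and at most -2 outside the
    ball of radius \<open>2 * r\<close>.\<close>
  define \<beta> where "\<beta> x = h (2 - (x - a) \<bullet> (x - a) / r\<^sup>2)" for x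
  have q: "smooth_on UNIV (\<lambda>x. 2 - (x - a) \<bullet> (x - a) / r\<^sup>2)"
    using assms by (intro smooth_on_diff smooth_on_divide smooth_on_const smooth_on_norm_square) auto
  have "smooth_on UNIV \<beta>"
    unfolding \<beta>_def by (rule smooth_on_compose[OF onb_real open_UNIV open_UNIV _ h q]) simp
  moreover have "\<beta> x = 1" if "x \<in> cball a r" for x
  proof -
    have "(x - a) \<bullet> (x - a) \<le> r\<^sup>2"
      using that by (simp add: dot_square_norm dist_norm norm_minus_commute power_mono)
    then show ?thesis using assms by (simp add: \<beta>_def h1)
  qed
  moreover have "\<beta> x = 0" if "x \<notin> cball a (2 * r)" for x
  proof -
    have "(2 * r)\<^sup>2 \<le> (norm (x - a))\<^sup>2"
      using that assms by (intro power_mono) (auto simp: dist_norm norm_minus_commute)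
    then have "4 * r\<^sup>2 \<le> (x - a) \<bullet> (x - a)"
      by (simp add: dot_square_norm power_mult_distrib)
    then have "(x - a) \<bullet> (x - a) / r\<^sup>2 \<ge> 4" using assms by (simp add: field_simps)
    then show ?thesis by (simp add: \<beta>_def h0)
  qed
  ultimately show ?thesis by blast
qed

subsection \<open>Local inverses\<close>

text \<open>The inverse function theorem, normalised to derivative identity at \<open>x0\<close>.
  Near \<open>x0\<close> the map \<open>x - f x\<close> is a contraction with constant 1/2, and the
  Banach fixed point theorem provides preimages.\<close>

lemma smooth_local_inverse:
  fixes f :: "'k::real_inner \<Rightarrow> 'k"
  assumes B: "onb (B :: 'k set)" and S: "open S" "x0 \<in> S" and f: "smooth_on S f"
    and id: "frechet_derivative f (at x0) = (\<lambda>v. v)"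
  obtains U V h where "open U" "x0 \<in> U" "U \<subseteq> S" "open V" "f ` U \<subseteq> V" "h ` V \<subseteq> U"
    "\<And>x. x \<in> U \<Longrightarrow> h (f x) = x" "smooth_on V h"
proof -
  let ?D = "\<lambda>x. frechet_derivative f (at x)"
  have der: "(f has_derivative ?D x) (at x)" if "x \<in> S" for x
    using smooth_on_has_derivative[OF f that] .
  have lin: "linear (?D x)" if "x \<in> S" for x using der[OF that] has_derivative_linear by blast
  \<comment> \<open>Bounds the operator norm of the identity minus \<open>?D x\<close>. As a finite
    sum over the basis it is visibly continuous in \<open>x\<close>, and it vanishes at
    \<open>x0\<close>.\<close>
  define m where "m x = (\<Sum>b\<in>B. norm (b - ?D x b))" for x
  have mD: "norm (v - ?D x v) \<le> m x * norm v" if "x \<in> S" for x v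
  proof -
    have "linear (\<lambda>v. v - ?D x v)" using lin[OF that] by (intro linear_compose_sub linear_ident)
    then have "norm (v - ?D x v) = norm (\<Sum>b\<in>B. (v \<bullet> b) *\<^sub>R (b - ?D x b))"
      using onb_linear_expand[OF B] by metis
    also have "\<dots> \<le> (\<Sum>b\<in>B. norm ((v \<bullet> b) *\<^sub>R (b - ?D x b)))" by (rule norm_sum)
    also have "\<dots> \<le> (\<Sum>b\<in>B. norm v * norm (b - ?D x b))"
    proof (rule sum_mono)
      fix b assume b: "b \<in> B"
      have "norm b = 1" using onb_inner[OF B b b] by (simp add: norm_eq_1)
      then have "\<bar>v \<bullet> b\<bar> \<le> norm v" using Cauchy_Schwarz_ineq2[of v b] by simp
      then show "norm ((v \<bullet> b) *\<^sub>R (b - ?D x b)) \<le> norm v * norm (b - ?D x b)"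
        by (simp add: mult_right_mono)
    qed
    also have "\<dots> = m x * norm v" by (simp add: m_def sum_distrib_left mult.commute)
    finally show ?thesis .
  qed
  have "continuous_on S m"
    unfolding m_def by (intro continuous_intros smooth_on_continuous_on smooth_on_frechet_derivative f)
  then have "isCont m x0" using S continuous_on_eq_continuous_at by blast
  then have "eventually (\<lambda>x. dist (m x) (m x0) < 1/2) (nhds x0)"
    by (metis isCont_def tendsto_at_iff_tendsto_nhds tendstoD half_gt_zero zero_less_one)
  moreover have "eventually (\<lambda>x. x \<in> S) (nhds x0)" using S eventually_nhds_in_open by blast
  ultimately have "eventually (\<lambda>x. x \<in> S \<and> m x < 1/2) (nhds x0)"
    by eventually_elim (simp add: m_def id dist_real_def)
  then obtain \<epsilon> where \<epsilon>: "\<epsilon> > 0" "\<And>x. dist x x0 < \<epsilon> \<Longrightarrow> x \<in> S \<and> m x < 1/2"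
    by (auto simp: eventually_nhds_metric)
  \<comment> \<open>Halving makes the closed ball of radius \<open>r\<close> fit into the open ball
    of radius \<open>\<epsilon>\<close>.\<close>
  define r where "r = \<epsilon> / 2"
  have r: "r > 0" "\<And>x. x \<in> cball x0 r \<Longrightarrow> x \<in> S" "\<And>x. x \<in> cball x0 r \<Longrightarrow> m x \<le> 1/2"
    using \<epsilon> by (auto simp: r_def dist_commute less_imp_le)
  let ?C = "cball x0 r"
  have lip: "norm ((x - f x) - (y - f y)) \<le> 1/2 * norm (x - y)" if "x \<in> ?C" "y \<in> ?C" for x y
  proof (rule differentiable_bound[where f = "\<lambda>x. x - f x" and f' = "\<lambda>z v. v - ?D z v", OF convex_cball _ _ that])
    fix z assume z: "z \<in> ?C"
    show "((\<lambda>x. x - f x) has_derivative (\<lambda>v. v - ?D z v)) (at z within ?C)"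
      using has_derivative_at_withinI[OF der[OF r(2)[OF z]]] by (intro has_derivative_diff has_derivative_ident)
    show "onorm (\<lambda>v. v - ?D z v) \<le> 1/2"
    proof (rule onorm_bound)
      show "norm (v - ?D z v) \<le> 1/2 * norm v" for v
        using mD[OF r(2)[OF z], of v] mult_right_mono[OF r(3)[OF z] norm_ge_zero[of v]] by linarith
      show "(0::real) \<le> 1/2" by simp
    qed
  qed
  \<comment> \<open>This makes \<open>f\<close> injective on the ball and its inverse Lipschitz with
    constant 2.\<close>
  have dist2: "norm (x - y) \<le> 2 * norm (f x - f y)" if "x \<in> ?C" "y \<in> ?C" for x y
  proof -
    have "norm (x - y) = norm (((x - f x) - (y - f y)) + (f x - f y))" by simp
    also have "\<dots> \<le> norm ((x - f x) - (y - f y)) + norm (f x - f y)" by (rule norm_triangle_ineq)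
    finally show ?thesis using lip[OF that] by simp
  qed
  \<comment> \<open>Radius \<open>r / 2\<close> for \<open>y\<close> plus the contraction bound
    \<open>1/2 * r\<close> keeps the iteration below inside the ball of radius
    \<open>r\<close>.\<close>
  define V where "V = ball (f x0) (r / 2)"
  define U where "U = {x \<in> ball x0 r. f x \<in> V}"
  have surj: "\<exists>x\<in>ball x0 r. f x = y" if y: "y \<in> V" for y
  proof -
    \<comment> \<open>The fixed points of \<open>x \<mapsto> y + (x - f x)\<close> are the solutions
      of \<open>f x = y\<close>. The strict bound puts them into the open ball, although the fixed
      point theorem is applied on the closed one.\<close>
    have into: "y + (x - f x) \<in> ball x0 r" if x: "x \<in> ?C" for x
    proof -
      have "norm (y + (x - f x) - x0) = norm ((y - f x0) + ((x - f x) - (x0 - f x0)))"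
        by (simp add: algebra_simps)
      also have "\<dots> \<le> norm (y - f x0) + norm ((x - f x) - (x0 - f x0))" by (rule norm_triangle_ineq)
      also have "\<dots> < r / 2 + 1/2 * r"
      proof (rule add_less_le_mono)
        show "norm (y - f x0) < r / 2" using y by (simp add: V_def dist_norm norm_minus_commute)
        have "norm (x - x0) \<le> r" using x by (simp add: dist_norm norm_minus_commute)
        then show "norm ((x - f x) - (x0 - f x0)) \<le> 1/2 * r" using lip[OF x, of x0] r(1) by simp
      qed
      finally show ?thesis by (simp add: dist_norm norm_minus_commute)
    qed
    have "\<exists>!x\<in>?C. y + (x - f x) = x"
    proof (rule Banach_fix[where c = "1/2"])
      show "complete ?C" using onb_compact_cball[OF B] compact_imp_complete by blast
      show "?C \<noteq> {}" using r(1) by auto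
      show "(\<lambda>x. y + (x - f x)) ` ?C \<subseteq> ?C" using into by force
      show "dist (y + (x - f x)) (y + (z - f z)) \<le> 1/2 * dist x z" if "x \<in> ?C" "z \<in> ?C" for x z
        using lip[OF that] by (simp add: dist_norm)
    qed auto
    then obtain x where "x \<in> ?C" "y + (x - f x) = x" by blast
    then show ?thesis using into[of x] by (intro bexI[of _ x]) (auto simp: algebra_simps)
  qed
  define h where "h y = (SOME x. x \<in> ball x0 r \<and> f x = y)" for y
  have h: "h y \<in> ball x0 r" "f (h y) = y" if "y \<in> V" for y
  proof -
    have "\<exists>x. x \<in> ball x0 r \<and> f x = y" using surj[OF that] by blast
    then have "h y \<in> ball x0 r \<and> f (h y) = y" unfolding h_def by (rule someI_ex)
    then show "h y \<in> ball x0 r" "f (h y) = y" by blast+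
  qed
  have hf: "h (f x) = x" if "x \<in> U" for x
    using dist2[of "h (f x)" x] h[of "f x"] that by (auto simp: U_def less_imp_le)
  have "continuous_on (ball x0 r) f"
    using smooth_on_continuous_on[OF f] r(2) continuous_on_subset by (metis ball_subset_cball subsetI subset_trans)
  then have "open (f -` V \<inter> ball x0 r)" by (simp add: V_def continuous_on_open_vimage)
  then have U: "open U" "x0 \<in> U" "U \<subseteq> S"
    using r by (auto simp: U_def V_def vimage_def Int_def conj_commute)
  have "open V" by (simp add: V_def)
  have hV: "h y \<in> S" "h y \<in> ?C" if "y \<in> V" for y using h[OF that] r by (auto simp: less_imp_le)
  \<comment> \<open>A kernel vector satisfies \<open>norm v = norm (v - ?D (h y) v)\<close>, which
    is at most half of \<open>norm v\<close>.\<close>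
  have inj0: "v = 0" if "y \<in> V" "?D (h y) v = 0" for y v
  proof -
    have "norm v \<le> 0"
      using mD[OF hV(1)[OF that(1)], of v] mult_right_mono[OF r(3)[OF hV(2)[OF that(1)]] norm_ge_zero[of v]] that(2)
      by (simp del: norm_le_zero_iff)
    then show ?thesis by simp
  qed
  have contV: "continuous_on V h"
  proof (rule continuous_onI)
    fix y e :: real and z assume "z \<in> V" "(0::real) < e"
    show "\<exists>d>0. \<forall>y\<in>V. dist y z < d \<longrightarrow> dist (h y) (h z) \<le> e"
    proof (intro exI[of _ "e/2"] conjI ballI impI)
      show "dist (h y) (h z) \<le> e" if "y \<in> V" "dist y z < e/2" for y
        using dist2[OF hV(2) hV(2), of y z] h \<open>z \<in> V\<close> that by (simp add: dist_norm)
    qed (use \<open>0 < e\<close> in simp)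
  qed
  have derh: "(h has_derivative frechet_derivative h (at y)) (at y)" if y: "y \<in> V" for y
  proof -
    have l: "linear (?D (h y))" using lin hV(1)[OF y] by blast
    then have "inj (?D (h y))" using inj0[OF y] by (simp add: linear_injective_0)
    then obtain G where G: "linear G" "G \<circ> ?D (h y) = id" using linear_injective_left_inverse l by blast
    have "(h has_derivative G) (at y)"
      by (rule has_derivative_inverse_basic[where T = V])
        (use der hV[OF y] G onb_linear_imp_bounded_linear[OF B] contV \<open>open V\<close> y h(2)
          continuous_on_eq_continuous_at in blast)+
    then show ?thesis by (metis frechet_derivative_at)
  qed
  have solve: "?D (h y) (frechet_derivative h (at y) v) = v" if y: "y \<in> V" for y v
  proof -
    have "((\<lambda>y. f (h y)) has_derivative (\<lambda>v. ?D (h y) (frechet_derivative h (at y) v))) (at y)"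
      by (rule has_derivative_compose[OF derh[OF y] der[OF hV(1)[OF y]]])
    then have "((\<lambda>y. y) has_derivative (\<lambda>v. ?D (h y) (frechet_derivative h (at y) v))) (at y)"
      by (rule has_derivative_transform_within_open[OF _ \<open>open V\<close> y]) (rule h(2))
    then show ?thesis using has_derivative_unique[OF _ has_derivative_ident] by metis
  qed
  \<comment> \<open>Bootstrapping: by \<open>solve\<close>, the components of the derivative of
    \<open>h\<close> satisfy a linear system with coefficients \<open>?D (h y)\<close>, which are of
    class C^k once \<open>h\<close> is.\<close>
  have "Ck_on k V h" for k
  proof (induction k)
    case 0
    then show ?case using contV by simp
  next
    case (Suc k)
    show ?case
    proof (rule Ck_on_SucI[OF \<open>open V\<close>, where f' = "\<lambda>y. frechet_derivative h (at y)"])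
      fix v
      show "Ck_on k V (\<lambda>y. frechet_derivative h (at y) v)"
      proof (rule Ck_on_components[OF B \<open>open V\<close>])
        fix b assume "b \<in> B"
        show "Ck_on k V (\<lambda>y. frechet_derivative h (at y) v \<bullet> b)"
        proof (rule Ck_on_linear_solution[where J = B and I = B and w = "\<lambda>b y. frechet_derivative h (at y) v \<bullet> b"
              and A = "\<lambda>c b y. ?D (h y) b \<bullet> c" and b = "\<lambda>c y. v \<bullet> c"])
          show "finite B" using B onb_finite by blast
          show "open V" "b \<in> B" by fact+
          show "Ck_on k V (\<lambda>y. v \<bullet> c)" for c by (rule Ck_on_const)
          show "Ck_on k V (\<lambda>y. ?D (h y) b \<bullet> c)" for c b
          proof (rule Ck_on_linear_compose[OF bounded_linear_inner_left \<open>open V\<close>])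
            have "Ck_on k S (\<lambda>x. ?D x b)"
              using smooth_on_frechet_derivative[OF f] by (simp add: smooth_on_def)
            then show "Ck_on k V (\<lambda>y. ?D (h y) b)"
              by (rule Ck_on_compose[OF B \<open>open V\<close> S(1), rotated]) (use Suc hV in auto)
          qed
          have expand: "(\<Sum>b\<in>B. ?D (h y) b \<bullet> c * u b) = ?D (h y) (\<Sum>b\<in>B. u b *\<^sub>R b) \<bullet> c" if "y \<in> V" for y c u
          proof -
            have "?D (h y) (\<Sum>b\<in>B. u b *\<^sub>R b) = (\<Sum>b\<in>B. u b *\<^sub>R ?D (h y) b)"
              using lin[OF hV(1)[OF that]] by (simp add: linear_sum linear_scale)
            then show ?thesis by (simp add: inner_sum_left mult.commute)
          qed
          show "(\<Sum>b\<in>B. ?D (h y) b \<bullet> c * (frechet_derivative h (at y) v \<bullet> b)) = v \<bullet> c" if "y \<in> V" for y c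
            using expand[OF that] solve[OF that] by (simp add: onb_expand[OF B])
          show "u j = 0" if "y \<in> V" "\<And>c. c \<in> B \<Longrightarrow> (\<Sum>b\<in>B. ?D (h y) b \<bullet> c * u b) = 0" "j \<in> B" for y u j
          proof -
            have "?D (h y) (\<Sum>b\<in>B. u b *\<^sub>R b) = 0"
              by (rule onb_eqI[OF B]) (use expand that in simp)
            then have "(\<Sum>b\<in>B. u b *\<^sub>R b) = 0" using inj0 that(1) by blast
            then show ?thesis using onb_coord[OF B that(3), of u] by simp
          qed
        qed
      qed
    qed (rule derh)
  qed
  then have "smooth_on V h" by (simp add: smooth_on_def)
  moreover have "f ` U \<subseteq> V" by (auto simp: U_def)
  moreover have "h ` V \<subseteq> U" using h by (auto simp: U_def)
  ultimately show ?thesis using that U \<open>open V\<close> hf by blast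
qed

text \<open>A linear left inverse \<open>L\<close> of the derivative reduces the immersion to a map
  between spaces of equal dimension: \<open>L (F x)\<close> has derivative identity at
  \<open>x0\<close>. Its local inverse after \<open>L\<close> is the retraction
  \<open>G\<close>.\<close>

lemma smooth_local_left_inverse:
  fixes F :: "'k::real_inner \<Rightarrow> 'm::real_inner"
  assumes B: "onb (B :: 'k set)" and C: "onb (C :: 'm set)" and S: "open S" "x0 \<in> S"
    and F: "smooth_on S F" and inj: "inj (frechet_derivative F (at x0))"
  obtains U W G where "open U" "x0 \<in> U" "U \<subseteq> S" "open W" "F ` U \<subseteq> W" "G ` W \<subseteq> U"
    "\<And>x. x \<in> U \<Longrightarrow> G (F x) = x" "smooth_on W G"
proof -
  have D: "(F has_derivative frechet_derivative F (at x0)) (at x0)"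
    using smooth_on_has_derivative[OF F S(2)] .
  then obtain L where L: "linear L" "L \<circ> frechet_derivative F (at x0) = id"
    using linear_injective_left_inverse[OF has_derivative_linear[OF D] inj] by blast
  have bl: "bounded_linear L" using onb_linear_imp_bounded_linear[OF C L(1)] .
  have "L (frechet_derivative F (at x0) v) = v" for v using L(2) by (simp add: fun_eq_iff)
  then have "((\<lambda>x. L (F x)) has_derivative (\<lambda>v. v)) (at x0)"
    using bounded_linear.has_derivative[OF bl D] by simp
  then have id: "frechet_derivative (\<lambda>x. L (F x)) (at x0) = (\<lambda>v. v)"
    by (rule frechet_derivative_at[symmetric])
  obtain U V h where U: "open U" "x0 \<in> U" "U \<subseteq> S" "open V" "(\<lambda>x. L (F x)) ` U \<subseteq> V" "h ` V \<subseteq> U"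
    "\<And>x. x \<in> U \<Longrightarrow> h (L (F x)) = x" "smooth_on V h"
    by (rule smooth_local_inverse[OF B S smooth_on_linear_compose[OF bl S(1) F] id]) (rule that; assumption)
  show ?thesis
  proof (rule that[OF U(1-3)])
    have "isCont L y" for y using linear_continuous_at[OF bl] .
    then show o: "open (L -` V)"
      by (rule continuous_open_vimage[OF \<open>open V\<close>])
    show "smooth_on (L -` V) (\<lambda>y. h (L y))"
      by (rule smooth_on_compose[OF B o U(4) _ U(8) smooth_on_linear_compose[OF bl o smooth_on_ident[OF o]]]) auto
  qed (use U in auto)
qed

section \<open>Charts and smooth maps\<close>

lemma smooth_manifold_onb:
  fixes M :: "('a, 'e::real_inner) manifold"
  assumes "smooth_manifold M"
  obtains B :: "'e set" where "onb B"
proof -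
  have "\<exists>B::'e set. finite B \<and> span B = UNIV" using assms by (simp add: smooth_manifold_def)
  then show ?thesis using onb_exists that by blast
qed

lemma chart_facts:
  assumes "smooth_manifold M" "(U, \<phi>) \<in> charts M"
  shows "openin (mtop M) U" "open (\<phi> ` U)" "U \<subseteq> topspace (mtop M)" "inj_on \<phi> U"
    "homeomorphic_map (subtopology (mtop M) U) (top_of_set (\<phi> ` U)) \<phi>"
proof -
  show *: "openin (mtop M) U" "open (\<phi> ` U)" "homeomorphic_map (subtopology (mtop M) U) (top_of_set (\<phi> ` U)) \<phi>"
  proof -
    have "\<forall>u\<in>charts M. openin (mtop M) (fst u) \<and> open (snd u ` fst u) \<and>
        homeomorphic_map (subtopology (mtop M) (fst u)) (top_of_set (snd u ` fst u)) (snd u)"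
      using assms(1) by (simp add: smooth_manifold_def case_prod_unfold)
    from bspec[OF this assms(2)] show "openin (mtop M) U" "open (\<phi> ` U)"
      "homeomorphic_map (subtopology (mtop M) U) (top_of_set (\<phi> ` U)) \<phi>" by simp_all
  qed
  show U: "U \<subseteq> topspace (mtop M)" using *(1) openin_subset by blast
  show "inj_on \<phi> U"
    using homeomorphic_imp_injective_map[OF *(3)] U by (simp add: topspace_subtopology Int_absorb1)
qed

lemma chart_at:
  assumes "smooth_manifold M" "p \<in> topspace (mtop M)"
  obtains U \<phi> where "(U, \<phi>) \<in> charts M" "p \<in> U"
proof -
  have "(\<Union>(U, \<phi>)\<in>charts M. U) = topspace (mtop M)" using assms(1) by (simp add: smooth_manifold_def)
  then show ?thesis using assms(2) that by blast
qed

lemma chart_transition: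
  assumes "smooth_manifold M" "(U, \<phi>) \<in> charts M" "(V, \<psi>) \<in> charts M"
  shows "smooth_on (\<phi> ` (U \<inter> V)) (\<lambda>y. \<psi> (inv_into U \<phi> y))"
proof -
  have "\<forall>u\<in>charts M. \<forall>v\<in>charts M. smooth_on (snd u ` (fst u \<inter> fst v)) (snd v \<circ> inv_into (fst u) (snd u))"
    using assms(1) by (simp add: smooth_manifold_def case_prod_unfold)
  from bspec[OF bspec[OF this assms(2)] assms(3)] show ?thesis by (simp add: o_def)
qed

lemma chart_inv [simp]:
  assumes "smooth_manifold M" "(U, \<phi>) \<in> charts M" "q \<in> U"
  shows "inv_into U \<phi> (\<phi> q) = q"
  using chart_facts(4)[OF assms(1,2)] assms(3) by simp

lemma chart_open_image:
  assumes "smooth_manifold M" "(U, \<phi>) \<in> charts M" "openin (mtop M) W" "W \<subseteq> U"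
  shows "open (\<phi> ` W)"
proof -
  note c = chart_facts[OF assms(1,2)]
  have "openin (subtopology (mtop M) U) W"
    using assms(3,4) c(1) by (simp add: openin_open_subtopology)
  then have "openin (top_of_set (\<phi> ` U)) (\<phi> ` W)"
    using homeomorphic_imp_open_map[OF c(5)] by (simp add: open_map_def)
  then show ?thesis using c(2) openin_open_eq by blast
qed

lemma chart_open_preimage:
  assumes "smooth_manifold M" "(U, \<phi>) \<in> charts M" "open N"
  shows "openin (mtop M) {q \<in> U. \<phi> q \<in> N}"
proof -
  note c = chart_facts[OF assms(1,2)]
  have "continuous_map (subtopology (mtop M) U) euclidean \<phi>"
    using homeomorphic_imp_continuous_map[OF c(5)] continuous_map_in_subtopology by blast
  then have "openin (subtopology (mtop M) U) {q \<in> topspace (subtopology (mtop M) U). \<phi> q \<in> N}"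
    by (rule openin_continuous_map_preimage) (simp add: assms(3))
  then have "openin (subtopology (mtop M) U) {q \<in> U. \<phi> q \<in> N}"
    using c(3) by (simp add: Int_absorb1)
  then show ?thesis using c(1) openin_trans_full by blast
qed

lemma chart_inv_continuous:
  assumes M: "smooth_manifold M" and U: "(U, \<phi>) \<in> charts M"
  shows "continuous_map (top_of_set (\<phi> ` U)) (subtopology (mtop M) U) (inv_into U \<phi>)"
proof -
  note c = chart_facts[OF M U]
  obtain h where h: "homeomorphic_maps (subtopology (mtop M) U) (top_of_set (\<phi> ` U)) \<phi> h"
    using c(5) homeomorphic_map_maps by blast
  have "h y = inv_into U \<phi> y" if "y \<in> \<phi> ` U" for y
    using h that c(3) chart_inv[OF M U] unfolding homeomorphic_maps_def by (auto simp: Int_absorb1)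
  then show ?thesis
    using h continuous_map_eq unfolding homeomorphic_maps_def by (metis topspace_euclidean_subtopology)
qed

lemma smooth_map_chart:
  assumes "smooth_map M N F" "(U, \<phi>) \<in> charts M" "(V, \<psi>) \<in> charts N"
  shows "smooth_on (\<phi> ` (U \<inter> F -` V)) (\<psi> \<circ> F \<circ> inv_into U \<phi>)"
proof -
  have "\<forall>u\<in>charts M. \<forall>v\<in>charts N.
      smooth_on (snd u ` (fst u \<inter> F -` fst v)) (snd v \<circ> F \<circ> inv_into (fst u) (snd u))"
    using assms(1) by (simp add: smooth_map_def case_prod_unfold)
  from bspec[OF bspec[OF this assms(2)] assms(3)] show ?thesis by simp
qed

text \<open>The definition tests charts of \<open>M\<close> against charts of \<open>P\<close>, but
  the image of one chart of \<open>M\<close> need not fit into one chart of \<open>N\<close>.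
  Smoothness is therefore checked locally, through a chart of \<open>N\<close> around each point
  \<open>F p\<close>.\<close>

lemma smooth_map_compose:
  fixes M :: "('a, 'e::real_inner) manifold" and N :: "('b, 'f::real_inner) manifold"
    and P :: "('c, 'g::real_inner) manifold"
  assumes M: "smooth_manifold M" and N: "smooth_manifold N" and P: "smooth_manifold P"
    and F: "smooth_map M N F" and G: "smooth_map N P G"
  shows "smooth_map M P (G \<circ> F)"
proof -
  have cF: "continuous_map (mtop M) (mtop N) F" and cG: "continuous_map (mtop N) (mtop P) G"
    using F G by (simp_all add: smooth_map_def)
  have "smooth_on (\<phi> ` (U \<inter> (G \<circ> F) -` V)) (\<psi> \<circ> (G \<circ> F) \<circ> inv_into U \<phi>)"
    if U: "(U, \<phi>) \<in> charts M" and V: "(V, \<psi>) \<in> charts P" for U \<phi> V \<psi>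
  proof (rule smooth_on_locally)
    obtain B :: "'f set" where B: "onb B" using smooth_manifold_onb[OF N] by blast
    fix y assume "y \<in> \<phi> ` (U \<inter> (G \<circ> F) -` V)"
    then obtain p where p: "p \<in> U" "G (F p) \<in> V" "y = \<phi> p" by auto
    have "F p \<in> topspace (mtop N)"
      using p(1) chart_facts(3)[OF M U] continuous_map_image_subset_topspace[OF cF] by blast
    then obtain X \<theta> where X: "(X, \<theta>) \<in> charts N" "F p \<in> X" using chart_at[OF N] by metis
    define XV where "XV = X \<inter> G -` V"
    have "openin (mtop N) {q \<in> topspace (mtop N). G q \<in> V}"
      using openin_continuous_map_preimage[OF cG] chart_facts(1)[OF P V] by blast
    moreover have "XV = X \<inter> {q \<in> topspace (mtop N). G q \<in> V}"
      using chart_facts(3)[OF N X(1)] by (auto simp: XV_def)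
    ultimately have oXV: "openin (mtop N) XV" using chart_facts(1)[OF N X(1)] by auto
    define UX where "UX = U \<inter> F -` XV"
    have "openin (mtop M) {q \<in> topspace (mtop M). F q \<in> XV}"
      using openin_continuous_map_preimage[OF cF] oXV by blast
    moreover have "UX = U \<inter> {q \<in> topspace (mtop M). F q \<in> XV}"
      using chart_facts(3)[OF M U] by (auto simp: UX_def)
    ultimately have oUX: "openin (mtop M) UX" using chart_facts(1)[OF M U] by auto
    have o1: "open (\<phi> ` UX)" using chart_open_image[OF M U oUX] by (auto simp: UX_def)
    have o2: "open (\<theta> ` XV)" using chart_open_image[OF N X(1) oXV] by (auto simp: XV_def)
    have s1: "smooth_on (\<phi> ` UX) (\<theta> \<circ> F \<circ> inv_into U \<phi>)"
    proof (rule smooth_on_subset)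
      show "smooth_on (\<phi> ` (U \<inter> F -` X)) (\<theta> \<circ> F \<circ> inv_into U \<phi>)"
        by (rule smooth_map_chart[OF F U X(1)])
    qed (auto simp: UX_def XV_def)
    have s2: "smooth_on (\<theta> ` XV) (\<psi> \<circ> G \<circ> inv_into X \<theta>)"
      unfolding XV_def by (rule smooth_map_chart[OF G X(1) V])
    have "smooth_on (\<phi> ` UX) (\<lambda>y. (\<psi> \<circ> G \<circ> inv_into X \<theta>) ((\<theta> \<circ> F \<circ> inv_into U \<phi>) y))"
      by (rule smooth_on_compose[OF B o1 o2 _ s2 s1]) (auto simp: UX_def chart_inv[OF M U])
    then have "smooth_on (\<phi> ` UX) (\<psi> \<circ> (G \<circ> F) \<circ> inv_into U \<phi>)"
      by (rule smooth_on_cong[OF o1, rotated]) (auto simp: UX_def XV_def chart_inv[OF M U] chart_inv[OF N X(1)])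
    moreover have "y \<in> \<phi> ` UX" using p X by (auto simp: UX_def XV_def)
    ultimately show "\<exists>N. open N \<and> y \<in> N \<and> smooth_on N (\<psi> \<circ> (G \<circ> F) \<circ> inv_into U \<phi>)"
      using o1 by blast
  qed
  then show ?thesis
    using continuous_map_compose[OF cF cG] by (auto simp: smooth_map_def)
qed

lemma onb_span: "onb B \<Longrightarrow> finite B \<and> span B = UNIV"
proof -
  assume B: "onb B"
  have "x \<in> span B" for x
  proof -
    have "(\<Sum>b\<in>B. (x \<bullet> b) *\<^sub>R b) \<in> span B" by (intro span_sum span_scale span_base)
    then show ?thesis using onb_expand[OF B] by simp
  qed
  then show ?thesis using onb_finite[OF B] by auto
qed

text \<open>Covers the real line and the open intervals, so that functions and curves fall under
  \<open>smooth_map_compose\<close>.\<close>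

lemma smooth_manifold_open_subset_real:
  assumes "open S"
  shows "smooth_manifold \<lparr>mtop = top_of_set S, charts = {(S :: real set, \<lambda>t. t)}\<rparr>"
proof -
  have inv: "inv_into S (\<lambda>t. t) y = y" if "y \<in> S" for y
    using inv_into_f_f[of "\<lambda>t. t" S y] that by (simp add: inj_on_def)
  obtain \<B> :: "real set set" where \<B>: "countable \<B>" "topological_basis \<B>"
    using ex_countable_basis by blast
  have "second_countable (euclidean :: real topology)"
    unfolding second_countable_def
  proof (intro exI conjI allI impI ballI)
    show "countable \<B>" by fact
    show "openin euclidean V" if "V \<in> \<B>" for V using \<B>(2) that topological_basis_open by auto
    show "\<exists>V\<in>\<B>. x \<in> V \<and> V \<subseteq> U" if "openin euclidean U \<and> x \<in> U" for U x
      using topological_basisE[OF \<B>(2), of U x] that by auto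
  qed
  then have "second_countable (top_of_set S)" by (rule second_countable_subtopology)
  moreover have "smooth_on S (\<lambda>y. inv_into S (\<lambda>t. t) y)"
    by (rule smooth_on_cong[OF assms _ smooth_on_ident[OF assms]]) (simp add: inv)
  moreover have "Hausdorff_space (top_of_set S)"
    by (simp add: Hausdorff_space_subtopology Hausdorff_space_euclidean)
  moreover have "homeomorphic_map (top_of_set S) (top_of_set S) (\<lambda>t. t)"
    using homeomorphic_map_id[of "top_of_set S" "top_of_set S"] by (simp add: id_def)
  moreover have "\<exists>B::real set. finite B \<and> span B = UNIV" using onb_span[OF onb_real] by blast
  ultimately show ?thesis
    using assms by (simp add: smooth_manifold_def o_def subtopology_subtopology)
qed

lemma smooth_manifold_real: "smooth_manifold real_manifold"
  using smooth_manifold_open_subset_real[of UNIV] by (simp add: real_manifold_def)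

lemma smooth_manifold_interval: "smooth_manifold (open_interval_manifold e)"
  using smooth_manifold_open_subset_real[of "{-e<..<e}"] by (simp add: open_interval_manifold_def)

section \<open>The algebra of smooth functions\<close>

lemma smooth_functions_compose:
  assumes "smooth_manifold M" "smooth_manifold N" "smooth_map M N F" "f \<in> smooth_functions N"
  shows "(\<lambda>p. f (F p)) \<in> smooth_functions M"
  using smooth_map_compose[OF assms(1,2) smooth_manifold_real assms(3), of f] assms(4)
  by (simp add: smooth_functions_def o_def)

lemma smooth_functions_chart:
  assumes "smooth_manifold M" "f \<in> smooth_functions M" "(U, \<phi>) \<in> charts M"
  shows "smooth_on (\<phi> ` U) (\<lambda>y. f (inv_into U \<phi> y))"
proof -
  have "smooth_on (\<phi> ` (U \<inter> f -` UNIV)) ((\<lambda>t. t) \<circ> f \<circ> inv_into U \<phi>)"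
    using assms(2,3) by (intro smooth_map_chart[of M real_manifold])
      (simp_all add: smooth_functions_def real_manifold_def)
  then show ?thesis by (simp add: o_def)
qed

text \<open>One chart around each point suffices: transition maps carry smoothness to all other
  charts, and global continuity is read off from the local expressions.\<close>

lemma smooth_functionsI:
  fixes M :: "('a, 'e::real_inner) manifold"
  assumes M: "smooth_manifold M"
    and loc: "\<And>p. p \<in> topspace (mtop M) \<Longrightarrow> \<exists>U \<phi> W. (U, \<phi>) \<in> charts M \<and> openin (mtop M) W \<and> p \<in> W \<and> W \<subseteq> U \<and>
       smooth_on (\<phi> ` W) (\<lambda>y. f (inv_into U \<phi> y))"
  shows "f \<in> smooth_functions M"
proof -
  obtain B :: "'e set" where B: "onb B" using smooth_manifold_onb[OF M] by blast
  have nbhd: "\<exists>T. openin (mtop M) T \<and> p \<in> T \<and> (\<forall>q\<in>T. f q \<in> S)"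
    if "open S" "p \<in> topspace (mtop M)" "f p \<in> S" for S p
  proof -
    obtain U \<phi> W where W: "(U, \<phi>) \<in> charts M" "openin (mtop M) W" "p \<in> W" "W \<subseteq> U"
      "smooth_on (\<phi> ` W) (\<lambda>y. f (inv_into U \<phi> y))" using loc \<open>p \<in> topspace (mtop M)\<close> by metis
    have o: "open (\<phi> ` W)" using chart_open_image[OF M W(1,2,4)] .
    have o2: "open ((\<lambda>y. f (inv_into U \<phi> y)) -` S \<inter> \<phi> ` W)"
      using smooth_on_continuous_on[OF W(5)] continuous_on_open_vimage[OF o] that(1) by blast
    show ?thesis
    proof (intro exI conjI ballI)
      show "openin (mtop M) {q \<in> U. \<phi> q \<in> (\<lambda>y. f (inv_into U \<phi> y)) -` S \<inter> \<phi> ` W}"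
        by (rule chart_open_preimage[OF M W(1) o2])
      show "p \<in> {q \<in> U. \<phi> q \<in> (\<lambda>y. f (inv_into U \<phi> y)) -` S \<inter> \<phi> ` W}"
        using W that chart_inv[OF M W(1)] by auto
      show "f q \<in> S" if "q \<in> {q \<in> U. \<phi> q \<in> (\<lambda>y. f (inv_into U \<phi> y)) -` S \<inter> \<phi> ` W}" for q
        using that chart_inv[OF M W(1), of q] by simp
    qed
  qed
  have "openin (mtop M) {q \<in> topspace (mtop M). f q \<in> S}" if "open S" for S
  proof (subst openin_subopen, intro ballI)
    fix p assume "p \<in> {q \<in> topspace (mtop M). f q \<in> S}"
    then obtain T where "openin (mtop M) T" "p \<in> T" "\<forall>q\<in>T. f q \<in> S" using nbhd \<open>open S\<close> by blast
    then show "\<exists>T. openin (mtop M) T \<and> p \<in> T \<and> T \<subseteq> {q \<in> topspace (mtop M). f q \<in> S}"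
      using openin_subset[of "mtop M" T] by blast
  qed
  then have "continuous_map (mtop M) euclidean f"
    by (simp add: continuous_map_def)
  moreover have "smooth_on (\<psi> ` V) (\<lambda>y. f (inv_into V \<psi> y))" if V: "(V, \<psi>) \<in> charts M" for V \<psi>
  proof (rule smooth_on_locally)
    fix y assume "y \<in> \<psi> ` V"
    then obtain p where p: "p \<in> V" "y = \<psi> p" by blast
    then have "p \<in> topspace (mtop M)" using chart_facts(3)[OF M V] by blast
    then obtain U \<phi> W where W: "(U, \<phi>) \<in> charts M" "openin (mtop M) W" "p \<in> W" "W \<subseteq> U"
      "smooth_on (\<phi> ` W) (\<lambda>y. f (inv_into U \<phi> y))" using loc by metis
    have oW: "open (\<phi> ` W)" using chart_open_image[OF M W(1,2,4)] .
    have oV: "open (\<psi> ` (V \<inter> W))"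
      using chart_open_image[OF M V, of "V \<inter> W"] chart_facts(1)[OF M V] W(2) by blast
    have s: "smooth_on (\<psi> ` (V \<inter> W)) (\<lambda>y. \<phi> (inv_into V \<psi> y))"
      using smooth_on_subset[OF chart_transition[OF M V W(1)]] W(4) by (meson Int_mono image_mono subset_refl)
    have "smooth_on (\<psi> ` (V \<inter> W)) (\<lambda>y. (\<lambda>y. f (inv_into U \<phi> y)) (\<phi> (inv_into V \<psi> y)))"
      by (rule smooth_on_compose[OF B oV oW _ W(5) s]) (auto simp: chart_inv[OF M V])
    then have "smooth_on (\<psi> ` (V \<inter> W)) (\<lambda>y. f (inv_into V \<psi> y))"
      by (rule smooth_on_cong[OF oV, rotated]) (use W(4) in \<open>auto simp: chart_inv[OF M V] chart_inv[OF M W(1)]\<close>)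
    then show "\<exists>N. open N \<and> y \<in> N \<and> smooth_on N (\<lambda>y. f (inv_into V \<psi> y))"
      using oV p W(3) by blast
  qed
  ultimately show ?thesis
    by (auto simp: smooth_functions_def smooth_map_def real_manifold_def o_def)
qed

lemma smooth_functions_locally:
  assumes M: "smooth_manifold M"
    and loc: "\<And>p. p \<in> topspace (mtop M) \<Longrightarrow> \<exists>W F. openin (mtop M) W \<and> p \<in> W \<and> F \<in> smooth_functions M \<and> (\<forall>q\<in>W. f q = F q)"
  shows "f \<in> smooth_functions M"
proof (rule smooth_functionsI[OF M])
  fix p assume p: "p \<in> topspace (mtop M)"
  obtain W F where W: "openin (mtop M) W" "p \<in> W" "F \<in> smooth_functions M" "\<And>q. q \<in> W \<Longrightarrow> f q = F q"
    using loc[OF p] by blast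
  obtain U \<phi> where U: "(U, \<phi>) \<in> charts M" "p \<in> U" using chart_at[OF M p] by metis
  have o: "openin (mtop M) (U \<inter> W)" using W(1) chart_facts(1)[OF M U(1)] by blast
  have "smooth_on (\<phi> ` (U \<inter> W)) (\<lambda>y. F (inv_into U \<phi> y))"
    by (rule smooth_on_subset[OF smooth_functions_chart[OF M W(3) U(1)]]) blast
  then have "smooth_on (\<phi> ` (U \<inter> W)) (\<lambda>y. f (inv_into U \<phi> y))"
    by (rule smooth_on_cong[OF chart_open_image[OF M U(1) o Int_lower1], rotated]) (use W(4) in \<open>auto simp: chart_inv[OF M U(1)]\<close>)
  then show "\<exists>U \<phi> W. (U, \<phi>) \<in> charts M \<and> openin (mtop M) W \<and> p \<in> W \<and> W \<subseteq> U \<and>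
       smooth_on (\<phi> ` W) (\<lambda>y. f (inv_into U \<phi> y))"
    using U W(2) o by blast
qed

lemma smooth_functions_pointwise:
  assumes M: "smooth_manifold M"
    and "\<And>U \<phi>. (U, \<phi>) \<in> charts M \<Longrightarrow> smooth_on (\<phi> ` U) (\<lambda>y. f (inv_into U \<phi> y))"
  shows "f \<in> smooth_functions M"
  using chart_at[OF M] chart_facts(1)[OF M] assms(2) by (intro smooth_functionsI[OF M]) (metis subset_refl)

lemma smooth_functions_const: "smooth_manifold M \<Longrightarrow> (\<lambda>p. c) \<in> smooth_functions M"
  by (rule smooth_functions_pointwise) (auto intro: smooth_on_const)

lemma smooth_functions_add:
  "smooth_manifold M \<Longrightarrow> f \<in> smooth_functions M \<Longrightarrow> h \<in> smooth_functions M \<Longrightarrow>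
    (\<lambda>p. f p + h p) \<in> smooth_functions M"
  using smooth_on_add[OF chart_facts(2) smooth_functions_chart smooth_functions_chart]
  by (intro smooth_functions_pointwise) blast+

lemma smooth_functions_mult:
  "smooth_manifold M \<Longrightarrow> f \<in> smooth_functions M \<Longrightarrow> h \<in> smooth_functions M \<Longrightarrow>
    (\<lambda>p. f p * h p) \<in> smooth_functions M"
  using smooth_on_mult[OF chart_facts(2) smooth_functions_chart smooth_functions_chart]
  by (intro smooth_functions_pointwise) blast+

lemma smooth_functions_diff:
  assumes "smooth_manifold M" "f \<in> smooth_functions M" "h \<in> smooth_functions M"
  shows "(\<lambda>p. f p - h p) \<in> smooth_functions M"
  using smooth_functions_add[OF assms(1,2) smooth_functions_mult[OF assms(1) smooth_functions_const[OF assms(1), of "-1"] assms(3)]]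
  by simp

lemma smooth_functions_sum:
  "smooth_manifold M \<Longrightarrow> (\<And>i. i \<in> I \<Longrightarrow> f i \<in> smooth_functions M) \<Longrightarrow>
    (\<lambda>p. \<Sum>i\<in>I. f i p) \<in> smooth_functions M"
  by (induction I rule: infinite_finite_induct) (auto intro: smooth_functions_const smooth_functions_add)

text \<open>Outside \<open>W\<close> the function vanishes near each point, namely on the complement
  of \<open>K\<close>, which is open because \<open>K\<close> is closed in all of \<open>M\<close>
  and not merely in \<open>U\<close>.\<close>

lemma smooth_functions_supported:
  assumes M: "smooth_manifold M" and U: "(U, \<phi>) \<in> charts M" and W: "openin (mtop M) W" "W \<subseteq> U"
    and K: "closedin (mtop M) K" "K \<subseteq> W" "\<And>q. q \<notin> K \<Longrightarrow> f q = 0"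
    and f: "smooth_on (\<phi> ` W) (\<lambda>y. f (inv_into U \<phi> y))"
  shows "f \<in> smooth_functions M"
proof (rule smooth_functionsI[OF M])
  fix q assume q: "q \<in> topspace (mtop M)"
  show "\<exists>U \<phi> W. (U, \<phi>) \<in> charts M \<and> openin (mtop M) W \<and> q \<in> W \<and> W \<subseteq> U \<and>
       smooth_on (\<phi> ` W) (\<lambda>y. f (inv_into U \<phi> y))"
  proof (cases "q \<in> W")
    case True
    then show ?thesis using U W f by blast
  next
    case False
    obtain U' \<phi>' where U': "(U', \<phi>') \<in> charts M" "q \<in> U'" using chart_at[OF M q] by metis
    let ?W = "U' - K"
    have o: "openin (mtop M) ?W" using chart_facts(1)[OF M U'(1)] K(1) by blast
    have oi: "open (\<phi>' ` ?W)" by (rule chart_open_image[OF M U'(1) o]) auto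
    have "smooth_on (\<phi>' ` ?W) (\<lambda>y. f (inv_into U' \<phi>' y))"
      by (rule smooth_on_cong[OF oi _ smooth_on_const[of _ 0]]) (auto simp: K(3) chart_inv[OF M U'(1)])
    moreover have "q \<in> ?W" using False K(2) U'(2) by blast
    ultimately show ?thesis using U' o by blast
  qed
qed

text \<open>A function given near a point extends to the whole manifold after multiplication with a bump
  function; its support is closed because compact balls of the chart are closed in a Hausdorff space.\<close>

lemma chart_extension:
  fixes M :: "('a, 'e::real_inner) manifold"
  assumes M: "smooth_manifold M" and U: "(U, \<phi>) \<in> charts M" and p: "p \<in> U" "p \<in> W" and W: "openin (mtop M) W"
    and G: "open N" "\<phi> p \<in> N" "smooth_on N (G :: 'e \<Rightarrow> real)"
  shows "\<exists>F\<in>smooth_functions M. \<exists>V K. openin (mtop M) V \<and> p \<in> V \<and> V \<subseteq> U \<inter> W \<and> \<phi> ` V \<subseteq> N \<and>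
    (\<forall>q\<in>V. F q = G (\<phi> q)) \<and> closedin (mtop M) K \<and> K \<subseteq> U \<inter> W \<and> (\<forall>q. q \<notin> K \<longrightarrow> F q = 0)"
proof -
  note c = chart_facts[OF M U]
  obtain B :: "'e set" where B: "onb B" using smooth_manifold_onb[OF M] by blast
  define N' where "N' = \<phi> ` (U \<inter> W) \<inter> N"
  have "openin (mtop M) (U \<inter> W)" using W c(1) by blast
  then have "open (\<phi> ` (U \<inter> W))" using chart_open_image[OF M U] by blast
  then have N': "open N'" "\<phi> p \<in> N'" using p G by (auto simp: N'_def)
  then obtain s where s: "s > 0" "cball (\<phi> p) s \<subseteq> N'" using open_contains_cball by blast
  \<comment> \<open>The bump function of radius \<open>r\<close> lives on the ball of radius
    \<open>2 * r\<close>, which is to be the ball of radius \<open>s\<close>.\<close>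
  define r where "r = s / 2"
  have r: "r > 0" "cball (\<phi> p) (2 * r) \<subseteq> N'" using s by (auto simp: r_def)
  obtain \<beta> :: "'e \<Rightarrow> real" where \<beta>: "smooth_on UNIV \<beta>" "\<And>x. x \<in> cball (\<phi> p) r \<Longrightarrow> \<beta> x = 1"
    "\<And>x. x \<notin> cball (\<phi> p) (2 * r) \<Longrightarrow> \<beta> x = 0"
    using bump_function[OF r(1), of "\<phi> p"] by blast
  define F where "F q = (if q \<in> U then \<beta> (\<phi> q) * G (\<phi> q) else 0)" for q
  define K where "K = inv_into U \<phi> ` cball (\<phi> p) (2 * r)"
  have sub: "cball (\<phi> p) (2 * r) \<subseteq> \<phi> ` U" using r(2) by (auto simp: N'_def)
  have KU: "K \<subseteq> U \<inter> W" using r(2) chart_inv[OF M U] by (force simp: K_def N'_def)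
  have inK: "q \<in> K" if "q \<in> U" "\<phi> q \<in> cball (\<phi> p) (2 * r)" for q
    using that chart_inv[OF M U that(1)] unfolding K_def by (metis image_eqI)
  have "compactin (top_of_set (\<phi> ` U)) (cball (\<phi> p) (2 * r))"
    using onb_compact_cball[OF B] sub by (simp add: compactin_subtopology)
  then have "compactin (subtopology (mtop M) U) K"
    unfolding K_def by (rule image_compactin[OF _ chart_inv_continuous[OF M U]])
  then have "compactin (mtop M) K" by (simp add: compactin_subtopology)
  moreover have "Hausdorff_space (mtop M)" using M by (simp add: smooth_manifold_def)
  ultimately have Kc: "closedin (mtop M) K" using compactin_imp_closedin by blast
  have F0: "F q = 0" if "q \<notin> K" for q using that inK \<beta>(3) by (auto simp: F_def)
  let ?W = "{q \<in> U. \<phi> q \<in> N'}"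
  have oW: "openin (mtop M) ?W" using chart_open_preimage[OF M U N'(1)] .
  have oi: "open (\<phi> ` ?W)" by (rule chart_open_image[OF M U oW]) auto
  have KW: "K \<subseteq> ?W" using r(2) c(4) sub KU unfolding K_def by (auto simp: f_inv_into_f subset_iff)
  have "smooth_on (\<phi> ` ?W) (\<lambda>y. \<beta> y * G y)"
    by (rule smooth_on_mult[OF oi smooth_on_subset[OF \<beta>(1)] smooth_on_subset[OF G(3)]]) (auto simp: N'_def)
  then have sF: "smooth_on (\<phi> ` ?W) (\<lambda>y. F (inv_into U \<phi> y))"
    by (rule smooth_on_cong[OF oi, rotated]) (auto simp: F_def chart_inv[OF M U])
  have "F \<in> smooth_functions M"
    by (rule smooth_functions_supported[OF M U oW _ Kc KW F0 sF]) auto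
  moreover define V where "V = {q \<in> U. \<phi> q \<in> ball (\<phi> p) r}"
  have "openin (mtop M) V" unfolding V_def by (rule chart_open_preimage[OF M U open_ball])
  moreover have "p \<in> V" using p r(1) by (simp add: V_def)
  moreover have "V \<subseteq> K" using inK r(1) by (auto simp: V_def)
  moreover have "\<phi> ` V \<subseteq> N" using r by (force simp: V_def N'_def)
  moreover have "\<forall>q\<in>V. F q = G (\<phi> q)" using \<beta>(2) by (auto simp: V_def F_def)
  ultimately show ?thesis using Kc KU F0 by blast
qed

text \<open>The constant 1, extended by \<open>chart_extension\<close>, is itself a bump
  function.\<close>

lemma manifold_bump:
  assumes M: "smooth_manifold M" and W: "openin (mtop M) W" "p \<in> W"
  obtains \<beta> V K where "\<beta> \<in> smooth_functions M" "openin (mtop M) V" "p \<in> V" "V \<subseteq> W" "\<And>q. q \<in> V \<Longrightarrow> \<beta> q = 1"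
    "closedin (mtop M) K" "K \<subseteq> W" "\<And>q. q \<notin> K \<Longrightarrow> \<beta> q = 0"
proof -
  have "p \<in> topspace (mtop M)" using W openin_subset by blast
  then obtain U \<phi> where U: "(U, \<phi>) \<in> charts M" "p \<in> U" using chart_at[OF M] by metis
  show ?thesis
    using chart_extension[OF M U W(2,1) open_UNIV UNIV_I smooth_on_const[of UNIV 1]] that by (auto 0 3)
qed

section \<open>Tangent vectors\<close>

text \<open>The directional derivative along \<open>v\<close> in the chart, that is, the tangent
  vector with coordinates \<open>v\<close>. The value 0 off the smooth functions follows the
  convention of \<open>tangent_space\<close>.\<close>

definition coord_tangent ::
  "('a, 'e::real_inner) manifold \<Rightarrow> 'a set \<Rightarrow> ('a \<Rightarrow> 'e) \<Rightarrow> 'a \<Rightarrow> 'e \<Rightarrow> 'a tangent" where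
  "coord_tangent M U \<phi> p v =
     (\<lambda>f. if f \<in> smooth_functions M then frechet_derivative (\<lambda>y. f (inv_into U \<phi> y)) (at (\<phi> p)) v else 0)"

lemma chart_has_derivative:
  assumes "smooth_manifold M" "(U, \<phi>) \<in> charts M" "p \<in> U" "f \<in> smooth_functions M"
  shows "((\<lambda>y. f (inv_into U \<phi> y)) has_derivative frechet_derivative (\<lambda>y. f (inv_into U \<phi> y)) (at (\<phi> p))) (at (\<phi> p))"
  using smooth_on_has_derivative[OF smooth_functions_chart[OF assms(1,4,2)]] assms(3) by blast

lemma coord_tangent_combination:
  assumes "smooth_manifold M" "(U, \<phi>) \<in> charts M" "p \<in> U"
  shows "(\<lambda>f. a * coord_tangent M U \<phi> p v f + b * coord_tangent M U \<phi> p w f) =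
    coord_tangent M U \<phi> p (a *\<^sub>R v + b *\<^sub>R w)"
  using has_derivative_linear[OF chart_has_derivative[OF assms]]
  by (auto simp: coord_tangent_def fun_eq_iff linear_add linear_scale)

text \<open>By the chain rule through the chart, a velocity depends on its curve only through the
  derivative of the coordinate expression.\<close>

lemma curve_velocity:
  assumes M: "smooth_manifold M" and U: "(U, \<phi>) \<in> charts M" "p \<in> U"
    and c: "smooth_map (open_interval_manifold e) M c" "e > 0" "c 0 = p"
  shows "(\<lambda>f. if f \<in> smooth_functions M then deriv (\<lambda>t. f (c t)) 0 else 0) =
    coord_tangent M U \<phi> p (frechet_derivative (\<lambda>t. \<phi> (c t)) (at 0) 1)"
    and "((\<lambda>t. \<phi> (c t)) has_derivative frechet_derivative (\<lambda>t. \<phi> (c t)) (at 0)) (at 0)"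
proof -
  let ?I = "{-e<..<e}"
  define J where "J = ?I \<inter> c -` U"
  have "continuous_map (top_of_set ?I) (mtop M) c"
    using c(1) by (simp add: smooth_map_def open_interval_manifold_def)
  then have "openin (top_of_set ?I) {t \<in> topspace (top_of_set ?I). c t \<in> U}"
    using chart_facts(1)[OF M U(1)] by (rule openin_continuous_map_preimage)
  moreover have "{t \<in> topspace (top_of_set ?I). c t \<in> U} = J" by (auto simp: J_def)
  ultimately have J: "open J" "0 \<in> J"
    using c(2,3) U(2) openin_open_trans[of ?I J] by (auto simp: J_def)
  have inv: "inv_into ?I (\<lambda>t. t) t = t" if "t \<in> ?I" for t
    using inv_into_f_f[of "\<lambda>t. t" ?I t] that by (simp add: inj_on_def)
  have "smooth_on ((\<lambda>t. t) ` (?I \<inter> c -` U)) (\<phi> \<circ> c \<circ> inv_into ?I (\<lambda>t. t))"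
    by (rule smooth_map_chart[OF c(1) _ U(1)]) (simp add: open_interval_manifold_def)
  then have "smooth_on J (\<phi> \<circ> c \<circ> inv_into ?I (\<lambda>t. t))" by (simp add: J_def)
  then have "smooth_on J (\<lambda>t. \<phi> (c t))"
    by (rule smooth_on_cong[OF J(1), rotated]) (simp add: J_def inv)
  then show \<gamma>: "((\<lambda>t. \<phi> (c t)) has_derivative frechet_derivative (\<lambda>t. \<phi> (c t)) (at 0)) (at 0)"
    using smooth_on_has_derivative J(2) by blast
  have "deriv (\<lambda>t. f (c t)) 0 =
      frechet_derivative (\<lambda>y. f (inv_into U \<phi> y)) (at (\<phi> p)) (frechet_derivative (\<lambda>t. \<phi> (c t)) (at 0) 1)"
    if f: "f \<in> smooth_functions M" for f
  proof -
    let ?D = "frechet_derivative (\<lambda>y. f (inv_into U \<phi> y)) (at (\<phi> p))"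
    let ?G = "frechet_derivative (\<lambda>t. \<phi> (c t)) (at 0)"
    have D: "((\<lambda>y. f (inv_into U \<phi> y)) has_derivative ?D) (at (\<phi> (c 0)))"
      using chart_has_derivative[OF M U f] c(3) by simp
    have "((\<lambda>t. f (inv_into U \<phi> (\<phi> (c t)))) has_derivative (\<lambda>t. ?D (?G t))) (at 0)"
      by (rule has_derivative_compose[OF \<gamma> D])
    then have "((\<lambda>t. f (c t)) has_derivative (\<lambda>t. ?D (?G t))) (at 0)"
      by (rule has_derivative_transform_within_open[OF _ J]) (simp add: J_def chart_inv[OF M U(1)])
    moreover have "(\<lambda>t. ?D (?G t)) = (*) (?D (?G 1))"
    proof
      fix t
      have "?G t = ?G (t *\<^sub>R 1)" by simp
      also have "\<dots> = t *\<^sub>R ?G 1" by (rule linear_scale[OF has_derivative_linear[OF \<gamma>]])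
      finally have "?D (?G t) = ?D (t *\<^sub>R ?G 1)" by (rule arg_cong)
      also have "\<dots> = t *\<^sub>R ?D (?G 1)" by (rule linear_scale[OF has_derivative_linear[OF D]])
      finally show "?D (?G t) = ?D (?G 1) * t" by (simp only: real_scaleR_def mult.commute)
    qed
    ultimately have "((\<lambda>t. f (c t)) has_field_derivative ?D (?G 1)) (at 0)"
      by (simp only: has_field_derivative_def)
    then show ?thesis by (rule DERIV_imp_deriv)
  qed
  then show "(\<lambda>f. if f \<in> smooth_functions M then deriv (\<lambda>t. f (c t)) 0 else 0) =
      coord_tangent M U \<phi> p (frechet_derivative (\<lambda>t. \<phi> (c t)) (at 0) 1)"
    by (auto simp: coord_tangent_def)
qed

text \<open>The witness is the curve that is a straight line with direction \<open>v\<close> in the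
  chart, on an interval short enough to stay in the image of the chart.\<close>

lemma coord_tangent_in_tangent_space:
  fixes M :: "('a, 'e::real_inner) manifold"
  assumes M: "smooth_manifold M" and U: "(U, \<phi>) \<in> charts M" "p \<in> U"
  shows "coord_tangent M U \<phi> p v \<in> tangent_space M p"
proof -
  obtain B :: "'e set" where B: "onb B" using smooth_manifold_onb[OF M] by blast
  define l where "l t = \<phi> p + t *\<^sub>R v" for t :: real
  have contl: "continuous_on S l" for S unfolding l_def by (intro continuous_intros)
  have "open (l -` (\<phi> ` U))" using contl chart_facts(2)[OF M U(1)] open_vimage by blast
  moreover have "0 \<in> l -` (\<phi> ` U)" using U(2) by (simp add: l_def)
  ultimately obtain e where e: "e > 0" "ball 0 e \<subseteq> l -` (\<phi> ` U)" using open_contains_ball by metis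
  let ?I = "{-e<..<e}"
  have I: "l t \<in> \<phi> ` U" if "t \<in> ?I" for t using e(2) that by (auto simp: subset_iff)
  define c where "c t = inv_into U \<phi> (l t)" for t
  have \<phi>c: "c t \<in> U" "\<phi> (c t) = l t" if "t \<in> ?I" for t
    using I[OF that] by (auto simp: c_def inv_into_into f_inv_into_f)
  have "continuous_map (top_of_set ?I) (top_of_set (\<phi> ` U)) l"
    using contl I by (auto simp: continuous_map_in_subtopology)
  then have "continuous_map (top_of_set ?I) (subtopology (mtop M) U) (inv_into U \<phi> \<circ> l)"
    by (rule continuous_map_compose[OF _ chart_inv_continuous[OF M U(1)]])
  then have "continuous_map (top_of_set ?I) (mtop M) (inv_into U \<phi> \<circ> l)"
    by (rule continuous_map_into_fulltopology)
  moreover have "inv_into U \<phi> \<circ> l = c" by (auto simp: c_def)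
  ultimately have cc: "continuous_map (top_of_set ?I) (mtop M) c" by simp
  have inv: "inv_into ?I (\<lambda>t. t) t = t" if "t \<in> ?I" for t
    using inv_into_f_f[of "\<lambda>t. t" ?I t] that by (simp add: inj_on_def)
  have "smooth_on (?I \<inter> c -` V) (\<psi> \<circ> c \<circ> inv_into ?I (\<lambda>t. t))" if V: "(V, \<psi>) \<in> charts M" for V \<psi>
  proof -
    let ?S = "?I \<inter> c -` V"
    have "openin (top_of_set ?I) {t \<in> topspace (top_of_set ?I). c t \<in> V}"
      using cc chart_facts(1)[OF M V] by (rule openin_continuous_map_preimage)
    moreover have "{t \<in> topspace (top_of_set ?I). c t \<in> V} = ?S" by auto
    ultimately have o: "open ?S" using openin_open_trans[of ?I ?S] by auto
    have "openin (mtop M) (U \<inter> V)" using chart_facts(1)[OF M] U(1) V by blast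
    then have o2: "open (\<phi> ` (U \<inter> V))" using chart_open_image[OF M U(1)] by blast
    have "smooth_on ?S (\<lambda>t. t *\<^sub>R v)"
      by (rule smooth_on_linear_compose[OF bounded_linear_scaleR_left o smooth_on_ident[OF o]])
    then have sl: "smooth_on ?S l"
      unfolding l_def by (intro smooth_on_add[OF o smooth_on_const])
    have into: "l ` ?S \<subseteq> \<phi> ` (U \<inter> V)"
    proof clarify
      fix t assume t: "t \<in> ?I" "c t \<in> V"
      have "l t = \<phi> (c t)" "c t \<in> U \<inter> V" using \<phi>c[OF t(1)] t(2) by auto
      then show "l t \<in> \<phi> ` (U \<inter> V)" by blast
    qed
    have "smooth_on ?S (\<lambda>t. (\<lambda>y. \<psi> (inv_into U \<phi> y)) (l t))"
      by (rule smooth_on_compose[OF B o o2 into chart_transition[OF M U(1) V] sl])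
    then show ?thesis by (rule smooth_on_cong[OF o, rotated]) (simp add: c_def inv)
  qed
  then have sm: "smooth_map (open_interval_manifold e) M c"
    using cc by (auto simp: smooth_map_def open_interval_manifold_def)
  have c0: "c 0 = p" using chart_inv[OF M U] by (simp add: c_def l_def)
  have "(l has_derivative (\<lambda>t. t *\<^sub>R v)) (at 0)"
    unfolding l_def by (auto intro!: derivative_eq_intros)
  then have "((\<lambda>t. \<phi> (c t)) has_derivative (\<lambda>t. t *\<^sub>R v)) (at 0)"
    by (rule has_derivative_transform_within_open[where s = ?I]) (use e(1) \<phi>c in auto)
  then have "frechet_derivative (\<lambda>t. \<phi> (c t)) (at 0) = (\<lambda>t. t *\<^sub>R v)"
    using frechet_derivative_at by metis
  then have "coord_tangent M U \<phi> p v =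
      (\<lambda>f. if f \<in> smooth_functions M then deriv (\<lambda>t. f (c t)) 0 else 0)"
    using curve_velocity(1)[OF M U sm e(1) c0] by simp
  then show ?thesis using sm e(1) c0 unfolding tangent_space_def by blast
qed

text \<open>Sums of velocities are not visibly velocities of curves. The coordinate description is
  what makes the tangent space a linear space.\<close>

lemma tangent_space_eq_coord:
  assumes M: "smooth_manifold M" and U: "(U, \<phi>) \<in> charts M" "p \<in> U"
  shows "tangent_space M p = range (coord_tangent M U \<phi> p)"
  using curve_velocity(1)[OF M U] coord_tangent_in_tangent_space[OF M U]
  unfolding tangent_space_def by blast

lemma tangent_spaceE:
  assumes M: "smooth_manifold M" and p: "p \<in> topspace (mtop M)" and u: "u \<in> tangent_space M p"
  obtains U \<phi> v where "(U, \<phi>) \<in> charts M" "p \<in> U" "u = coord_tangent M U \<phi> p v"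
  using chart_at[OF M p] tangent_space_eq_coord[OF M] u by (metis rangeE)

lemma tangent_combination:
  assumes M: "smooth_manifold M" and p: "p \<in> topspace (mtop M)"
    and u: "u \<in> tangent_space M p" and v: "v \<in> tangent_space M p"
  shows "(\<lambda>f. a * u f + b * v f) \<in> tangent_space M p"
proof -
  obtain U \<phi> where U: "(U, \<phi>) \<in> charts M" "p \<in> U" using chart_at[OF M p] by metis
  note E = tangent_space_eq_coord[OF M U]
  obtain x y where "u = coord_tangent M U \<phi> p x" "v = coord_tangent M U \<phi> p y" using u v E by auto
  then show ?thesis using coord_tangent_combination[OF M U] E by auto
qed

lemma tangent_zero:
  assumes M: "smooth_manifold M" and p: "p \<in> topspace (mtop M)"
  shows "(\<lambda>f. 0) \<in> tangent_space M p"
proof -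
  obtain U \<phi> where U: "(U, \<phi>) \<in> charts M" "p \<in> U" using chart_at[OF M p] by metis
  then have "coord_tangent M U \<phi> p 0 \<in> tangent_space M p" using coord_tangent_in_tangent_space[OF M] by blast
  then show ?thesis using tangent_combination[OF M p, of "coord_tangent M U \<phi> p 0" "coord_tangent M U \<phi> p 0" 0 0] by simp
qed

lemma tangent_add:
  assumes "smooth_manifold M" "p \<in> topspace (mtop M)" "u \<in> tangent_space M p" "v \<in> tangent_space M p"
  shows "(\<lambda>f. u f + v f) \<in> tangent_space M p"
  using tangent_combination[OF assms, of 1 1] by simp

lemma tangent_diff:
  assumes "smooth_manifold M" "p \<in> topspace (mtop M)" "u \<in> tangent_space M p" "v \<in> tangent_space M p"
  shows "(\<lambda>f. u f - v f) \<in> tangent_space M p"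
  using tangent_combination[OF assms, of 1 "-1"] by simp

lemma tangent_scale:
  assumes "smooth_manifold M" "p \<in> topspace (mtop M)" "u \<in> tangent_space M p"
  shows "(\<lambda>f. a * u f) \<in> tangent_space M p"
  using tangent_combination[OF assms assms(3), of a 0] by simp

lemma tangent_sum:
  assumes "smooth_manifold M" "p \<in> topspace (mtop M)" "\<And>i. i \<in> I \<Longrightarrow> u i \<in> tangent_space M p"
  shows "(\<lambda>f. \<Sum>i\<in>I. a i * u i f) \<in> tangent_space M p"
  using assms(3)
proof (induction I rule: infinite_finite_induct)
  case (insert i I)
  then show ?case
    using tangent_add[OF assms(1,2) tangent_scale[OF assms(1,2), of "u i" "a i"], of "\<lambda>f. \<Sum>i\<in>I. a i * u i f"]
    by simp
qed (use tangent_zero[OF assms(1,2)] in auto)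

lemma tangent_outside: "u \<in> tangent_space M p \<Longrightarrow> f \<notin> smooth_functions M \<Longrightarrow> u f = 0"
  by (auto simp: tangent_space_def)

text \<open>A tangent vector sees only germs, so identities that hold near \<open>p\<close> may be
  differentiated at \<open>p\<close>.\<close>

lemma tangent_local:
  assumes M: "smooth_manifold M" and u: "u \<in> tangent_space M p"
    and f: "f \<in> smooth_functions M" "h \<in> smooth_functions M"
    and W: "openin (mtop M) W" "p \<in> W" "\<And>q. q \<in> W \<Longrightarrow> f q = h q"
  shows "u f = u h"
proof -
  have p: "p \<in> topspace (mtop M)" using W openin_subset by blast
  obtain U \<phi> v where U: "(U, \<phi>) \<in> charts M" "p \<in> U" and v: "u = coord_tangent M U \<phi> p v"
    using tangent_spaceE[OF M p u] .
  have oi: "openin (mtop M) (U \<inter> W)" using chart_facts(1)[OF M U(1)] W(1) by blast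
  have o: "open (\<phi> ` (U \<inter> W))" by (rule chart_open_image[OF M U(1) oi]) simp
  have "frechet_derivative (\<lambda>y. f (inv_into U \<phi> y)) (at (\<phi> p)) = frechet_derivative (\<lambda>y. h (inv_into U \<phi> y)) (at (\<phi> p))"
    by (rule frechet_derivative_transform_within_open[OF _ o])
      (use U(2) W(2,3) chart_has_derivative[OF M U f(1)] in \<open>auto simp: chart_inv[OF M U(1)] differentiableI\<close>)
  then show ?thesis using v f by (simp add: coord_tangent_def)
qed

lemma tangent_of_add:
  assumes M: "smooth_manifold M" and p: "p \<in> topspace (mtop M)" and u: "u \<in> tangent_space M p"
    and f: "f \<in> smooth_functions M" "h \<in> smooth_functions M"
  shows "u (\<lambda>q. f q + h q) = u f + u h"
proof -
  obtain U \<phi> v where U: "(U, \<phi>) \<in> charts M" "p \<in> U" and v: "u = coord_tangent M U \<phi> p v"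
    using tangent_spaceE[OF M p u] .
  show ?thesis
    using frechet_derivative_at[OF has_derivative_add[OF chart_has_derivative[OF M U f(1)] chart_has_derivative[OF M U f(2)]], symmetric]
      smooth_functions_add[OF M f] f by (simp add: v coord_tangent_def)
qed

lemma tangent_of_mult:
  assumes M: "smooth_manifold M" and p: "p \<in> topspace (mtop M)" and u: "u \<in> tangent_space M p"
    and f: "f \<in> smooth_functions M" "h \<in> smooth_functions M"
  shows "u (\<lambda>q. f q * h q) = f p * u h + u f * h p"
proof -
  obtain U \<phi> v where U: "(U, \<phi>) \<in> charts M" "p \<in> U" and v: "u = coord_tangent M U \<phi> p v"
    using tangent_spaceE[OF M p u] .
  show ?thesis
    using frechet_derivative_at[OF has_derivative_mult[OF chart_has_derivative[OF M U f(1)] chart_has_derivative[OF M U f(2)]], symmetric]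
      smooth_functions_mult[OF M f] f by (simp add: v coord_tangent_def chart_inv[OF M U])
qed

lemma tangent_of_const:
  assumes M: "smooth_manifold M" and p: "p \<in> topspace (mtop M)" and u: "u \<in> tangent_space M p"
  shows "u (\<lambda>q. c) = 0"
proof -
  obtain U \<phi> v where "(U, \<phi>) \<in> charts M" "p \<in> U" and v: "u = coord_tangent M U \<phi> p v"
    using tangent_spaceE[OF M p u] .
  then show ?thesis by (simp add: coord_tangent_def)
qed

lemma tangent_of_sum:
  assumes M: "smooth_manifold M" and p: "p \<in> topspace (mtop M)" and u: "u \<in> tangent_space M p"
    and f: "\<And>i. i \<in> I \<Longrightarrow> f i \<in> smooth_functions M"
  shows "u (\<lambda>q. \<Sum>i\<in>I. f i q) = (\<Sum>i\<in>I. u (f i))"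
  using f
proof (induction I rule: infinite_finite_induct)
  case (insert i I)
  then show ?case
    using tangent_of_add[OF M p u, of "f i" "\<lambda>q. \<Sum>i\<in>I. f i q"] smooth_functions_sum[OF M, of I f] by simp
qed (use tangent_of_const[OF M p u] in auto)

section \<open>Vector fields and local frames\<close>

lemma vector_fieldsD:
  assumes "X \<in> vector_fields M"
  shows "p \<in> topspace (mtop M) \<Longrightarrow> X p \<in> tangent_space M p" "p \<notin> topspace (mtop M) \<Longrightarrow> X p = (\<lambda>f. 0)"
    "f \<in> smooth_functions M \<Longrightarrow> (\<lambda>p. X p f) \<in> smooth_functions M"
    "f \<notin> smooth_functions M \<Longrightarrow> X p f = 0"
proof -
  show X: "p \<in> topspace (mtop M) \<Longrightarrow> X p \<in> tangent_space M p" "p \<notin> topspace (mtop M) \<Longrightarrow> X p = (\<lambda>f. 0)"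
    and "f \<in> smooth_functions M \<Longrightarrow> (\<lambda>p. X p f) \<in> smooth_functions M"
    using assms by (auto simp: vector_fields_def)
  show "f \<notin> smooth_functions M \<Longrightarrow> X p f = 0"
    using X tangent_outside by (cases "p \<in> topspace (mtop M)") (auto simp: fun_eq_iff)
qed

lemma vector_fields_scale:
  assumes M: "smooth_manifold M" and "h \<in> smooth_functions M" "X \<in> vector_fields M"
  shows "(\<lambda>p f. h p * X p f) \<in> vector_fields M"
  using vector_fieldsD[OF assms(3)] tangent_scale[OF M _ vector_fieldsD(1)[OF assms(3)]]
    smooth_functions_mult[OF M assms(2) vector_fieldsD(3)[OF assms(3)]]
  by (simp add: vector_fields_def)

lemma vector_fields_add:
  assumes M: "smooth_manifold M" and "X \<in> vector_fields M" "Y \<in> vector_fields M"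
  shows "(\<lambda>p f. X p f + Y p f) \<in> vector_fields M"
  using vector_fieldsD(2)[OF assms(2)] vector_fieldsD(2)[OF assms(3)]
    tangent_add[OF M _ vector_fieldsD(1)[OF assms(2)] vector_fieldsD(1)[OF assms(3)]]
    smooth_functions_add[OF M vector_fieldsD(3)[OF assms(2)] vector_fieldsD(3)[OF assms(3)]]
  by (simp add: vector_fields_def)

lemma vector_fields_diff:
  assumes M: "smooth_manifold M" and "X \<in> vector_fields M" "Y \<in> vector_fields M"
  shows "(\<lambda>p f. X p f - Y p f) \<in> vector_fields M"
  using vector_fieldsD(2)[OF assms(2)] vector_fieldsD(2)[OF assms(3)]
    tangent_diff[OF M _ vector_fieldsD(1)[OF assms(2)] vector_fieldsD(1)[OF assms(3)]]
    smooth_functions_diff[OF M vector_fieldsD(3)[OF assms(2)] vector_fieldsD(3)[OF assms(3)]]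
  by (simp add: vector_fields_def)

lemma vector_fields_zero:
  assumes M: "smooth_manifold M"
  shows "(\<lambda>p f. 0) \<in> vector_fields M"
  by (auto simp: vector_fields_def intro: tangent_zero[OF M] smooth_functions_const[OF M])

lemma vector_fields_sum:
  assumes M: "smooth_manifold M" and "\<And>i. i \<in> I \<Longrightarrow> h i \<in> smooth_functions M" "\<And>i. i \<in> I \<Longrightarrow> X i \<in> vector_fields M"
  shows "(\<lambda>p f. \<Sum>i\<in>I. h i p * X i p f) \<in> vector_fields M"
  using assms(2,3)
proof (induction I rule: infinite_finite_induct)
  case (insert i I)
  then show ?case
    using vector_fields_add[OF M vector_fields_scale[OF M, of "h i" "X i"], of "\<lambda>p f. \<Sum>i\<in>I. h i p * X i p f"] by simp
qed (auto intro: vector_fields_zero[OF M])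

section \<open>Local frames of coordinate fields\<close>

lemma smooth_functions_cutoff:
  assumes M: "smooth_manifold M" and U: "(U, \<phi>) \<in> charts M" and \<beta>: "\<beta> \<in> smooth_functions M"
    and K: "closedin (mtop M) K" "K \<subseteq> U" "\<And>q. q \<notin> K \<Longrightarrow> \<beta> q = 0" and h: "smooth_on (\<phi> ` U) h"
  shows "(\<lambda>q. if q \<in> U then \<beta> q * h (\<phi> q) else 0) \<in> smooth_functions M"
proof (rule smooth_functions_supported[OF M U chart_facts(1)[OF M U] subset_refl K(1,2)])
  have "smooth_on (\<phi> ` U) (\<lambda>y. \<beta> (inv_into U \<phi> y) * h y)"
    by (rule smooth_on_mult[OF chart_facts(2)[OF M U] smooth_functions_chart[OF M \<beta> U] h])
  then show "smooth_on (\<phi> ` U) (\<lambda>y. if inv_into U \<phi> y \<in> U then \<beta> (inv_into U \<phi> y) * h (\<phi> (inv_into U \<phi> y)) else 0)"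
    by (rule smooth_on_cong[OF chart_facts(2)[OF M U], rotated]) (auto simp: chart_inv[OF M U])
qed (simp add: K(3))

text \<open>Coordinate functions \<open>x b\<close> and coordinate fields \<open>E b\<close>, both
  defined on the whole manifold, since tangent vectors and connections accept only global arguments;
  their relations hold on \<open>W\<close> alone. The clauses on \<open>W\<close> are duality,
  expansion of tangent vectors, and vanishing brackets of the \<open>E b\<close>.\<close>

definition local_frame ::
  "('a, 'e::real_inner) manifold \<Rightarrow> 'a set \<Rightarrow> 'e set \<Rightarrow> ('e \<Rightarrow> 'a \<Rightarrow> real) \<Rightarrow> ('e \<Rightarrow> 'a vfield) \<Rightarrow> bool" where
  "local_frame M W B x E \<longleftrightarrow> openin (mtop M) W \<and> finite B \<and>
     (\<forall>b\<in>B. x b \<in> smooth_functions M \<and> E b \<in> vector_fields M) \<and>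
     (\<forall>q\<in>W. \<forall>b\<in>B. \<forall>c\<in>B. E b q (x c) = (if b = c then 1 else 0)) \<and>
     (\<forall>q\<in>W. \<forall>v\<in>tangent_space M q. v = (\<lambda>f. \<Sum>b\<in>B. v (x b) * E b q f)) \<and>
     (\<forall>q\<in>W. \<forall>f\<in>smooth_functions M. \<forall>b\<in>B. \<forall>c\<in>B. E b q (\<lambda>r. E c r f) = E c q (\<lambda>r. E b r f))"

lemma local_frame_exists:
  fixes M :: "('a, 'e::real_inner) manifold"
  assumes M: "smooth_manifold M" and U: "(U, \<phi>) \<in> charts M" "p \<in> U" and B: "onb (B :: 'e set)"
  obtains W x E where "local_frame M W B x E" "p \<in> W" "W \<subseteq> U"
    "\<And>b q. b \<in> B \<Longrightarrow> q \<in> W \<Longrightarrow> x b q = \<phi> q \<bullet> b"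
    "\<And>b q. b \<in> B \<Longrightarrow> q \<in> W \<Longrightarrow> E b q = coord_tangent M U \<phi> q b"
proof -
  obtain \<beta> V K where \<beta>: "\<beta> \<in> smooth_functions M" and V: "openin (mtop M) V" "p \<in> V" "V \<subseteq> U" "\<And>q. q \<in> V \<Longrightarrow> \<beta> q = 1"
    and K: "closedin (mtop M) K" "K \<subseteq> U" "\<And>q. q \<notin> K \<Longrightarrow> \<beta> q = 0"
    using manifold_bump[OF M chart_facts(1)[OF M U(1)] U(2)] by metis
  note oU = chart_facts(2)[OF M U(1)]
  \<comment> \<open>The cut-off by \<open>\<beta>\<close> makes coordinates and fields global; on
    \<open>V\<close>, where \<open>\<beta>\<close> is 1, nothing changes.\<close>
  define x where "x b q = (if q \<in> U then \<beta> q * (\<phi> q \<bullet> b) else 0)" for b q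
  define E where "E b q = (\<lambda>f. if q \<in> U then \<beta> q * coord_tangent M U \<phi> q b f else 0)" for b q
  have xs: "x b \<in> smooth_functions M" for b
    unfolding x_def
    by (rule smooth_functions_cutoff[OF M U(1) \<beta> K smooth_on_linear_compose[OF bounded_linear_inner_left oU smooth_on_ident[OF oU]]])
  have Ef: "(\<lambda>q. E b q f) = (\<lambda>q. if q \<in> U then \<beta> q * frechet_derivative (\<lambda>y. f (inv_into U \<phi> y)) (at (\<phi> q)) b else 0)"
    if "f \<in> smooth_functions M" for b f
    using that by (auto simp: E_def coord_tangent_def)
  have Es: "E b \<in> vector_fields M" for b
  proof -
    have "E b q \<in> tangent_space M q" if "q \<in> topspace (mtop M)" for q
    proof (cases "q \<in> U")
      case True
      then show ?thesis
        using tangent_scale[OF M that coord_tangent_in_tangent_space[OF M U(1) True], of "\<beta> q" b] by (simp add: E_def)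
    qed (use tangent_zero[OF M that] in \<open>simp add: E_def\<close>)
    moreover have "E b q = (\<lambda>f. 0)" if "q \<notin> topspace (mtop M)" for q
      using that chart_facts(3)[OF M U(1)] by (auto simp: E_def fun_eq_iff)
    moreover have "(\<lambda>q. E b q f) \<in> smooth_functions M" if f: "f \<in> smooth_functions M" for f
      unfolding Ef[OF f]
      by (rule smooth_functions_cutoff[OF M U(1) \<beta> K smooth_on_frechet_derivative[OF smooth_functions_chart[OF M f U(1)]]])
    ultimately show ?thesis by (auto simp: vector_fields_def)
  qed
  have EV: "E b q = coord_tangent M U \<phi> q b" if "q \<in> V" for b q
    using that V(3,4) by (auto simp: E_def)
  have xV: "x b q = \<phi> q \<bullet> b" if "q \<in> V" for b q
    using that V(3,4) by (auto simp: x_def)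
  have oV: "open (\<phi> ` V)" using chart_open_image[OF M U(1) V(1,3)] .
  have vx: "coord_tangent M U \<phi> q w (x b) = w \<bullet> b" if q: "q \<in> V" for q w b
  proof -
    have "((\<lambda>y. y \<bullet> b) has_derivative (\<lambda>w. w \<bullet> b)) (at (\<phi> q))" by (auto intro!: derivative_eq_intros)
    then have "((\<lambda>y. x b (inv_into U \<phi> y)) has_derivative (\<lambda>w. w \<bullet> b)) (at (\<phi> q))"
      by (rule has_derivative_transform_within_open[OF _ oV])
        (use q V(3) in \<open>auto simp: xV chart_inv[OF M U(1)] subset_iff\<close>)
    from frechet_derivative_at[OF this, symmetric] show ?thesis using xs by (simp add: coord_tangent_def)
  qed
  have "local_frame M V B x E"
    unfolding local_frame_def
  proof (intro conjI ballI)
    show "openin (mtop M) V" "finite B" using V(1) onb_finite[OF B] by auto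
    show "x b \<in> smooth_functions M" "E b \<in> vector_fields M" for b using xs Es by auto
    show "E b q (x c) = (if b = c then 1 else 0)" if "q \<in> V" "b \<in> B" "c \<in> B" for q b c
      using vx[OF that(1)] EV[OF that(1)] onb_inner[OF B that(2,3)] by simp
    show "v = (\<lambda>f. \<Sum>b\<in>B. v (x b) * E b q f)" if q: "q \<in> V" and v: "v \<in> tangent_space M q" for q v
    proof -
      have qU: "q \<in> U" using q V(3) by blast
      obtain w where w: "v = coord_tangent M U \<phi> q w" using v tangent_space_eq_coord[OF M U(1) qU] by auto
      have "v f = (\<Sum>b\<in>B. (w \<bullet> b) * E b q f)" for f
      proof (cases "f \<in> smooth_functions M")
        case True
        let ?D = "frechet_derivative (\<lambda>y. f (inv_into U \<phi> y)) (at (\<phi> q))"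
        have "?D w = (\<Sum>b\<in>B. (w \<bullet> b) *\<^sub>R ?D b)"
          by (rule onb_linear_expand[OF B has_derivative_linear[OF chart_has_derivative[OF M U(1) qU True]]])
        then show ?thesis using True by (simp add: w EV[OF q] coord_tangent_def)
      qed (simp add: w EV[OF q] coord_tangent_def)
      then show ?thesis using vx[OF q] w by auto
    qed
    show "E b q (\<lambda>r. E c r f) = E c q (\<lambda>r. E b r f)" if q: "q \<in> V" and f: "f \<in> smooth_functions M" for q b c f
    proof -
      let ?f = "\<lambda>y. f (inv_into U \<phi> y)"
      \<comment> \<open>In the chart the fields \<open>E b\<close> act as directional derivatives
        near \<open>q\<close>, so commutation is the symmetry of second derivatives.\<close>
      have "E b q (\<lambda>r. E c r f) = frechet_derivative (\<lambda>y. frechet_derivative ?f (at y) c) (at (\<phi> q)) b" for b c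
      proof -
        have "((\<lambda>y. frechet_derivative ?f (at y) c) has_derivative
            frechet_derivative (\<lambda>y. frechet_derivative ?f (at y) c) (at (\<phi> q))) (at (\<phi> q))"
          by (rule smooth_on_has_derivative[OF smooth_on_frechet_derivative[OF smooth_functions_chart[OF M f U(1)]]])
            (use q V(3) in blast)
        then have "((\<lambda>y. E c (inv_into U \<phi> y) f) has_derivative
            frechet_derivative (\<lambda>y. frechet_derivative ?f (at y) c) (at (\<phi> q))) (at (\<phi> q))"
          by (rule has_derivative_transform_within_open[OF _ oV])
            (use q f V(3) in \<open>auto simp: EV chart_inv[OF M U(1)] subset_iff coord_tangent_def\<close>)
        then have "frechet_derivative (\<lambda>y. E c (inv_into U \<phi> y) f) (at (\<phi> q)) =
            frechet_derivative (\<lambda>y. frechet_derivative ?f (at y) c) (at (\<phi> q))"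
          by (rule frechet_derivative_at[symmetric])
        then show ?thesis
          using vector_fieldsD(3)[OF Es f, of c] by (simp add: EV[OF q] coord_tangent_def)
      qed
      moreover have "Ck_on 2 (\<phi> ` U) ?f"
        using smooth_functions_chart[OF M f U(1)] by (simp add: smooth_on_def)
      moreover have "\<phi> q \<in> \<phi> ` U" using q V(3) by blast
      ultimately show ?thesis using frechet_derivative_commute[OF oU] by metis
    qed
  qed
  then show ?thesis using that[of V x E] V(2,3) xV EV by blast
qed

lemma local_frameD:
  assumes "local_frame M W B x E"
  shows "openin (mtop M) W" "finite B" "b \<in> B \<Longrightarrow> x b \<in> smooth_functions M" "b \<in> B \<Longrightarrow> E b \<in> vector_fields M"
    "q \<in> W \<Longrightarrow> b \<in> B \<Longrightarrow> c \<in> B \<Longrightarrow> E b q (x c) = (if b = c then 1 else 0)"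
    "q \<in> W \<Longrightarrow> v \<in> tangent_space M q \<Longrightarrow> v f = (\<Sum>b\<in>B. v (x b) * E b q f)"
    "q \<in> W \<Longrightarrow> f \<in> smooth_functions M \<Longrightarrow> b \<in> B \<Longrightarrow> c \<in> B \<Longrightarrow> E b q (\<lambda>r. E c r f) = E c q (\<lambda>r. E b r f)"
proof -
  show "q \<in> W \<Longrightarrow> v \<in> tangent_space M q \<Longrightarrow> v f = (\<Sum>b\<in>B. v (x b) * E b q f)"
    using assms unfolding local_frame_def by (elim conjE) (metis (no_types))
qed (use assms in \<open>simp_all add: local_frame_def\<close>)

lemma local_frame_at:
  fixes M :: "('a, 'e::real_inner) manifold"
  assumes M: "smooth_manifold M" and p: "p \<in> topspace (mtop M)"
  obtains W x E and B :: "'e set" where "local_frame M W B x E" "p \<in> W"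
proof -
  obtain U \<phi> where U: "(U, \<phi>) \<in> charts M" "p \<in> U" using chart_at[OF M p] by metis
  obtain B :: "'e set" where "onb B" using smooth_manifold_onb[OF M] by blast
  then show ?thesis using local_frame_exists[OF M U] that by metis
qed

text \<open>Tangent vectors are functionals on global functions only; the cut-off coordinate
  functions \<open>x b\<close> are enough of them to recover every coordinate of
  \<open>v\<close>.\<close>

lemma coord_tangent_eq_0:
  fixes M :: "('a, 'e::real_inner) manifold"
  assumes M: "smooth_manifold M" and U: "(U, \<phi>) \<in> charts M" "p \<in> U"
    and 0: "coord_tangent M U \<phi> p v = (\<lambda>f. 0)"
  shows "v = 0"
proof -
  obtain B :: "'e set" where B: "onb B" using smooth_manifold_onb[OF M] by blast
  obtain W x E where F: "local_frame M W B x E" "p \<in> W"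
    "\<And>b q. b \<in> B \<Longrightarrow> q \<in> W \<Longrightarrow> E b q = coord_tangent M U \<phi> q b"
    using local_frame_exists[OF M U B] by metis
  have "v \<bullet> b = 0" if b: "b \<in> B" for b
  proof -
    have "linear (\<lambda>v. coord_tangent M U \<phi> p v (x b))"
      using has_derivative_linear[OF chart_has_derivative[OF M U]] local_frameD(3)[OF F(1) b]
      by (simp add: coord_tangent_def)
    from onb_linear_expand[OF B this, of v]
    have "coord_tangent M U \<phi> p v (x b) = (\<Sum>c\<in>B. (v \<bullet> c) * E c p (x b))" using F(3)[OF _ F(2)] by simp
    also have "\<dots> = (\<Sum>c\<in>B. if c = b then v \<bullet> c else 0)"
      by (intro sum.cong refl) (use local_frameD(5)[OF F(1,2) _ b] in auto)
    also have "\<dots> = v \<bullet> b" using b onb_finite[OF B] by simp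
    finally show ?thesis using 0 by simp
  qed
  then show ?thesis by (intro onb_eqI[OF B]) simp
qed

text \<open>A field equals its frame expansion only on \<open>W\<close>. Multiplied with a function
  supported in \<open>W\<close> it does so everywhere, and only identities between global fields can
  be inserted into a connection or a tensor.\<close>

lemma local_frame_cutoff:
  assumes M: "smooth_manifold M" and F: "local_frame M W B x E" and p: "p \<in> W"
  obtains \<beta> where "\<beta> \<in> smooth_functions M" "\<beta> p = 1"
    "\<And>X. X \<in> vector_fields M \<Longrightarrow> (\<lambda>q f. \<beta> q * X q f) = (\<lambda>q f. \<Sum>b\<in>B. (\<beta> q * X q (x b)) * E b q f)"
proof -
  obtain \<beta> V K where \<beta>: "\<beta> \<in> smooth_functions M" "p \<in> V" "\<And>q. q \<in> V \<Longrightarrow> \<beta> q = 1" "K \<subseteq> W" "\<And>q. q \<notin> K \<Longrightarrow> \<beta> q = 0"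
    using manifold_bump[OF M local_frameD(1)[OF F] p] by metis
  have "\<beta> q * X q f = (\<Sum>b\<in>B. (\<beta> q * X q (x b)) * E b q f)" if X: "X \<in> vector_fields M" for X q f
  proof (cases "q \<in> W")
    case True
    then have "X q \<in> tangent_space M q"
      using openin_subset[OF local_frameD(1)[OF F]] vector_fieldsD(1)[OF X] by blast
    then have "X q f = (\<Sum>b\<in>B. X q (x b) * E b q f)" using local_frameD(6)[OF F True] by blast
    then show ?thesis by (simp add: sum_distrib_left mult.assoc)
  next
    case False
    then have "\<beta> q = 0" using \<beta>(4,5) by blast
    then show ?thesis by simp
  qed
  then show ?thesis using that[OF \<beta>(1) \<beta>(3)[OF \<beta>(2)]] by blast
qed

lemma field_through:
  assumes M: "smooth_manifold M" and p: "p \<in> topspace (mtop M)" and v: "v \<in> tangent_space M p"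
  obtains X where "X \<in> vector_fields M" "X p = v"
proof -
  obtain W x E B where F: "local_frame M W B x E" "p \<in> W" using local_frame_at[OF M p] .
  show ?thesis
  proof
    show "(\<lambda>q f. \<Sum>b\<in>B. v (x b) * E b q f) \<in> vector_fields M"
      by (rule vector_fields_sum[OF M smooth_functions_const[OF M] local_frameD(4)[OF F(1)]])
    show "(\<lambda>f. \<Sum>b\<in>B. v (x b) * E b p f) = v"
      by (rule ext) (rule local_frameD(6)[OF F v, symmetric])
  qed
qed

section \<open>Functionals that are linear over the smooth functions\<close>

lemma tensor_sum:
  assumes M: "smooth_manifold M"
    and add: "\<And>X Y. X \<in> vector_fields M \<Longrightarrow> Y \<in> vector_fields M \<Longrightarrow> \<Lambda> (\<lambda>q f. X q f + Y q f) = \<Lambda> X + (\<Lambda> Y :: real)"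
    and scale: "\<And>h X. h \<in> smooth_functions M \<Longrightarrow> X \<in> vector_fields M \<Longrightarrow> \<Lambda> (\<lambda>q f. h q * X q f) = h p * \<Lambda> X"
    and "finite I" "\<And>i. i \<in> I \<Longrightarrow> h i \<in> smooth_functions M" "\<And>i. i \<in> I \<Longrightarrow> X i \<in> vector_fields M"
  shows "\<Lambda> (\<lambda>q f. \<Sum>i\<in>I. h i q * X i q f) = (\<Sum>i\<in>I. h i p * \<Lambda> (X i))"
  using assms(4-6)
proof (induction I rule: finite_induct)
  case empty
  then show ?case
    using scale[OF smooth_functions_const[OF M, of 0] vector_fields_zero[OF M]] by simp
next
  case (insert i I)
  have "(\<lambda>q f. \<Sum>i\<in>I. h i q * X i q f) \<in> vector_fields M"
    using insert.prems by (intro vector_fields_sum[OF M]) auto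
  then show ?case
    using insert add[OF vector_fields_scale[OF M, of "h i" "X i"], of "\<lambda>q f. \<Sum>i\<in>I. h i q * X i q f"]
      scale[of "h i" "X i"] by simp
qed

text \<open>Multiplication with \<open>\<beta>\<close> changes nothing, as
  \<open>\<beta> p = 1\<close>. The frame expansion then reduces \<open>\<Lambda> X\<close> to the
  components of \<open>X\<close> at \<open>p\<close>, which are all 0.\<close>

lemma tensor_zero:
  assumes M: "smooth_manifold M" and p: "p \<in> topspace (mtop M)"
    and add: "\<And>X Y. X \<in> vector_fields M \<Longrightarrow> Y \<in> vector_fields M \<Longrightarrow> \<Lambda> (\<lambda>q f. X q f + Y q f) = \<Lambda> X + (\<Lambda> Y :: real)"
    and scale: "\<And>h X. h \<in> smooth_functions M \<Longrightarrow> X \<in> vector_fields M \<Longrightarrow> \<Lambda> (\<lambda>q f. h q * X q f) = h p * \<Lambda> X"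
    and X: "X \<in> vector_fields M" "X p = (\<lambda>f. 0)"
  shows "\<Lambda> X = 0"
proof -
  obtain W x E B where F: "local_frame M W B x E" "p \<in> W" using local_frame_at[OF M p] .
  obtain \<beta> where \<beta>: "\<beta> \<in> smooth_functions M" "\<beta> p = 1"
    "\<And>X. X \<in> vector_fields M \<Longrightarrow> (\<lambda>q f. \<beta> q * X q f) = (\<lambda>q f. \<Sum>b\<in>B. (\<beta> q * X q (x b)) * E b q f)"
    by (rule local_frame_cutoff[OF M F]) (rule that; assumption)
  have "\<Lambda> X = \<Lambda> (\<lambda>q f. \<beta> q * X q f)" using scale[OF \<beta>(1) X(1)] \<beta>(2) by simp
  also have "\<dots> = \<Lambda> (\<lambda>q f. \<Sum>b\<in>B. (\<beta> q * X q (x b)) * E b q f)" by (simp only: \<beta>(3)[OF X(1)])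
  also have "\<dots> = (\<Sum>b\<in>B. (\<beta> p * X p (x b)) * \<Lambda> (E b))"
    by (rule tensor_sum[OF M add scale, where h = "\<lambda>b q. \<beta> q * X q (x b)"])
      (simp_all add: smooth_functions_mult[OF M \<beta>(1) vector_fieldsD(3)[OF X(1) local_frameD(3)[OF F(1)]]]
        local_frameD(2,4)[OF F(1)])
  also have "\<dots> = 0" by (simp add: X(2))
  finally show ?thesis .
qed

lemma tensor_cong:
  assumes M: "smooth_manifold M" and p: "p \<in> topspace (mtop M)"
    and add: "\<And>X Y. X \<in> vector_fields M \<Longrightarrow> Y \<in> vector_fields M \<Longrightarrow> \<Lambda> (\<lambda>q f. X q f + Y q f) = \<Lambda> X + (\<Lambda> Y :: real)"
    and scale: "\<And>h X. h \<in> smooth_functions M \<Longrightarrow> X \<in> vector_fields M \<Longrightarrow> \<Lambda> (\<lambda>q f. h q * X q f) = h p * \<Lambda> X"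
    and X: "X \<in> vector_fields M" "Y \<in> vector_fields M" "X p = Y p"
  shows "\<Lambda> X = \<Lambda> Y"
proof -
  have Z: "(\<lambda>q f. X q f - Y q f) \<in> vector_fields M" by (rule vector_fields_diff[OF M X(1,2)])
  have "\<Lambda> (\<lambda>q f. X q f - Y q f) = 0"
    by (rule tensor_zero[where \<Lambda> = \<Lambda> and p = p, OF M p add scale Z]) (use X(3) in auto)
  then show ?thesis using add[OF Z X(2)] by simp
qed

text \<open>\<open>l\<close> evaluates \<open>\<Lambda>\<close> on an arbitrarily chosen field
  through the given vector; by \<open>tensor_cong\<close> the choice does not matter.\<close>

lemma tensor_functional:
  assumes M: "smooth_manifold M" and p: "p \<in> topspace (mtop M)"
    and add: "\<And>X Y. X \<in> vector_fields M \<Longrightarrow> Y \<in> vector_fields M \<Longrightarrow> \<Lambda> (\<lambda>q f. X q f + Y q f) = \<Lambda> X + (\<Lambda> Y :: real)"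
    and scale: "\<And>h X. h \<in> smooth_functions M \<Longrightarrow> X \<in> vector_fields M \<Longrightarrow> \<Lambda> (\<lambda>q f. h q * X q f) = h p * \<Lambda> X"
  obtains l where "\<And>X. X \<in> vector_fields M \<Longrightarrow> \<Lambda> X = l (X p)"
    "\<And>u v a b. u \<in> tangent_space M p \<Longrightarrow> v \<in> tangent_space M p \<Longrightarrow> l (\<lambda>f. a * u f + b * v f) = a * l u + b * l v"
proof -
  define l where "l v = \<Lambda> (SOME X. X \<in> vector_fields M \<and> X p = v)" for v
  have l: "\<Lambda> X = l (X p)" if X: "X \<in> vector_fields M" for X
  proof -
    have "(SOME Y. Y \<in> vector_fields M \<and> Y p = X p) \<in> vector_fields M \<and> (SOME Y. Y \<in> vector_fields M \<and> Y p = X p) p = X p"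
      by (rule someI[of _ X]) (use X in simp)
    then show ?thesis
      unfolding l_def by (intro tensor_cong[where \<Lambda> = \<Lambda> and p = p, OF M p add scale X]) auto
  qed
  have "l (\<lambda>f. a * u f + b * v f) = a * l u + b * l v"
    if u: "u \<in> tangent_space M p" and v: "v \<in> tangent_space M p" for u v a b
  proof -
    obtain X where X: "X \<in> vector_fields M" "X p = u" using field_through[OF M p u] .
    obtain Y where Y: "Y \<in> vector_fields M" "Y p = v" using field_through[OF M p v] .
    have c: "(\<lambda>q. c) \<in> smooth_functions M" for c by (rule smooth_functions_const[OF M])
    have aX: "(\<lambda>q f. a * X q f) \<in> vector_fields M" and bY: "(\<lambda>q f. b * Y q f) \<in> vector_fields M"
      using vector_fields_scale[OF M c X(1)] vector_fields_scale[OF M c Y(1)] by auto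
    have "l (\<lambda>f. a * u f + b * v f) = \<Lambda> (\<lambda>q f. a * X q f + b * Y q f)"
      using l[OF vector_fields_add[OF M aX bY]] X(2) Y(2) by simp
    also have "\<dots> = a * \<Lambda> X + b * \<Lambda> Y"
      using add[OF aX bY] scale[OF c X(1), of a] scale[OF c Y(1), of b] by simp
    finally show ?thesis using l X Y by metis
  qed
  then show ?thesis using that[of l] l by blast
qed

text \<open>Functions are total, so two of them may represent the same element of the algebra of
  smooth functions and still differ as HOL functions.\<close>

lemma tangent_cong:
  assumes M: "smooth_manifold M" and p: "p \<in> topspace (mtop M)" and u: "u \<in> tangent_space M p"
    and f: "f \<in> smooth_functions M" "h \<in> smooth_functions M" "\<And>q. q \<in> topspace (mtop M) \<Longrightarrow> f q = h q"
  shows "u f = u h"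
  by (rule tangent_local[OF M u f(1,2) openin_topspace p f(3)])

text \<open>In a frame of commuting coordinate fields the second-order terms of the bracket cancel.\<close>

lemma lie_bracket_tangent:
  assumes M: "smooth_manifold M" and p: "p \<in> topspace (mtop M)"
    and X: "X \<in> vector_fields M" and Y: "Y \<in> vector_fields M"
  shows "lie_bracket M X Y p \<in> tangent_space M p"
proof -
  obtain W x E B where F: "local_frame M W B x E" "p \<in> W" using local_frame_at[OF M p] .
  note D = local_frameD[OF F(1)]
  have top: "q \<in> topspace (mtop M)" if "q \<in> W" for q using that openin_subset[OF D(1)] by blast
  have tE: "E b p \<in> tangent_space M p" if "b \<in> B" for b using vector_fieldsD(1)[OF D(4)[OF that] p] .
  have second: "X p (\<lambda>q. Y q f) = (\<Sum>b\<in>B. X p (\<lambda>q. Y q (x b)) * E b p f)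
      + (\<Sum>b\<in>B. \<Sum>c\<in>B. Y p (x b) * X p (x c) * E c p (\<lambda>q. E b q f))"
    if f: "f \<in> smooth_functions M" and X: "X \<in> vector_fields M" and Y: "Y \<in> vector_fields M" for X Y f
  proof -
    note tX = vector_fieldsD(1)[OF X p]
    have s: "(\<lambda>q. Y q (x b)) \<in> smooth_functions M" "(\<lambda>q. E b q f) \<in> smooth_functions M" if "b \<in> B" for b
      using vector_fieldsD(3)[OF Y D(3)[OF that]] vector_fieldsD(3)[OF D(4)[OF that] f] .
    have "X p (\<lambda>q. Y q f) = X p (\<lambda>q. \<Sum>b\<in>B. Y q (x b) * E b q f)"
    proof (rule tangent_local[OF M tX _ _ D(1) F(2)])
      show "(\<lambda>q. Y q f) \<in> smooth_functions M" by (rule vector_fieldsD(3)[OF Y f])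
      show "(\<lambda>q. \<Sum>b\<in>B. Y q (x b) * E b q f) \<in> smooth_functions M"
        by (intro smooth_functions_sum[OF M] smooth_functions_mult[OF M] s)
      show "Y q f = (\<Sum>b\<in>B. Y q (x b) * E b q f)" if "q \<in> W" for q
        by (rule D(6)[OF that vector_fieldsD(1)[OF Y top[OF that]]])
    qed
    also have "\<dots> = (\<Sum>b\<in>B. X p (\<lambda>q. Y q (x b) * E b q f))"
      by (intro tangent_of_sum[OF M p tX] smooth_functions_mult[OF M] s)
    also have "\<dots> = (\<Sum>b\<in>B. X p (\<lambda>q. Y q (x b)) * E b p f + Y p (x b) * X p (\<lambda>q. E b q f))"
      by (intro sum.cong refl) (simp add: tangent_of_mult[OF M p tX s])
    also have "\<dots> = (\<Sum>b\<in>B. X p (\<lambda>q. Y q (x b)) * E b p f + (\<Sum>c\<in>B. Y p (x b) * X p (x c) * E c p (\<lambda>q. E b q f)))"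
      by (intro sum.cong refl) (simp add: D(6)[OF F(2) tX, of "\<lambda>q. E _ q f"] sum_distrib_left mult.assoc)
    finally show ?thesis by (simp add: sum.distrib)
  qed
  have "lie_bracket M X Y p f = (\<Sum>b\<in>B. (X p (\<lambda>q. Y q (x b)) - Y p (\<lambda>q. X q (x b))) * E b p f)" for f
  proof (cases "f \<in> smooth_functions M")
    case True
    \<comment> \<open>This is the second-order part of \<open>X p (\<lambda>q. Y q f)\<close>.
      Exchanging the sums and commuting the frame fields turns it into that of
      \<open>Y p (\<lambda>q. X q f)\<close>.\<close>
    have "(\<Sum>b\<in>B. \<Sum>c\<in>B. Y p (x b) * X p (x c) * E c p (\<lambda>q. E b q f))
        = (\<Sum>c\<in>B. \<Sum>b\<in>B. Y p (x b) * X p (x c) * E c p (\<lambda>q. E b q f))" by (rule sum.swap)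
    also have "\<dots> = (\<Sum>c\<in>B. \<Sum>b\<in>B. X p (x c) * Y p (x b) * E b p (\<lambda>q. E c q f))"
      by (intro sum.cong refl) (simp add: D(7)[OF F(2) True])
    finally show ?thesis
      using True second[OF True X Y] second[OF True Y X]
      by (simp add: lie_bracket_def left_diff_distrib sum_subtractf)
  next
    case False
    then have "E b p f = 0" if "b \<in> B" for b using vector_fieldsD(4)[OF D(4)[OF that]] by blast
    then show ?thesis using False by (simp add: lie_bracket_def)
  qed
  then have "lie_bracket M X Y p = (\<lambda>f. \<Sum>b\<in>B. (X p (\<lambda>q. Y q (x b)) - Y p (\<lambda>q. X q (x b))) * E b p f)" by blast
  also have "\<dots> \<in> tangent_space M p" by (rule tangent_sum[OF M p tE])
  finally show ?thesis .
qed

section \<open>Pseudo-Riemannian metrics\<close>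

lemma metricD:
  assumes "pseudo_riemannian_metric M g"
  shows "p \<in> topspace (mtop M) \<Longrightarrow> u \<in> tangent_space M p \<Longrightarrow> v \<in> tangent_space M p \<Longrightarrow> g p u v = g p v u"
    "p \<in> topspace (mtop M) \<Longrightarrow> u \<in> tangent_space M p \<Longrightarrow> v \<in> tangent_space M p \<Longrightarrow> w \<in> tangent_space M p \<Longrightarrow>
      g p (\<lambda>f. a * u f + b * v f) w = a * g p u w + b * g p v w"
    "p \<in> topspace (mtop M) \<Longrightarrow> u \<in> tangent_space M p \<Longrightarrow> (\<And>v. v \<in> tangent_space M p \<Longrightarrow> g p u v = 0) \<Longrightarrow> u = (\<lambda>f. 0)"
    "X \<in> vector_fields M \<Longrightarrow> Y \<in> vector_fields M \<Longrightarrow> (\<lambda>p. g p (X p) (Y p)) \<in> smooth_functions M"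
  using assms by (simp_all add: pseudo_riemannian_metric_def)

lemma metric_left:
  assumes M: "smooth_manifold M" and g: "pseudo_riemannian_metric M g" and p: "p \<in> topspace (mtop M)"
    and u: "u \<in> tangent_space M p" and w: "w \<in> tangent_space M p"
  shows "v \<in> tangent_space M p \<Longrightarrow> g p (\<lambda>f. u f + v f) w = g p u w + g p v w"
    "v \<in> tangent_space M p \<Longrightarrow> g p (\<lambda>f. u f - v f) w = g p u w - g p v w"
    "g p (\<lambda>f. a * u f) w = a * g p u w"
    "g p (\<lambda>f. 0) w = 0"
  using metricD(2)[OF g p u _ w, of v 1 1] metricD(2)[OF g p u _ w, of v 1 "-1"]
    metricD(2)[OF g p u u w, of a 0] metricD(2)[OF g p u u w, of 0 0] by auto

lemma metric_right:
  assumes M: "smooth_manifold M" and g: "pseudo_riemannian_metric M g" and p: "p \<in> topspace (mtop M)"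
    and u: "u \<in> tangent_space M p" and w: "w \<in> tangent_space M p"
  shows "v \<in> tangent_space M p \<Longrightarrow> g p w (\<lambda>f. u f + v f) = g p w u + g p w v"
    "v \<in> tangent_space M p \<Longrightarrow> g p w (\<lambda>f. u f - v f) = g p w u - g p w v"
    "g p w (\<lambda>f. a * u f) = a * g p w u"
  using metric_left[OF M g p u w] metricD(1)[OF g p w] u
    tangent_add[OF M p u] tangent_diff[OF M p u] tangent_scale[OF M p u] by auto

lemma metric_sum_left:
  assumes M: "smooth_manifold M" and g: "pseudo_riemannian_metric M g" and p: "p \<in> topspace (mtop M)"
    and w: "w \<in> tangent_space M p" and u: "\<And>i. i \<in> I \<Longrightarrow> u i \<in> tangent_space M p"
  shows "g p (\<lambda>f. \<Sum>i\<in>I. a i * u i f) w = (\<Sum>i\<in>I. a i * g p (u i) w)"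
  using u
proof (induction I rule: infinite_finite_induct)
  case (insert i I)
  have "(\<lambda>f. \<Sum>i\<in>I. a i * u i f) \<in> tangent_space M p"
    using insert.prems by (intro tangent_sum[OF M p]) auto
  then show ?case
    using insert metric_left(1)[OF M g p tangent_scale[OF M p, of "u i" "a i"] w, of "\<lambda>f. \<Sum>i\<in>I. a i * u i f"]
      metric_left(3)[OF M g p, of "u i" w "a i"] w by simp
qed (use metric_left(4)[OF M g p tangent_zero[OF M p] w] in auto)

lemma metric_eqI:
  assumes M: "smooth_manifold M" and g: "pseudo_riemannian_metric M g" and p: "p \<in> topspace (mtop M)"
    and u: "u \<in> tangent_space M p" and v: "v \<in> tangent_space M p"
    and eq: "\<And>w. w \<in> tangent_space M p \<Longrightarrow> g p u w = g p v w"
  shows "u = v"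
proof -
  have "(\<lambda>f. u f - v f) = (\<lambda>f. 0)"
    by (rule metricD(3)[OF g p tangent_diff[OF M p u v]]) (use metric_left(2)[OF M g p u _ v] eq in simp)
  then show ?thesis by (auto simp: fun_eq_iff)
qed

text \<open>Induced and semi-dual connections are known through their products with fields, so
  identities between their values are tested in this way.\<close>

lemma vector_field_eqI:
  assumes M: "smooth_manifold M" and g: "pseudo_riemannian_metric M g"
    and W: "W \<in> vector_fields M" "W' \<in> vector_fields M"
    and eq: "\<And>Y p. Y \<in> vector_fields M \<Longrightarrow> p \<in> topspace (mtop M) \<Longrightarrow> g p (Y p) (W p) = g p (Y p) (W' p)"
  shows "W = W'"
proof
  fix p
  show "W p = W' p"
  proof (cases "p \<in> topspace (mtop M)")
    case True
    note t = vector_fieldsD(1)[OF W(1) True] vector_fieldsD(1)[OF W(2) True]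
    show ?thesis
    proof (rule metric_eqI[OF M g True t])
      fix w assume w: "w \<in> tangent_space M p"
      obtain Y where Y: "Y \<in> vector_fields M" "Y p = w" using field_through[OF M True w] .
      then show "g p (W p) w = g p (W' p) w"
        using eq[OF Y(1) True] metricD(1)[OF g True w] t by metis
    qed
  qed (simp add: vector_fieldsD(2)[OF W(1)] vector_fieldsD(2)[OF W(2)])
qed

section \<open>Riesz representation by a non-degenerate metric\<close>

text \<open>The Gram matrix is read as an endomorphism of the model space. Non-degeneracy makes it
  injective, and finite dimension then makes it surjective; no definiteness enters.\<close>

lemma metric_riesz:
  fixes M :: "('a, 'e::real_inner) manifold"
  assumes M: "smooth_manifold M" and g: "pseudo_riemannian_metric M g" and p: "p \<in> topspace (mtop M)"
    and l: "\<And>u v a b. u \<in> tangent_space M p \<Longrightarrow> v \<in> tangent_space M p \<Longrightarrow> l (\<lambda>f. a * u f + b * v f) = a * l u + b * l v"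
  obtains u where "u \<in> tangent_space M p" "\<And>v. v \<in> tangent_space M p \<Longrightarrow> g p u v = l v"
proof -
  obtain U \<phi> where U: "(U, \<phi>) \<in> charts M" "p \<in> U" using chart_at[OF M p] by metis
  obtain B :: "'e set" where B: "onb B" using smooth_manifold_onb[OF M] by blast
  let ?t = "coord_tangent M U \<phi> p"
  note T = tangent_space_eq_coord[OF M U]
  have t: "?t v \<in> tangent_space M p" for v using T by blast
  note comb = coord_tangent_combination[OF M U]
  have linG: "linear (\<lambda>v. F (?t v))"
    if F: "\<And>u v a b. u \<in> tangent_space M p \<Longrightarrow> v \<in> tangent_space M p \<Longrightarrow> F (\<lambda>f. a * u f + b * v f) = a * F u + b * F v"
    for F :: "'a tangent \<Rightarrow> real"
  proof (rule linearI)
    show "F (?t (v + w)) = F (?t v) + F (?t w)" for v w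
      using F[OF t t, of 1 v 1 w] comb[of 1 v 1 w] by simp
    show "F (?t (a *\<^sub>R v)) = a *\<^sub>R F (?t v)" for a v
      using F[OF t t, of a v 0 v] comb[of a v 0 v] by simp
  qed
  have lg: "linear (\<lambda>v. g p (?t v) w)" if "w \<in> tangent_space M p" for w
    by (rule linG) (rule metricD(2)[OF g p _ _ that])
  have ll: "linear (\<lambda>v. l (?t v))" by (rule linG[OF l])
  \<comment> \<open>\<open>A v\<close> collects the coordinates of the functional
    \<open>g p (?t v)\<close> in the basis \<open>B\<close>.\<close>
  define A where "A v = (\<Sum>c\<in>B. g p (?t v) (?t c) *\<^sub>R c)" for v
  have linA: "linear A"
    unfolding A_def
    by (rule linearI) (simp_all add: linear_add[OF lg[OF t]] linear_scale[OF lg[OF t]] scaleR_add_left sum.distrib scaleR_sum_right)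
  have full: "g p (?t v) (?t w) = (\<Sum>c\<in>B. (w \<bullet> c) * g p (?t v) (?t c))" for v w
    using onb_linear_expand[OF B lg[OF t], of w v] metricD(1)[OF g p t t] by simp
  have ker: "v = 0" if "A v = 0" for v
  proof -
    have z: "g p (?t v) (?t c) = 0" if "c \<in> B" for c
      using onb_coord[OF B that, of "\<lambda>c. g p (?t v) (?t c)"] \<open>A v = 0\<close> by (simp add: A_def)
    have "g p (?t v) w = 0" if w: "w \<in> tangent_space M p" for w
    proof -
      obtain y where "w = ?t y" using w T by auto
      then show ?thesis unfolding full[of v y] \<open>w = ?t y\<close> by (simp add: z)
    qed
    then have "?t v = (\<lambda>f. 0)" using metricD(3)[OF g p t] by blast
    then show ?thesis by (rule coord_tangent_eq_0[OF M U])
  qed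
  have "surj A"
  proof -
    have "independent B"
    proof (rule pairwise_orthogonal_independent)
      show "pairwise orthogonal B" using onb_inner[OF B] by (auto simp: pairwise_def orthogonal_def)
      show "0 \<notin> B" using onb_inner[OF B, of 0 0] by auto
    qed
    then interpret fd: finite_dimensional_vector_space "scaleR :: real \<Rightarrow> 'e \<Rightarrow> 'e" B
      using onb_span[OF B] by unfold_locales (auto simp: dependent_raw_def span_raw_def)
    have "Vector_Spaces.linear scaleR scaleR A" using linA by (simp add: linear_def)
    moreover have "inj A" using ker linA by (simp add: linear_injective_0)
    ultimately show ?thesis by (rule fd.linear_inj_imp_surj)
  qed
  \<comment> \<open>The preimage of the coordinate vector of \<open>l\<close>.\<close>
  then obtain v where v: "A v = (\<Sum>c\<in>B. l (?t c) *\<^sub>R c)" by (metis surjD)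
  have "g p (?t v) (?t c) = l (?t c)" if "c \<in> B" for c
    using arg_cong[OF v, of "\<lambda>z. z \<bullet> c"] onb_coord[OF B that] by (simp add: A_def)
  then have "g p (?t v) (?t w) = l (?t w)" for w
    using full[of v w] onb_linear_expand[OF B ll, of w] by simp
  then have "g p (?t v) w = l w" if "w \<in> tangent_space M p" for w using that T by auto
  then show ?thesis using that t by blast
qed

text \<open>The smoothness test for fields that are only given pointwise, such as tangential
  components and Riesz representatives.\<close>

lemma vector_field_of_metric:
  assumes M: "smooth_manifold M" and g: "pseudo_riemannian_metric M g"
    and tan: "\<And>p. p \<in> topspace (mtop M) \<Longrightarrow> W p \<in> tangent_space M p"
    and out: "\<And>p. p \<notin> topspace (mtop M) \<Longrightarrow> W p = (\<lambda>f. 0)"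
    and smooth: "\<And>Y. Y \<in> vector_fields M \<Longrightarrow> (\<lambda>p. g p (W p) (Y p)) \<in> smooth_functions M"
  shows "W \<in> vector_fields M"
proof -
  have "(\<lambda>q. W q f) \<in> smooth_functions M" if f: "f \<in> smooth_functions M" for f
  proof (rule smooth_functionsI[OF M])
    fix p assume p: "p \<in> topspace (mtop M)"
    obtain \<Omega> x E B where F: "local_frame M \<Omega> B x E" "p \<in> \<Omega>" using local_frame_at[OF M p] .
    note D = local_frameD[OF F(1)]
    obtain U \<phi> where U: "(U, \<phi>) \<in> charts M" "p \<in> U" using chart_at[OF M p] by metis
    let ?V = "U \<inter> \<Omega>"
    let ?i = "inv_into U \<phi>"
    have oV: "openin (mtop M) ?V" using chart_facts(1)[OF M U(1)] D(1) by blast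
    have o: "open (\<phi> ` ?V)" by (rule chart_open_image[OF M U(1) oV]) simp
    have inv: "?i y \<in> \<Omega>" "?i y \<in> topspace (mtop M)" if "y \<in> \<phi> ` ?V" for y
      using that chart_inv[OF M U(1)] chart_facts(3)[OF M U(1)] by auto
    have ch: "smooth_on (\<phi> ` ?V) (\<lambda>y. h (?i y))" if "h \<in> smooth_functions M" for h
      by (rule smooth_on_subset[OF smooth_functions_chart[OF M that U(1)]]) blast
    have ck: "Ck_on k (\<phi> ` ?V) (\<lambda>y. h (?i y))" if "h \<in> smooth_functions M" for h k
      using ch[OF that] by (simp add: smooth_on_def)
    have tE: "E b q \<in> tangent_space M q" if "b \<in> B" "q \<in> topspace (mtop M)" for b q
      using vector_fieldsD(1)[OF D(4)[OF that(1)] that(2)] .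
    have expand: "W q f = (\<Sum>b\<in>B. W q (x b) * E b q f)" if "q \<in> \<Omega>" "q \<in> topspace (mtop M)" for q f
      by (rule D(6)[OF that(1) tan[OF that(2)]])
    have comp: "smooth_on (\<phi> ` ?V) (\<lambda>y. W (?i y) (x j))" if j: "j \<in> B" for j
      unfolding smooth_on_def
    proof
      fix k
      show "Ck_on k (\<phi> ` ?V) (\<lambda>y. W (?i y) (x j))"
      proof (rule Ck_on_linear_solution[where J = B and I = B and w = "\<lambda>b y. W (?i y) (x b)"
            and A = "\<lambda>c b y. g (?i y) (E b (?i y)) (E c (?i y))"
            and b = "\<lambda>c y. g (?i y) (W (?i y)) (E c (?i y))"])
        show "finite B" "open (\<phi> ` ?V)" "j \<in> B" by (fact D(2) o j)+
        show "Ck_on k (\<phi> ` ?V) (\<lambda>y. g (?i y) (E b (?i y)) (E c (?i y)))" if "c \<in> B" "b \<in> B" for c b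
          by (rule ck[OF metricD(4)[OF g D(4)[OF that(2)] D(4)[OF that(1)]]])
        show "Ck_on k (\<phi> ` ?V) (\<lambda>y. g (?i y) (W (?i y)) (E c (?i y)))" if "c \<in> B" for c
          by (rule ck[OF smooth[OF D(4)[OF that]]])
        show "(\<Sum>b\<in>B. g (?i y) (E b (?i y)) (E c (?i y)) * W (?i y) (x b)) = g (?i y) (W (?i y)) (E c (?i y))"
          if y: "y \<in> \<phi> ` ?V" and c: "c \<in> B" for y c
        proof -
          let ?q = "?i y"
          note q = inv[OF y]
          have "W ?q = (\<lambda>f. \<Sum>b\<in>B. W ?q (x b) * E b ?q f)" by (rule ext) (rule expand[OF q])
          then have "g ?q (W ?q) (E c ?q) = g ?q (\<lambda>f. \<Sum>b\<in>B. W ?q (x b) * E b ?q f) (E c ?q)"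
            by (rule arg_cong[where f = "\<lambda>v. g ?q v (E c ?q)"])
          also have "\<dots> = (\<Sum>b\<in>B. W ?q (x b) * g ?q (E b ?q) (E c ?q))"
            by (rule metric_sum_left[OF M g q(2) tE[OF c q(2)] tE[OF _ q(2)]])
          finally show ?thesis by (simp add: mult.commute)
        qed
        \<comment> \<open>A kernel vector of the Gram matrix is a tangent vector \<open>?v\<close>
          orthogonal to the frame, hence to all tangent vectors. By non-degeneracy it is 0, and
          evaluation at the coordinate function \<open>x l\<close> returns its coefficient at
          \<open>l\<close>.\<close>
        show "u l = 0" if y: "y \<in> \<phi> ` ?V"
          and u: "\<And>c. c \<in> B \<Longrightarrow> (\<Sum>b\<in>B. g (?i y) (E b (?i y)) (E c (?i y)) * u b) = 0" and l: "l \<in> B" for y u l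
        proof -
          let ?q = "?i y"
          note q = inv[OF y]
          let ?v = "\<lambda>f. \<Sum>b\<in>B. u b * E b ?q f"
          have tv: "?v \<in> tangent_space M ?q" by (rule tangent_sum[OF M q(2) tE[OF _ q(2)]])
          have gE: "g ?q ?v (E c ?q) = 0" if c: "c \<in> B" for c
            using metric_sum_left[OF M g q(2) tE[OF c q(2)] tE[OF _ q(2)], of B "\<lambda>b. b" u] u[OF c]
            by (simp add: mult.commute)
          have "g ?q ?v w = 0" if w: "w \<in> tangent_space M ?q" for w
          proof -
            have "w = (\<lambda>f. \<Sum>b\<in>B. w (x b) * E b ?q f)" by (rule ext) (rule D(6)[OF q(1) w])
            then have "g ?q w ?v = g ?q (\<lambda>f. \<Sum>b\<in>B. w (x b) * E b ?q f) ?v"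
              by (rule arg_cong[where f = "\<lambda>w. g ?q w ?v"])
            also have "\<dots> = (\<Sum>b\<in>B. w (x b) * g ?q (E b ?q) ?v)"
              by (rule metric_sum_left[OF M g q(2) tv tE[OF _ q(2)]])
            also have "\<dots> = 0"
              using gE metricD(1)[OF g q(2) tv tE[OF _ q(2)]] by (intro sum.neutral) auto
            finally show ?thesis using metricD(1)[OF g q(2) tv w] by simp
          qed
          then have v0: "?v = (\<lambda>f. 0)" using metricD(3)[OF g q(2) tv] by blast
          have "?v (x l) = (\<Sum>b\<in>B. if b = l then u b else 0)"
            by (intro sum.cong refl) (use D(5)[OF q(1) _ l] in auto)
          then show ?thesis using fun_cong[OF v0, of "x l"] D(2) l by simp
        qed
      qed
    qed
    have "smooth_on (\<phi> ` ?V) (\<lambda>y. \<Sum>b\<in>B. W (?i y) (x b) * E b (?i y) f)"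
      unfolding smooth_on_def
    proof (intro allI Ck_on_sum[OF o] Ck_on_mult[OF o])
      show "Ck_on k (\<phi> ` ?V) (\<lambda>y. W (?i y) (x b))" if "b \<in> B" for k b
        using comp[OF that] by (simp add: smooth_on_def)
      show "Ck_on k (\<phi> ` ?V) (\<lambda>y. E b (?i y) f)" if "b \<in> B" for k b
        by (rule ck[OF vector_fieldsD(3)[OF D(4)[OF that] f]])
    qed
    then have "smooth_on (\<phi> ` ?V) (\<lambda>y. W (?i y) f)"
      by (rule smooth_on_cong[OF o, rotated]) (rule expand[OF inv, symmetric])
    then show "\<exists>U \<phi> W'. (U, \<phi>) \<in> charts M \<and> openin (mtop M) W' \<and> p \<in> W' \<and> W' \<subseteq> U \<and>
       smooth_on (\<phi> ` W') (\<lambda>y. W (inv_into U \<phi> y) f)"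
      using U F(2) oV by blast
  qed
  then show ?thesis using tan out by (simp add: vector_fields_def)
qed

text \<open>Since \<open>\<Lambda>\<close> is linear over the smooth functions, its value at
  \<open>p\<close> is a linear functional of the vector \<open>Y p\<close> alone, which has a Riesz
  representative; these representatives together form a smooth field.\<close>

lemma vector_field_riesz:
  assumes M: "smooth_manifold M" and g: "pseudo_riemannian_metric M g"
    and add: "\<And>X Y p. X \<in> vector_fields M \<Longrightarrow> Y \<in> vector_fields M \<Longrightarrow> p \<in> topspace (mtop M) \<Longrightarrow>
      \<Lambda> (\<lambda>q f. X q f + Y q f) p = \<Lambda> X p + (\<Lambda> Y p :: real)"
    and scale: "\<And>h X p. h \<in> smooth_functions M \<Longrightarrow> X \<in> vector_fields M \<Longrightarrow> p \<in> topspace (mtop M) \<Longrightarrow>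
      \<Lambda> (\<lambda>q f. h q * X q f) p = h p * \<Lambda> X p"
    and smooth: "\<And>X. X \<in> vector_fields M \<Longrightarrow> \<Lambda> X \<in> smooth_functions M"
  obtains W where "W \<in> vector_fields M"
    "\<And>Y p. Y \<in> vector_fields M \<Longrightarrow> p \<in> topspace (mtop M) \<Longrightarrow> g p (Y p) (W p) = \<Lambda> Y p"
proof -
  have "\<exists>u. u \<in> tangent_space M p \<and> (\<forall>Y\<in>vector_fields M. g p u (Y p) = \<Lambda> Y p)"
    if p: "p \<in> topspace (mtop M)" for p
  proof -
    obtain l where l: "\<And>X. X \<in> vector_fields M \<Longrightarrow> \<Lambda> X p = l (X p)"
      "\<And>u v a b. u \<in> tangent_space M p \<Longrightarrow> v \<in> tangent_space M p \<Longrightarrow> l (\<lambda>f. a * u f + b * v f) = a * l u + b * l v"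
      by (rule tensor_functional[where \<Lambda> = "\<lambda>X. \<Lambda> X p", OF M p add[OF _ _ p] scale[OF _ _ p]])
        (assumption | rule that)+
    obtain u where "u \<in> tangent_space M p" "\<And>v. v \<in> tangent_space M p \<Longrightarrow> g p u v = l v"
      by (rule metric_riesz[OF M g p l(2)]) (assumption | rule that)+
    then show ?thesis using l(1) vector_fieldsD(1)[OF _ p] by metis
  qed
  then obtain W0 where W0: "\<And>p. p \<in> topspace (mtop M) \<Longrightarrow> W0 p \<in> tangent_space M p"
    "\<And>p Y. p \<in> topspace (mtop M) \<Longrightarrow> Y \<in> vector_fields M \<Longrightarrow> g p (W0 p) (Y p) = \<Lambda> Y p" by metis
  \<comment> \<open>Pointwise choice leaves the values outside \<open>M\<close> open, while vector
    fields vanish there by convention.\<close>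
  define W where "W p = (if p \<in> topspace (mtop M) then W0 p else (\<lambda>f. 0))" for p
  have gW: "g p (W p) (Y p) = \<Lambda> Y p" if "p \<in> topspace (mtop M)" "Y \<in> vector_fields M" for p Y
    using W0(2)[OF that] that(1) by (simp add: W_def)
  have W: "W \<in> vector_fields M"
  proof (rule vector_field_of_metric[OF M g])
    show "W p \<in> tangent_space M p" if "p \<in> topspace (mtop M)" for p using W0(1)[OF that] that by (simp add: W_def)
    show "W p = (\<lambda>f. 0)" if "p \<notin> topspace (mtop M)" for p using that by (simp add: W_def)
    \<comment> \<open>The product agrees with \<open>\<Lambda> Y\<close> on \<open>M\<close> only,
      so smoothness is carried over by the local criterion, with all of \<open>M\<close> as the
      neighbourhood.\<close>
    show "(\<lambda>p. g p (W p) (Y p)) \<in> smooth_functions M" if Y: "Y \<in> vector_fields M" for Y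
      by (rule smooth_functions_locally[OF M])
        (use gW Y smooth[OF Y] in \<open>blast intro: openin_topspace\<close>)
  qed
  show ?thesis
    using that[OF W] gW metricD(1)[OF g _ vector_fieldsD(1)[OF W] vector_fieldsD(1)] by metis
qed

section \<open>Connections\<close>

lemma connectionD:
  assumes "affine_connection M D"
  shows "X \<in> vector_fields M \<Longrightarrow> Y \<in> vector_fields M \<Longrightarrow> D X Y \<in> vector_fields M"
    "X \<in> vector_fields M \<Longrightarrow> Y \<in> vector_fields M \<Longrightarrow> Z \<in> vector_fields M \<Longrightarrow>
      D (\<lambda>p f. X p f + Y p f) Z = (\<lambda>p f. D X Z p f + D Y Z p f)"
    "X \<in> vector_fields M \<Longrightarrow> Y \<in> vector_fields M \<Longrightarrow> Z \<in> vector_fields M \<Longrightarrow>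
      D X (\<lambda>p f. Y p f + Z p f) = (\<lambda>p f. D X Y p f + D X Z p f)"
    "h \<in> smooth_functions M \<Longrightarrow> X \<in> vector_fields M \<Longrightarrow> Y \<in> vector_fields M \<Longrightarrow>
      D (\<lambda>p f. h p * X p f) Y = (\<lambda>p f. h p * D X Y p f)"
    "h \<in> smooth_functions M \<Longrightarrow> X \<in> vector_fields M \<Longrightarrow> Y \<in> vector_fields M \<Longrightarrow>
      D X (\<lambda>p f. h p * Y p f) = (\<lambda>p f. X p h * Y p f + h p * D X Y p f)"
  using assms by (simp_all add: affine_connection_def)

text \<open>For fixed \<open>f\<close> the map \<open>X \<mapsto> D X Y p f\<close> is linear over
  the smooth functions.\<close>

lemma connection_left_pointwise:
  assumes M: "smooth_manifold M" and D: "affine_connection M D" and p: "p \<in> topspace (mtop M)"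
    and X: "X \<in> vector_fields M" "X' \<in> vector_fields M" "X p = X' p" and Y: "Y \<in> vector_fields M"
  shows "D X Y p = D X' Y p"
proof
  fix f
  show "D X Y p f = D X' Y p f"
    by (rule tensor_cong[where \<Lambda> = "\<lambda>X. D X Y p f", OF M p _ _ X])
      (simp_all add: connectionD(2)[OF D _ _ Y] connectionD(4)[OF D _ _ Y])
qed

lemma connection_sum_right:
  assumes M: "smooth_manifold M" and D: "affine_connection M D" and p: "p \<in> topspace (mtop M)"
    and S: "S \<in> vector_fields M" and "finite I"
    and "\<And>i. i \<in> I \<Longrightarrow> h i \<in> smooth_functions M" "\<And>i. i \<in> I \<Longrightarrow> X i \<in> vector_fields M"
  shows "D S (\<lambda>q f. \<Sum>i\<in>I. h i q * X i q f) p f = (\<Sum>i\<in>I. S p (h i) * X i p f + h i p * D S (X i) p f)"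
  using assms(5-7)
proof (induction I rule: finite_induct)
  case empty
  have "S p (\<lambda>q. 0) = 0" by (rule tangent_of_const[OF M p vector_fieldsD(1)[OF S p]])
  then show ?case
    using connectionD(5)[OF D smooth_functions_const[OF M, of 0] S vector_fields_zero[OF M]]
    by (simp add: fun_eq_iff)
next
  case (insert i I)
  have "(\<lambda>q f. \<Sum>i\<in>I. h i q * X i q f) \<in> vector_fields M"
    using insert.prems by (intro vector_fields_sum[OF M]) auto
  then show ?case
    using insert connectionD(3)[OF D S vector_fields_scale[OF M, of "h i" "X i"], of "\<lambda>q f. \<Sum>i\<in>I. h i q * X i q f"]
      connectionD(5)[OF D _ S, of "h i" "X i"] by simp
qed

text \<open>By the Leibniz rule in a frame, \<open>D S T p\<close> involves only the components of
  \<open>T\<close> at \<open>p\<close> and their derivatives along \<open>S p\<close>; both vanish.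
  This is how independence of the extension of the second argument is obtained.\<close>

lemma connection_right_zero:
  assumes M: "smooth_manifold M" and D: "affine_connection M D" and p: "p \<in> topspace (mtop M)"
    and S: "S \<in> vector_fields M" and T: "T \<in> vector_fields M" "T p = (\<lambda>f. 0)"
    and der: "\<And>f. f \<in> smooth_functions M \<Longrightarrow> S p (\<lambda>q. T q f) = 0"
  shows "D S T p = (\<lambda>f. 0)"
proof
  fix f
  obtain W x E B where F: "local_frame M W B x E" "p \<in> W" using local_frame_at[OF M p] .
  note L = local_frameD[OF F(1)]
  obtain \<beta> where \<beta>: "\<beta> \<in> smooth_functions M" "\<beta> p = 1"
    "\<And>X. X \<in> vector_fields M \<Longrightarrow> (\<lambda>q f. \<beta> q * X q f) = (\<lambda>q f. \<Sum>b\<in>B. (\<beta> q * X q (x b)) * E b q f)"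
    by (rule local_frame_cutoff[OF M F]) (rule that; assumption)
  have t: "(\<lambda>q. \<beta> q * T q (x b)) \<in> smooth_functions M" if "b \<in> B" for b
    by (rule smooth_functions_mult[OF M \<beta>(1) vector_fieldsD(3)[OF T(1) L(3)[OF that]]])
  \<comment> \<open>The additional Leibniz term contains \<open>T p\<close> and so drops
    out.\<close>
  have "D S T p f = D S (\<lambda>q f. \<beta> q * T q f) p f"
    using connectionD(5)[OF D \<beta>(1) S T(1)] \<beta>(2) T(2) by simp
  also have "\<dots> = D S (\<lambda>q f. \<Sum>b\<in>B. (\<beta> q * T q (x b)) * E b q f) p f" by (simp only: \<beta>(3)[OF T(1)])
  also have "\<dots> = (\<Sum>b\<in>B. S p (\<lambda>q. \<beta> q * T q (x b)) * E b p f + (\<beta> p * T p (x b)) * D S (E b) p f)"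
    by (rule connection_sum_right[OF M D p S L(2) t L(4)])
  also have "\<dots> = 0"
  proof (rule sum.neutral, rule ballI)
    fix b assume b: "b \<in> B"
    have "S p (\<lambda>q. \<beta> q * T q (x b)) = 0"
      using tangent_of_mult[OF M p vector_fieldsD(1)[OF S p] \<beta>(1) vector_fieldsD(3)[OF T(1) L(3)[OF b]]]
        der[OF L(3)[OF b]] T(2) by simp
    then show "S p (\<lambda>q. \<beta> q * T q (x b)) * E b p f + (\<beta> p * T p (x b)) * D S (E b) p f = 0"
      using T(2) by simp
  qed
  finally show "D S T p f = 0" .
qed

subsection \<open>Semi-dual connections\<close>

lemma one_formD:
  assumes "one_form M \<eta>"
  shows "p \<in> topspace (mtop M) \<Longrightarrow> u \<in> tangent_space M p \<Longrightarrow> v \<in> tangent_space M p \<Longrightarrow>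
      \<eta> p (\<lambda>f. a * u f + b * v f) = a * \<eta> p u + b * \<eta> p v"
    "X \<in> vector_fields M \<Longrightarrow> (\<lambda>p. \<eta> p (X p)) \<in> smooth_functions M"
  using assms by (simp_all add: one_form_def)

text \<open>Bilinearity of \<open>g\<close> holds at points of \<open>M\<close> only, so the
  differentiated functions are compared through \<open>tangent_cong\<close>.\<close>

lemma derivative_of_metric_add:
  assumes M: "smooth_manifold M" and g: "pseudo_riemannian_metric M g" and p: "p \<in> topspace (mtop M)"
    and u: "u \<in> tangent_space M p" and Y: "Y \<in> vector_fields M" "Y' \<in> vector_fields M" and Z: "Z \<in> vector_fields M"
  shows "u (\<lambda>q. g q (\<lambda>f. Y q f + Y' q f) (Z q)) = u (\<lambda>q. g q (Y q) (Z q)) + u (\<lambda>q. g q (Y' q) (Z q))"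
    and "u (\<lambda>q. g q (Z q) (\<lambda>f. Y q f + Y' q f)) = u (\<lambda>q. g q (Z q) (Y q)) + u (\<lambda>q. g q (Z q) (Y' q))"
proof -
  note m = metricD(4)[OF g Y(1) Z] metricD(4)[OF g Y(2) Z] metricD(4)[OF g Z Y(1)] metricD(4)[OF g Z Y(2)]
  note YY = vector_fields_add[OF M Y]
  note t = vector_fieldsD(1)[OF Y(1)] vector_fieldsD(1)[OF Y(2)] vector_fieldsD(1)[OF Z]
  have "u (\<lambda>q. g q (\<lambda>f. Y q f + Y' q f) (Z q)) = u (\<lambda>q. g q (Y q) (Z q) + g q (Y' q) (Z q))"
    by (rule tangent_cong[OF M p u metricD(4)[OF g YY Z] smooth_functions_add[OF M m(1,2)]])
      (simp add: metric_left(1)[OF M g _ t(1) t(3) t(2)])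
  then show "u (\<lambda>q. g q (\<lambda>f. Y q f + Y' q f) (Z q)) = u (\<lambda>q. g q (Y q) (Z q)) + u (\<lambda>q. g q (Y' q) (Z q))"
    using tangent_of_add[OF M p u m(1,2)] by simp
  have "u (\<lambda>q. g q (Z q) (\<lambda>f. Y q f + Y' q f)) = u (\<lambda>q. g q (Z q) (Y q) + g q (Z q) (Y' q))"
    by (rule tangent_cong[OF M p u metricD(4)[OF g Z YY] smooth_functions_add[OF M m(3,4)]])
      (simp add: metric_right(1)[OF M g _ t(1) t(3) t(2)])
  then show "u (\<lambda>q. g q (Z q) (\<lambda>f. Y q f + Y' q f)) = u (\<lambda>q. g q (Z q) (Y q)) + u (\<lambda>q. g q (Z q) (Y' q))"
    using tangent_of_add[OF M p u m(3,4)] by simp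
qed

lemma derivative_of_metric_scale:
  assumes M: "smooth_manifold M" and g: "pseudo_riemannian_metric M g" and p: "p \<in> topspace (mtop M)"
    and u: "u \<in> tangent_space M p" and h: "h \<in> smooth_functions M" and Y: "Y \<in> vector_fields M" and Z: "Z \<in> vector_fields M"
  shows "u (\<lambda>q. g q (\<lambda>f. h q * Y q f) (Z q)) = h p * u (\<lambda>q. g q (Y q) (Z q)) + u h * g p (Y p) (Z p)"
    and "u (\<lambda>q. g q (Z q) (\<lambda>f. h q * Y q f)) = h p * u (\<lambda>q. g q (Z q) (Y q)) + u h * g p (Z p) (Y p)"
proof -
  note m = metricD(4)[OF g Y Z] metricD(4)[OF g Z Y]
  note hY = vector_fields_scale[OF M h Y]
  note t = vector_fieldsD(1)[OF Y] vector_fieldsD(1)[OF Z]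
  have "u (\<lambda>q. g q (\<lambda>f. h q * Y q f) (Z q)) = u (\<lambda>q. h q * g q (Y q) (Z q))"
    by (rule tangent_cong[OF M p u metricD(4)[OF g hY Z] smooth_functions_mult[OF M h m(1)]])
      (simp add: metric_left(3)[OF M g _ t])
  then show "u (\<lambda>q. g q (\<lambda>f. h q * Y q f) (Z q)) = h p * u (\<lambda>q. g q (Y q) (Z q)) + u h * g p (Y p) (Z p)"
    using tangent_of_mult[OF M p u h m(1)] by simp
  have "u (\<lambda>q. g q (Z q) (\<lambda>f. h q * Y q f)) = u (\<lambda>q. h q * g q (Z q) (Y q))"
    by (rule tangent_cong[OF M p u metricD(4)[OF g Z hY] smooth_functions_mult[OF M h m(2)]])
      (simp add: metric_right(3)[OF M g _ t])
  then show "u (\<lambda>q. g q (Z q) (\<lambda>f. h q * Y q f)) = h p * u (\<lambda>q. g q (Z q) (Y q)) + u h * g p (Z p) (Y p)"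
    using tangent_of_mult[OF M p u h m(2)] by simp
qed

text \<open>The right-hand side is linear in \<open>Y\<close> over the smooth functions: replacing
  \<open>Y\<close> by its product with \<open>h\<close>, the term
  \<open>X p h * g p (Y p) (Z p)\<close> arises both from differentiating the metric and from the
  Leibniz rule of \<open>D\<close>, with opposite signs.\<close>

lemma semi_dual_exists:
  assumes M: "smooth_manifold M" and g: "pseudo_riemannian_metric M g" and \<eta>: "one_form M \<eta>"
    and D: "affine_connection M D" and X: "X \<in> vector_fields M" and Z: "Z \<in> vector_fields M"
  obtains W where "W \<in> vector_fields M"
    "\<And>Y p. Y \<in> vector_fields M \<Longrightarrow> p \<in> topspace (mtop M) \<Longrightarrow>
      g p (Y p) (W p) = X p (\<lambda>q. g q (Y q) (Z q)) - g p (D X Y p) (Z p) + \<eta> p (X p) * g p (Y p) (Z p)"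
proof (rule vector_field_riesz[OF M g, where \<Lambda> = "\<lambda>Y p. X p (\<lambda>q. g q (Y q) (Z q)) - g p (D X Y p) (Z p)
      + \<eta> p (X p) * g p (Y p) (Z p)"])
  note tX = vector_fieldsD(1)[OF X] and tZ = vector_fieldsD(1)[OF Z]
  show "(\<lambda>p. X p (\<lambda>q. g q (Y q) (Z q)) - g p (D X Y p) (Z p) + \<eta> p (X p) * g p (Y p) (Z p)) \<in> smooth_functions M"
    if Y: "Y \<in> vector_fields M" for Y
    by (intro smooth_functions_add[OF M] smooth_functions_diff[OF M] smooth_functions_mult[OF M]
        vector_fieldsD(3)[OF X] metricD(4)[OF g] one_formD(2)[OF \<eta>] connectionD(1)[OF D] X Y Z)
  fix Y p assume Y: "Y \<in> vector_fields M" and p: "p \<in> topspace (mtop M)"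
  note tY = vector_fieldsD(1)[OF Y]
  note tDY = vector_fieldsD(1)[OF connectionD(1)[OF D X Y]]
  show "X p (\<lambda>q. g q (\<lambda>f. Y q f + Y' q f) (Z q)) - g p (D X (\<lambda>q f. Y q f + Y' q f) p) (Z p)
      + \<eta> p (X p) * g p (\<lambda>f. Y p f + Y' p f) (Z p) =
    X p (\<lambda>q. g q (Y q) (Z q)) - g p (D X Y p) (Z p) + \<eta> p (X p) * g p (Y p) (Z p) +
    (X p (\<lambda>q. g q (Y' q) (Z q)) - g p (D X Y' p) (Z p) + \<eta> p (X p) * g p (Y' p) (Z p))"
    if Y': "Y' \<in> vector_fields M" for Y'
    unfolding connectionD(3)[OF D X Y Y'] derivative_of_metric_add(1)[OF M g p tX[OF p] Y Y' Z]
      metric_left(1)[OF M g p tY[OF p] tZ[OF p] vector_fieldsD(1)[OF Y' p]]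
      metric_left(1)[OF M g p tDY[OF p] tZ[OF p] vector_fieldsD(1)[OF connectionD(1)[OF D X Y'] p]]
    by (simp add: algebra_simps)
  show "X p (\<lambda>q. g q (\<lambda>f. h q * Y q f) (Z q)) - g p (D X (\<lambda>q f. h q * Y q f) p) (Z p)
      + \<eta> p (X p) * g p (\<lambda>f. h p * Y p f) (Z p) =
    h p * (X p (\<lambda>q. g q (Y q) (Z q)) - g p (D X Y p) (Z p) + \<eta> p (X p) * g p (Y p) (Z p))"
    if h: "h \<in> smooth_functions M" for h
    unfolding connectionD(5)[OF D h X Y] derivative_of_metric_scale(1)[OF M g p tX[OF p] h Y Z]
      metricD(2)[OF g p tY[OF p] tDY[OF p] tZ[OF p], of "X p h" "h p"]
      metric_left(3)[OF M g p tY[OF p] tZ[OF p], of "h p"]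
    by (simp add: algebra_simps)
qed (rule that)

lemma semi_dual_eqI:
  assumes M: "smooth_manifold M" and g: "pseudo_riemannian_metric M g" and W: "W \<in> vector_fields M"
    and eq: "\<And>Y p. Y \<in> vector_fields M \<Longrightarrow> p \<in> topspace (mtop M) \<Longrightarrow>
      X p (\<lambda>q. g q (Y q) (Z q)) = g p (D X Y p) (Z p) + g p (Y p) (W p) - \<eta> p (X p) * g p (Y p) (Z p)"
  shows "semi_dual M g \<eta> D X Z = W"
  unfolding semi_dual_def
proof (rule the_equality)
  fix W'
  assume W': "W' \<in> vector_fields M \<and> (\<forall>Y\<in>vector_fields M. \<forall>p\<in>topspace (mtop M).
        X p (\<lambda>q. g q (Y q) (Z q)) = g p (D X Y p) (Z p) + g p (Y p) (W' p) - \<eta> p (X p) * g p (Y p) (Z p))"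
  show "W' = W"
  proof (rule vector_field_eqI[OF M g _ W])
    show "g p (Y p) (W' p) = g p (Y p) (W p)" if "Y \<in> vector_fields M" "p \<in> topspace (mtop M)" for Y p
      using eq[OF that] W' that by force
  qed (use W' in blast)
qed (use W eq in blast)

lemma semi_dual:
  assumes M: "smooth_manifold M" and g: "pseudo_riemannian_metric M g" and \<eta>: "one_form M \<eta>"
    and D: "affine_connection M D" and X: "X \<in> vector_fields M" and Z: "Z \<in> vector_fields M"
  shows "semi_dual M g \<eta> D X Z \<in> vector_fields M"
    "Y \<in> vector_fields M \<Longrightarrow> p \<in> topspace (mtop M) \<Longrightarrow> g p (Y p) (semi_dual M g \<eta> D X Z p) =
      X p (\<lambda>q. g q (Y q) (Z q)) - g p (D X Y p) (Z p) + \<eta> p (X p) * g p (Y p) (Z p)"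
proof -
  obtain W where W: "W \<in> vector_fields M" "\<And>Y p. Y \<in> vector_fields M \<Longrightarrow> p \<in> topspace (mtop M) \<Longrightarrow>
      g p (Y p) (W p) = X p (\<lambda>q. g q (Y q) (Z q)) - g p (D X Y p) (Z p) + \<eta> p (X p) * g p (Y p) (Z p)"
    by (rule semi_dual_exists[OF M g \<eta> D X Z]) (rule that; assumption)
  have "semi_dual M g \<eta> D X Z = W"
    by (rule semi_dual_eqI[OF M g W(1)]) (simp add: W(2))
  then show "semi_dual M g \<eta> D X Z \<in> vector_fields M"
    "Y \<in> vector_fields M \<Longrightarrow> p \<in> topspace (mtop M) \<Longrightarrow> g p (Y p) (semi_dual M g \<eta> D X Z p) =
      X p (\<lambda>q. g q (Y q) (Z q)) - g p (D X Y p) (Z p) + \<eta> p (X p) * g p (Y p) (Z p)"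
    using W by simp_all
qed

text \<open>The facts about induced connections are stated for affine connections, so they reach the
  semi-dual connection only through this lemma. Each law is tested against a field \<open>V\<close>,
  where the defining identity reduces it to a law of \<open>D\<close>, \<open>g\<close> or
  \<open>\<eta>\<close>.\<close>

lemma semi_dual_affine_connection:
  assumes M: "smooth_manifold M" and g: "pseudo_riemannian_metric M g" and \<eta>: "one_form M \<eta>"
    and D: "affine_connection M D"
  shows "affine_connection M (semi_dual M g \<eta> D)"
proof -
  let ?S = "semi_dual M g \<eta> D"
  note S = semi_dual[OF M g \<eta> D]
  have tS: "?S X Z p \<in> tangent_space M p" if "X \<in> vector_fields M" "Z \<in> vector_fields M" "p \<in> topspace (mtop M)" for X Z p
    using vector_fieldsD(1)[OF S(1)[OF that(1,2)] that(3)] .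
  have 1: "?S (\<lambda>p f. X p f + Y p f) Z = (\<lambda>p f. ?S X Z p f + ?S Y Z p f)"
    "?S X (\<lambda>p f. Y p f + Z p f) = (\<lambda>p f. ?S X Y p f + ?S X Z p f)"
    if X: "X \<in> vector_fields M" and Y: "Y \<in> vector_fields M" and Z: "Z \<in> vector_fields M" for X Y Z
  proof -
    note XY = vector_fields_add[OF M X Y] and YZ = vector_fields_add[OF M Y Z]
    show "?S (\<lambda>p f. X p f + Y p f) Z = (\<lambda>p f. ?S X Z p f + ?S Y Z p f)"
    proof (rule vector_field_eqI[OF M g S(1)[OF XY Z] vector_fields_add[OF M S(1)[OF X Z] S(1)[OF Y Z]]])
      fix V p assume V: "V \<in> vector_fields M" and p: "p \<in> topspace (mtop M)"
      note t = vector_fieldsD(1)[OF _ p]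
      show "g p (V p) (?S (\<lambda>p f. X p f + Y p f) Z p) = g p (V p) (\<lambda>f. ?S X Z p f + ?S Y Z p f)"
        unfolding S(2)[OF XY Z V p] metric_right(1)[OF M g p tS[OF X Z p] t[OF V] tS[OF Y Z p]]
          S(2)[OF X Z V p] S(2)[OF Y Z V p] connectionD(2)[OF D X Y V]
          metric_left(1)[OF M g p t[OF connectionD(1)[OF D X V]] t[OF Z] t[OF connectionD(1)[OF D Y V]]]
          one_formD(1)[OF \<eta> p t[OF X] t[OF Y], of 1 1, simplified]
        by (simp add: algebra_simps)
    qed
    show "?S X (\<lambda>p f. Y p f + Z p f) = (\<lambda>p f. ?S X Y p f + ?S X Z p f)"
    proof (rule vector_field_eqI[OF M g S(1)[OF X YZ] vector_fields_add[OF M S(1)[OF X Y] S(1)[OF X Z]]])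
      fix V p assume V: "V \<in> vector_fields M" and p: "p \<in> topspace (mtop M)"
      note t = vector_fieldsD(1)[OF _ p]
      show "g p (V p) (?S X (\<lambda>p f. Y p f + Z p f) p) = g p (V p) (\<lambda>f. ?S X Y p f + ?S X Z p f)"
        unfolding S(2)[OF X YZ V p] metric_right(1)[OF M g p tS[OF X Y p] t[OF V] tS[OF X Z p]]
          S(2)[OF X Z V p] S(2)[OF X Y V p] derivative_of_metric_add(2)[OF M g p t[OF X] Y Z V]
          metric_right(1)[OF M g p t[OF Y] t[OF V] t[OF Z]]
          metric_right(1)[OF M g p t[OF Y] t[OF connectionD(1)[OF D X V]] t[OF Z]]
        by (simp add: algebra_simps)
    qed
  qed
  have 2: "?S (\<lambda>p f. h p * X p f) Y = (\<lambda>p f. h p * ?S X Y p f)"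
    "?S X (\<lambda>p f. h p * Y p f) = (\<lambda>p f. X p h * Y p f + h p * ?S X Y p f)"
    if h: "h \<in> smooth_functions M" and X: "X \<in> vector_fields M" and Y: "Y \<in> vector_fields M" for h X Y
  proof -
    note hX = vector_fields_scale[OF M h X] and hY = vector_fields_scale[OF M h Y]
    show "?S (\<lambda>p f. h p * X p f) Y = (\<lambda>p f. h p * ?S X Y p f)"
    proof (rule vector_field_eqI[OF M g S(1)[OF hX Y] vector_fields_scale[OF M h S(1)[OF X Y]]])
      fix V p assume V: "V \<in> vector_fields M" and p: "p \<in> topspace (mtop M)"
      note t = vector_fieldsD(1)[OF _ p]
      show "g p (V p) (?S (\<lambda>p f. h p * X p f) Y p) = g p (V p) (\<lambda>f. h p * ?S X Y p f)"
        unfolding S(2)[OF hX Y V p] metric_right(3)[OF M g p tS[OF X Y p] t[OF V]]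
          S(2)[OF X Y V p] connectionD(4)[OF D h X V]
          metric_left(3)[OF M g p t[OF connectionD(1)[OF D X V]] t[OF Y], of "h p"]
          one_formD(1)[OF \<eta> p t[OF X] t[OF X], of "h p" 0, simplified]
        by (simp add: algebra_simps)
    qed
    have f: "(\<lambda>p. X p h) \<in> smooth_functions M" using vector_fieldsD(3)[OF X h] .
    show "?S X (\<lambda>p f. h p * Y p f) = (\<lambda>p f. X p h * Y p f + h p * ?S X Y p f)"
    proof (rule vector_field_eqI[OF M g S(1)[OF X hY]
          vector_fields_add[OF M vector_fields_scale[OF M f Y] vector_fields_scale[OF M h S(1)[OF X Y]]]])
      fix V p assume V: "V \<in> vector_fields M" and p: "p \<in> topspace (mtop M)"
      note t = vector_fieldsD(1)[OF _ p]
      show "g p (V p) (?S X (\<lambda>p f. h p * Y p f) p) = g p (V p) (\<lambda>f. X p h * Y p f + h p * ?S X Y p f)"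
        unfolding S(2)[OF X hY V p]
          metricD(1)[OF g p t[OF V] tangent_combination[OF M p t[OF Y] tS[OF X Y p]]]
          metricD(2)[OF g p t[OF Y] tS[OF X Y p] t[OF V]]
          metricD(1)[OF g p tS[OF X Y p] t[OF V]] metricD(1)[OF g p t[OF Y] t[OF V]]
          S(2)[OF X Y V p] derivative_of_metric_scale(2)[OF M g p t[OF X] h Y V]
          metric_right(3)[OF M g p t[OF Y] t[OF V]]
          metric_right(3)[OF M g p t[OF Y] t[OF connectionD(1)[OF D X V]]]
        by (simp add: algebra_simps)
    qed
  qed
  show ?thesis
    unfolding affine_connection_def by (intro conjI ballI) (rule S(1) 1 2; assumption)+
qed

section \<open>Submanifolds\<close>

lemma submanifoldD:
  assumes "submanifold M' M"
  shows "smooth_manifold M'" "smooth_manifold M" "p \<in> topspace (mtop M') \<Longrightarrow> p \<in> topspace (mtop M)"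
    "smooth_map M' M (\<lambda>x. x)" "p \<in> topspace (mtop M') \<Longrightarrow> inj_on (incl_diff M) (tangent_space M' p)"
  using assms by (auto simp: submanifold_def)

lemma submanifold_smooth_functions:
  assumes "submanifold M' M" "f \<in> smooth_functions M"
  shows "f \<in> smooth_functions M'"
  using smooth_functions_compose[OF submanifoldD(1,2,4)[OF assms(1)] assms(2)] by simp

lemma submanifold_openin:
  assumes "submanifold M' M" "openin (mtop M) V"
  shows "openin (mtop M') (V \<inter> topspace (mtop M'))"
proof -
  have "continuous_map (mtop M') (mtop M) (\<lambda>x. x)"
    using submanifoldD(4)[OF assms(1)] by (simp add: smooth_map_def)
  then have "openin (mtop M') {x \<in> topspace (mtop M'). x \<in> V}"
    by (rule openin_continuous_map_preimage) (rule assms(2))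
  moreover have "{x \<in> topspace (mtop M'). x \<in> V} = V \<inter> topspace (mtop M')" by blast
  ultimately show ?thesis by simp
qed

lemma incl_diff_apply: "f \<in> smooth_functions M \<Longrightarrow> incl_diff M u f = u f"
  by (simp add: incl_diff_def)

lemma incl_diff_combination:
  "incl_diff M (\<lambda>f. a * u f + b * v f) = (\<lambda>f. a * incl_diff M u f + b * incl_diff M v f)"
  by (auto simp: incl_diff_def)

text \<open>A curve in \<open>M'\<close> with velocity \<open>u\<close> is, composed with the
  inclusion, a smooth curve in \<open>M\<close>.\<close>

lemma incl_diff_tangent:
  fixes M :: "('a, 'm::real_inner) manifold" and M' :: "('a, 'k::real_inner) manifold"
  assumes sub: "submanifold M' M" and u: "u \<in> tangent_space M' p"
  shows "incl_diff M u \<in> tangent_space M p"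
proof -
  obtain c e where c: "e > 0" "smooth_map (open_interval_manifold e) M' c" "c 0 = p"
    and u: "u = (\<lambda>f. if f \<in> smooth_functions M' then deriv (\<lambda>t. f (c t)) 0 else 0)"
    using u unfolding tangent_space_def by blast
  have "smooth_map (open_interval_manifold e) M ((\<lambda>x. x) \<circ> c)"
    by (rule smooth_map_compose[OF smooth_manifold_interval submanifoldD(1,2)[OF sub] c(2) submanifoldD(4)[OF sub]])
  then have "smooth_map (open_interval_manifold e) M c" by (simp add: o_def)
  moreover have "incl_diff M u = (\<lambda>f. if f \<in> smooth_functions M then deriv (\<lambda>t. f (c t)) 0 else 0)"
    using submanifold_smooth_functions[OF sub] by (auto simp: incl_diff_def u)
  ultimately show ?thesis using c(1,3) unfolding tangent_space_def by blast
qed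

text \<open>In charts the inclusion becomes a map \<open>\<iota>\<close> with injective derivative.
  Its local left inverse \<open>G\<close> pulls the coordinate expression of \<open>f\<close> back
  to an open set of the model space of \<open>M\<close>, and a bump function makes the result
  global.\<close>

lemma smooth_function_extension:
  fixes M :: "('a, 'm::real_inner) manifold" and M' :: "('a, 'k::real_inner) manifold"
  assumes sub: "submanifold M' M" and p: "p \<in> topspace (mtop M')" and f: "f \<in> smooth_functions M'"
  obtains F W where "F \<in> smooth_functions M" "openin (mtop M') W" "p \<in> W" "\<And>q. q \<in> W \<Longrightarrow> F q = f q"
proof -
  note M' = submanifoldD(1)[OF sub] and M = submanifoldD(2)[OF sub]
  obtain A :: "'k set" where A: "onb A" using smooth_manifold_onb[OF M'] by blast
  obtain B :: "'m set" where B: "onb B" using smooth_manifold_onb[OF M] by blast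
  obtain X \<psi> where X: "(X, \<psi>) \<in> charts M'" "p \<in> X" using chart_at[OF M' p] by metis
  obtain U \<phi> where U: "(U, \<phi>) \<in> charts M" "p \<in> U" using chart_at[OF M submanifoldD(3)[OF sub p]] by metis
  define S where "S = \<psi> ` (X \<inter> U)"
  define \<iota> where "\<iota> y = \<phi> (inv_into X \<psi> y)" for y
  have "openin (mtop M') (U \<inter> topspace (mtop M'))"
    by (rule submanifold_openin[OF sub chart_facts(1)[OF M U(1)]])
  moreover have "X \<inter> U = X \<inter> (U \<inter> topspace (mtop M'))" using chart_facts(3)[OF M' X(1)] by blast
  ultimately have "openin (mtop M') (X \<inter> U)" using chart_facts(1)[OF M' X(1)] by (metis openin_Int)
  then have S: "open S" "\<psi> p \<in> S"
    using chart_open_image[OF M' X(1)] X(2) U(2) by (auto simp: S_def)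
  have "smooth_on (\<psi> ` (X \<inter> (\<lambda>x. x) -` U)) (\<phi> \<circ> (\<lambda>x. x) \<circ> inv_into X \<psi>)"
    by (rule smooth_map_chart[OF submanifoldD(4)[OF sub] X(1) U(1)])
  then have \<iota>: "smooth_on S \<iota>" by (simp add: S_def \<iota>_def[abs_def] o_def vimage_def)
  have \<iota>p: "\<iota> (\<psi> p) = \<phi> p" using chart_inv[OF M' X] by (simp add: \<iota>_def)
  note d\<iota> = smooth_on_has_derivative[OF \<iota> S(2)]
  \<comment> \<open>The immersion hypothesis concerns functionals. If the derivative of
    \<open>\<iota>\<close> kills \<open>v\<close>, the tangent vector with coordinates
    \<open>v\<close> annihilates all smooth functions of \<open>M\<close>, so
    \<open>incl_diff\<close> sends it to 0.\<close>
  have "v = 0" if v: "frechet_derivative \<iota> (at (\<psi> p)) v = 0" for v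
  proof -
    let ?u = "coord_tangent M' X \<psi> p v"
    have tu: "?u \<in> tangent_space M' p" by (rule coord_tangent_in_tangent_space[OF M' X])
    have "?u h = 0" if h: "h \<in> smooth_functions M" for h
    proof -
      let ?H = "frechet_derivative (\<lambda>y. h (inv_into U \<phi> y)) (at (\<phi> p))"
      have H: "((\<lambda>y. h (inv_into U \<phi> y)) has_derivative ?H) (at (\<iota> (\<psi> p)))"
        using chart_has_derivative[OF M U h] \<iota>p by simp
      have "((\<lambda>y. h (inv_into U \<phi> (\<iota> y))) has_derivative (\<lambda>v. ?H (frechet_derivative \<iota> (at (\<psi> p)) v))) (at (\<psi> p))"
        by (rule has_derivative_compose[OF d\<iota> H])
      then have "((\<lambda>y. h (inv_into X \<psi> y)) has_derivative (\<lambda>v. ?H (frechet_derivative \<iota> (at (\<psi> p)) v))) (at (\<psi> p))"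
        by (rule has_derivative_transform_within_open[OF _ S])
          (auto simp: S_def \<iota>_def chart_inv[OF M' X(1)] chart_inv[OF M U(1)])
      from frechet_derivative_at[OF this, symmetric]
      show ?thesis using v linear_0[OF has_derivative_linear[OF H]] by (simp add: coord_tangent_def)
    qed
    then have "incl_diff M ?u = incl_diff M (\<lambda>f. 0)" by (auto simp: incl_diff_def)
    then have "?u = (\<lambda>f. 0)"
      using submanifoldD(5)[OF sub p] tu tangent_zero[OF M' p] by (meson inj_onD)
    then show ?thesis by (rule coord_tangent_eq_0[OF M' X])
  qed
  then have "inj (frechet_derivative \<iota> (at (\<psi> p)))"
    by (simp add: linear_injective_0[OF has_derivative_linear[OF d\<iota>]])
  then obtain O' W' G where O': "open O'" "\<psi> p \<in> O'" "O' \<subseteq> S" "open W'" "\<iota> ` O' \<subseteq> W'" "G ` W' \<subseteq> O'"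
    "\<And>x. x \<in> O' \<Longrightarrow> G (\<iota> x) = x" "smooth_on W' G"
    by (rule smooth_local_left_inverse[OF A B S \<iota>]) (rule that; assumption)
  have into: "G ` W' \<subseteq> \<psi> ` X" using O'(3,6) by (auto simp: S_def)
  have sm: "smooth_on W' (\<lambda>y. f (inv_into X \<psi> (G y)))"
    by (rule smooth_on_compose[OF A O'(4) chart_facts(2)[OF M' X(1)] into smooth_functions_chart[OF M' f X(1)] O'(8)])
  have "\<phi> p \<in> W'" using O'(2,5) \<iota>p by (metis image_subset_iff)
  from chart_extension[OF M U(1) U(2) U(2) chart_facts(1)[OF M U(1)] O'(4) this sm]
  obtain F V where F: "F \<in> smooth_functions M" "openin (mtop M) V" "p \<in> V"
    "\<And>q. q \<in> V \<Longrightarrow> F q = f (inv_into X \<psi> (G (\<phi> q)))" by blast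
  \<comment> \<open>Restricting \<open>V\<close> to \<open>M'\<close> would not be enough: other
    sheets of the immersed \<open>M'\<close> may pass through \<open>V\<close>, where
    \<open>F\<close> need not agree with \<open>f\<close>. The first factor selects the sheet on
    which \<open>G\<close> inverts \<open>\<iota>\<close>.\<close>
  define W where "W = {q \<in> X. \<psi> q \<in> O'} \<inter> (V \<inter> topspace (mtop M'))"
  show ?thesis
  proof (rule that[OF F(1)])
    show "openin (mtop M') W"
      unfolding W_def by (rule openin_Int[OF chart_open_preimage[OF M' X(1) O'(1)] submanifold_openin[OF sub F(2)]])
    show "p \<in> W" using X(2) O'(2) F(3) p by (simp add: W_def)
    show "F q = f q" if "q \<in> W" for q
    proof -
      have q: "q \<in> X" "\<psi> q \<in> O'" "q \<in> V" using that by (auto simp: W_def)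
      have "\<iota> (\<psi> q) = \<phi> q" using chart_inv[OF M' X(1) q(1)] by (simp add: \<iota>_def)
      then have "G (\<phi> q) = \<psi> q" using O'(7)[OF q(2)] by simp
      then show ?thesis using F(4)[OF q(3)] chart_inv[OF M' X(1) q(1)] by simp
    qed
  qed
qed

section \<open>Extensions of vector fields\<close>

lemma extends_nearD:
  assumes "extends_near M' M p X S"
  shows "S \<in> vector_fields M" "S p = incl_diff M (X p)" "p \<in> topspace (mtop M')"
  using assms openin_subset by (auto simp: extends_near_def)

lemma extends_near_nhd:
  assumes "extends_near M' M p X S"
  obtains W where "openin (mtop M') W" "p \<in> W" "\<And>q. q \<in> W \<Longrightarrow> extends_near M' M q X S"
  using assms unfolding extends_near_def by blast

text \<open>In a frame of \<open>M\<close>, the components of \<open>X\<close> are smooth functions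
  on \<open>M'\<close>; they are extended one by one.\<close>

lemma extends_near_exists:
  fixes M :: "('a, 'm::real_inner) manifold" and M' :: "('a, 'k::real_inner) manifold"
  assumes sub: "submanifold M' M" and p: "p \<in> topspace (mtop M')" and X: "X \<in> vector_fields M'"
  obtains S where "extends_near M' M p X S"
proof -
  note M' = submanifoldD(1)[OF sub] and M = submanifoldD(2)[OF sub]
  obtain V x E and B :: "'m set" where L: "local_frame M V B x E" "p \<in> V"
    using local_frame_at[OF M submanifoldD(3)[OF sub p]] .
  note D = local_frameD[OF L(1)]
  have "\<exists>F W. F \<in> smooth_functions M \<and> openin (mtop M') W \<and> p \<in> W \<and> (\<forall>q\<in>W. F q = X q (x b))" if b: "b \<in> B" for b
    using smooth_function_extension[OF sub p vector_fieldsD(3)[OF X submanifold_smooth_functions[OF sub D(3)[OF b]]]]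
    by metis
  then obtain F W where FW: "\<And>b. b \<in> B \<Longrightarrow> F b \<in> smooth_functions M \<and> openin (mtop M') (W b) \<and> p \<in> W b \<and>
      (\<forall>q\<in>W b. F b q = X q (x b))" by metis
  \<comment> \<open>The factor \<open>topspace (mtop M')\<close> matters if \<open>B\<close> is
    empty, that is, in dimension zero, where the indexed intersection is the whole type.\<close>
  define N where "N = ((\<Inter>b\<in>B. W b) \<inter> topspace (mtop M')) \<inter> (V \<inter> topspace (mtop M'))"
  have "openin (mtop M') N"
    unfolding N_def
    by (rule openin_Int[OF openin_INT[OF D(2)] submanifold_openin[OF sub D(1)]]) (use FW in blast)
  moreover have "p \<in> N" using FW L(2) p by (simp add: N_def)
  moreover have "(\<lambda>q f. \<Sum>b\<in>B. F b q * E b q f) \<in> vector_fields M"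
    by (rule vector_fields_sum[OF M _ D(4)]) (use FW in blast)
  moreover have "(\<lambda>f. \<Sum>b\<in>B. F b q * E b q f) = incl_diff M (X q)" if q: "q \<in> N" for q
  proof
    fix f
    have t: "incl_diff M (X q) \<in> tangent_space M q"
      by (rule incl_diff_tangent[OF sub vector_fieldsD(1)[OF X]]) (use q in \<open>simp add: N_def\<close>)
    have "incl_diff M (X q) f = (\<Sum>b\<in>B. incl_diff M (X q) (x b) * E b q f)"
      by (rule D(6)[OF _ t]) (use q in \<open>simp add: N_def\<close>)
    also have "\<dots> = (\<Sum>b\<in>B. F b q * E b q f)"
      using q FW by (intro sum.cong refl) (auto simp: incl_diff_apply D(3) N_def)
    finally show "(\<Sum>b\<in>B. F b q * E b q f) = incl_diff M (X q) f" by simp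
  qed
  ultimately have "extends_near M' M p X (\<lambda>q f. \<Sum>b\<in>B. F b q * E b q f)"
    unfolding extends_near_def by blast
  then show ?thesis by (rule that)
qed

lemma extends_near_add:
  assumes sub: "submanifold M' M" and X: "extends_near M' M p X S" and Y: "extends_near M' M p Y T"
  shows "extends_near M' M p (\<lambda>q f. X q f + Y q f) (\<lambda>q f. S q f + T q f)"
proof -
  obtain V W where VW: "openin (mtop M') V" "p \<in> V" "\<And>q. q \<in> V \<Longrightarrow> S q = incl_diff M (X q)"
    "openin (mtop M') W" "p \<in> W" "\<And>q. q \<in> W \<Longrightarrow> T q = incl_diff M (Y q)"
    using X Y unfolding extends_near_def by metis
  show ?thesis
    unfolding extends_near_def
  proof (intro conjI exI[of _ "V \<inter> W"] ballI)
    show "(\<lambda>q f. S q f + T q f) \<in> vector_fields M"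
      by (rule vector_fields_add[OF submanifoldD(2)[OF sub] extends_nearD(1)[OF X] extends_nearD(1)[OF Y]])
  qed (use VW in \<open>auto simp: incl_diff_def\<close>)
qed

lemma extends_near_scale:
  assumes sub: "submanifold M' M" and X: "extends_near M' M p X S" and H: "H \<in> smooth_functions M"
    and W: "openin (mtop M') W" "p \<in> W" "\<And>q. q \<in> W \<Longrightarrow> H q = h q"
  shows "extends_near M' M p (\<lambda>q f. h q * X q f) (\<lambda>q f. H q * S q f)"
proof -
  obtain V where V: "openin (mtop M') V" "p \<in> V" "\<And>q. q \<in> V \<Longrightarrow> S q = incl_diff M (X q)"
    using X unfolding extends_near_def by metis
  show ?thesis
    unfolding extends_near_def
  proof (intro conjI exI[of _ "V \<inter> W"] ballI)
    show "(\<lambda>q f. H q * S q f) \<in> vector_fields M"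
      by (rule vector_fields_scale[OF submanifoldD(2)[OF sub] H extends_nearD(1)[OF X]])
  qed (use V W in \<open>auto simp: incl_diff_def\<close>)
qed

text \<open>\<open>S p\<close> is the image of \<open>X p\<close>, so it differentiates
  \<open>F\<close> as \<open>X p\<close> does, and \<open>X p\<close> sees only the germ of
  \<open>F\<close> along \<open>M'\<close>. All derivative terms pass between \<open>M\<close> and
  \<open>M'\<close> by this lemma.\<close>

lemma extension_derivative:
  assumes sub: "submanifold M' M" and X: "X \<in> vector_fields M'" and S: "extends_near M' M p X S"
    and f: "f \<in> smooth_functions M'" and F: "F \<in> smooth_functions M"
    and W: "openin (mtop M') W" "p \<in> W" "\<And>q. q \<in> W \<Longrightarrow> F q = f q"
  shows "S p F = X p f"
proof -
  have "S p F = X p F" using extends_nearD(2)[OF S] F by (simp add: incl_diff_apply)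
  also have "\<dots> = X p f"
    by (rule tangent_local[OF submanifoldD(1)[OF sub] vector_fieldsD(1)[OF X extends_nearD(3)[OF S]]
          submanifold_smooth_functions[OF sub F] f W])
  finally show ?thesis .
qed

text \<open>Two extensions of \<open>Y\<close> differ by a field vanishing on \<open>M'\<close> near \<open>p\<close>; its components are
  annihilated by \<open>X p\<close>, which is tangent to \<open>M'\<close>.\<close>

lemma connection_along_eq:
  assumes sub: "submanifold M' M" and D: "affine_connection M D"
    and X: "X \<in> vector_fields M'" and S: "extends_near M' M p X S" and T: "extends_near M' M p Y T"
  shows "connection_along M' M D X Y p = D S T p"
  unfolding connection_along_def
proof (rule the_equality)
  note M' = submanifoldD(1)[OF sub] and M = submanifoldD(2)[OF sub]
  have p: "p \<in> topspace (mtop M)" using submanifoldD(3)[OF sub extends_nearD(3)[OF S]] .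
  fix w assume "\<exists>S T. extends_near M' M p X S \<and> extends_near M' M p Y T \<and> w = D S T p"
  then obtain S' T' where S': "extends_near M' M p X S'" and T': "extends_near M' M p Y T'" and w: "w = D S' T' p"
    by blast
  note vS = extends_nearD(1)[OF S] and vS' = extends_nearD(1)[OF S'] and vT = extends_nearD(1)[OF T]
    and vT' = extends_nearD(1)[OF T']
  define R where "R q f = T q f - T' q f" for q f
  have R: "R \<in> vector_fields M"
    using vector_fields_diff[OF M vT vT'] by (simp add: R_def[abs_def])
  have "D S R p = (\<lambda>f. 0)"
  proof (rule connection_right_zero[OF M D p vS R])
    show "R p = (\<lambda>f. 0)"
      using extends_nearD(2)[OF T] extends_nearD(2)[OF T'] by (auto simp: R_def)
    fix f assume f: "f \<in> smooth_functions M"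
    obtain V where V: "openin (mtop M') V" "p \<in> V" "\<And>q. q \<in> V \<Longrightarrow> extends_near M' M q Y T"
      by (rule extends_near_nhd[OF T]) (rule that; assumption)
    obtain V' where V': "openin (mtop M') V'" "p \<in> V'" "\<And>q. q \<in> V' \<Longrightarrow> extends_near M' M q Y T'"
      by (rule extends_near_nhd[OF T']) (rule that; assumption)
    have "S p (\<lambda>q. R q f) = X p (\<lambda>q. 0)"
    proof (rule extension_derivative[OF sub X S smooth_functions_const[OF M'] vector_fieldsD(3)[OF R f]])
      show "openin (mtop M') (V \<inter> V')" "p \<in> V \<inter> V'" using V V' by auto
      show "R q f = 0" if "q \<in> V \<inter> V'" for q
        using extends_nearD(2)[OF V(3)] extends_nearD(2)[OF V'(3)] that by (simp add: R_def)
    qed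
    then show "S p (\<lambda>q. R q f) = 0"
      using tangent_of_const[OF M' extends_nearD(3)[OF S] vector_fieldsD(1)[OF X extends_nearD(3)[OF S]]] by simp
  qed
  moreover have "D S T = (\<lambda>q f. D S T' q f + D S R q f)"
  proof -
    have "(\<lambda>q f. T' q f + R q f) = T" by (auto simp: R_def)
    then show ?thesis using connectionD(3)[OF D vS vT' R] by simp
  qed
  ultimately have "D S T p = D S T' p" by (auto dest: fun_cong)
  moreover have "D S' T' p = D S T' p"
    by (rule connection_left_pointwise[OF M D p vS' vS _ vT'])
      (simp add: extends_nearD(2)[OF S] extends_nearD(2)[OF S'])
  ultimately show "w = D S T p" using w by simp
qed (use S T in blast)

subsection \<open>The induced structure\<close>

lemma induced_form_one_form:
  assumes sub: "submanifold M' M" and \<eta>: "one_form M \<eta>"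
  shows "one_form M' (induced_form M \<eta>)"
proof -
  note M' = submanifoldD(1)[OF sub]
  have "(\<lambda>p. induced_form M \<eta> p (X p)) \<in> smooth_functions M'" if X: "X \<in> vector_fields M'" for X
  proof (rule smooth_functions_locally[OF M'])
    fix p assume p: "p \<in> topspace (mtop M')"
    obtain S where S: "extends_near M' M p X S" using extends_near_exists[OF sub p X] .
    obtain W where W: "openin (mtop M') W" "p \<in> W" "\<And>q. q \<in> W \<Longrightarrow> extends_near M' M q X S"
      by (rule extends_near_nhd[OF S]) (rule that; assumption)
    have "(\<lambda>q. \<eta> q (S q)) \<in> smooth_functions M'"
      by (rule submanifold_smooth_functions[OF sub one_formD(2)[OF \<eta> extends_nearD(1)[OF S]]])
    moreover have "induced_form M \<eta> q (X q) = \<eta> q (S q)" if "q \<in> W" for q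
      using extends_nearD(2)[OF W(3)[OF that]] by (simp add: induced_form_def)
    ultimately show "\<exists>W F. openin (mtop M') W \<and> p \<in> W \<and> F \<in> smooth_functions M' \<and>
        (\<forall>q\<in>W. induced_form M \<eta> q (X q) = F q)"
      using W by blast
  qed
  then show ?thesis
    using one_formD(1)[OF \<eta> submanifoldD(3)[OF sub] incl_diff_tangent[OF sub] incl_diff_tangent[OF sub]]
    by (simp add: one_form_def induced_form_def incl_diff_combination)
qed

section \<open>Tangential components and the induced connection\<close>

locale pseudo_riemannian_pair =
  fixes M :: "('a, 'm::real_inner) manifold"
    and M' :: "('a, 'k::real_inner) manifold"
    and g :: "'a \<Rightarrow> 'a tangent \<Rightarrow> 'a tangent \<Rightarrow> real"
  assumes prs: "pseudo_riemannian_submanifold M' M g" and g: "pseudo_riemannian_metric M g"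
begin

lemma sub: "submanifold M' M" and g': "pseudo_riemannian_metric M' (induced_metric M g)"
  using prs by (auto simp: pseudo_riemannian_submanifold_def)

lemmas M' = submanifoldD(1)[OF sub]
lemmas M = submanifoldD(2)[OF sub]
lemmas top = submanifoldD(3)[OF sub]
lemmas incl = incl_diff_tangent[OF sub]

text \<open>The orthogonal decomposition comes from the Riesz representation for the induced metric:
  the representative of \<open>v \<mapsto> g p (incl_diff M v) w\<close> is the tangential part of
  \<open>w\<close>, and what remains is normal by construction. Uniqueness is non-degeneracy of the
  induced metric.\<close>

lemma tangent_component:
  assumes p: "p \<in> topspace (mtop M')" and w: "w \<in> tangent_space M p"
  shows "tangent_component M' M g p w \<in> tangent_space M' p"
    "v \<in> tangent_space M' p \<Longrightarrow> induced_metric M g p v (tangent_component M' M g p w) = g p (incl_diff M v) w"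
proof -
  have "g p (incl_diff M (\<lambda>f. a * u f + b * v f)) w = a * g p (incl_diff M u) w + b * g p (incl_diff M v) w"
    if "u \<in> tangent_space M' p" "v \<in> tangent_space M' p" for u v a b
    unfolding incl_diff_combination by (rule metricD(2)[OF g top[OF p] incl[OF that(1)] incl[OF that(2)] w])
  then obtain u where u: "u \<in> tangent_space M' p"
    "\<And>v. v \<in> tangent_space M' p \<Longrightarrow> induced_metric M g p u v = g p (incl_diff M v) w"
    by (rule metric_riesz[OF M' g' p, where l = "\<lambda>v. g p (incl_diff M v) w"]) (assumption | rule that)+
  have sym: "induced_metric M g p v u = g p (incl_diff M v) w" if "v \<in> tangent_space M' p" for v
    using u(2)[OF that] metricD(1)[OF g' p u(1) that] by simp
  have "tangent_component M' M g p w = u"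
    unfolding tangent_component_def
  proof (rule the_equality)
    let ?n = "\<lambda>f. w f - incl_diff M u f"
    have tn: "?n \<in> tangent_space M p" by (rule tangent_diff[OF M top[OF p] w incl[OF u(1)]])
    have "g p ?n (incl_diff M v) = 0" if v: "v \<in> tangent_space M' p" for v
      using metric_left(2)[OF M g top[OF p] w incl[OF v] incl[OF u(1)]] u(2)[OF v]
        metricD(1)[OF g top[OF p] w incl[OF v]] by (simp add: induced_metric_def)
    then have "?n \<in> normal_space M' M g p" using tn by (simp add: normal_space_def)
    then show "u \<in> tangent_space M' p \<and> (\<exists>n\<in>normal_space M' M g p. w = (\<lambda>f. incl_diff M u f + n f))"
      using u(1) by (intro conjI bexI[of _ ?n]) auto
  next
    fix u' assume "u' \<in> tangent_space M' p \<and> (\<exists>n\<in>normal_space M' M g p. w = (\<lambda>f. incl_diff M u' f + n f))"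
    then obtain n where u': "u' \<in> tangent_space M' p" and n: "n \<in> tangent_space M p"
      "\<And>v. v \<in> tangent_space M' p \<Longrightarrow> g p n (incl_diff M v) = 0" and w': "w = (\<lambda>f. incl_diff M u' f + n f)"
      by (auto simp: normal_space_def)
    show "u' = u"
    proof (rule metric_eqI[OF M' g' p u' u(1)])
      fix v assume v: "v \<in> tangent_space M' p"
      have "g p w (incl_diff M v) = g p (incl_diff M u') (incl_diff M v)"
        using metric_left(1)[OF M g top[OF p] incl[OF u'] incl[OF v] n(1)] n(2)[OF v] w' by simp
      then show "induced_metric M g p u' v = induced_metric M g p u v"
        using u(2)[OF v] metricD(1)[OF g top[OF p] w incl[OF v]] by (simp add: induced_metric_def)
    qed
  qed
  then show "tangent_component M' M g p w \<in> tangent_space M' p"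
    "v \<in> tangent_space M' p \<Longrightarrow> induced_metric M g p v (tangent_component M' M g p w) = g p (incl_diff M v) w"
    using u(1) sym by simp_all
qed

lemma induced_connection:
  assumes D: "affine_connection M D" and X: "X \<in> vector_fields M'"
    and S: "extends_near M' M p X S" and T: "extends_near M' M p Y T"
  shows "induced_connection M' M g D X Y p \<in> tangent_space M' p"
    "v \<in> tangent_space M' p \<Longrightarrow>
      induced_metric M g p v (induced_connection M' M g D X Y p) = g p (incl_diff M v) (D S T p)"
proof -
  note p = extends_nearD(3)[OF S]
  have t: "D S T p \<in> tangent_space M p"
    using vector_fieldsD(1)[OF connectionD(1)[OF D extends_nearD(1)[OF S] extends_nearD(1)[OF T]] top[OF p]] .
  have e: "induced_connection M' M g D X Y p = tangent_component M' M g p (D S T p)"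
    using p by (simp add: induced_connection_def connection_along_eq[OF sub D X S T])
  show "induced_connection M' M g D X Y p \<in> tangent_space M' p"
    "v \<in> tangent_space M' p \<Longrightarrow>
      induced_metric M g p v (induced_connection M' M g D X Y p) = g p (incl_diff M v) (D S T p)"
    unfolding e by (rule tangent_component[OF p t])+
qed

lemma induced_connection_metric:
  assumes D: "affine_connection M D" and X: "X \<in> vector_fields M'" and Z: "Z \<in> vector_fields M'"
    and S: "extends_near M' M p X S" and T: "extends_near M' M p Y T" and R: "extends_near M' M p Z R"
  shows "induced_metric M g p (induced_connection M' M g D X Y p) (Z p) = g p (D S T p) (R p)"
    "induced_metric M g p (Z p) (induced_connection M' M g D X Y p) = g p (R p) (D S T p)"
proof -
  note p = extends_nearD(3)[OF S]
  note I = induced_connection[OF D X S T]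
  have Z: "Z p \<in> tangent_space M' p" using vector_fieldsD(1)[OF Z p] .
  show 1: "induced_metric M g p (Z p) (induced_connection M' M g D X Y p) = g p (R p) (D S T p)"
    using I(2)[OF Z] extends_nearD(2)[OF R] by simp
  have "g p (D S T p) (R p) = g p (R p) (D S T p)"
    by (rule metricD(1)[OF g top[OF p]])
      (intro vector_fieldsD(1)[OF _ top[OF p]] connectionD(1)[OF D] extends_nearD(1)[OF S] extends_nearD(1)[OF T]
        extends_nearD(1)[OF R])+
  then show "induced_metric M g p (induced_connection M' M g D X Y p) (Z p) = g p (D S T p) (R p)"
    using 1 metricD(1)[OF g' p Z I(1)] by simp
qed

lemma induced_metric_extension:
  assumes "extends_near M' M p Y T" "extends_near M' M p Z R"
  shows "induced_metric M g p (Y p) (Z p) = g p (T p) (R p)"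
  using extends_nearD(2)[OF assms(1)] extends_nearD(2)[OF assms(2)] by (simp add: induced_metric_def)

lemma derivative_of_induced_metric:
  assumes X: "X \<in> vector_fields M'" and Y: "Y \<in> vector_fields M'" and Z: "Z \<in> vector_fields M'"
    and S: "extends_near M' M p X S" and T: "extends_near M' M p Y T" and R: "extends_near M' M p Z R"
  shows "X p (\<lambda>q. induced_metric M g q (Y q) (Z q)) = S p (\<lambda>q. g q (T q) (R q))"
proof -
  obtain V where V: "openin (mtop M') V" "p \<in> V" "\<And>q. q \<in> V \<Longrightarrow> extends_near M' M q Y T"
    by (rule extends_near_nhd[OF T]) (rule that; assumption)
  obtain W where W: "openin (mtop M') W" "p \<in> W" "\<And>q. q \<in> W \<Longrightarrow> extends_near M' M q Z R"
    by (rule extends_near_nhd[OF R]) (rule that; assumption)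
  have "S p (\<lambda>q. g q (T q) (R q)) = X p (\<lambda>q. induced_metric M g q (Y q) (Z q))"
  proof (rule extension_derivative[OF sub X S metricD(4)[OF g' Y Z] metricD(4)[OF g extends_nearD(1)[OF T] extends_nearD(1)[OF R]]])
    show "openin (mtop M') (V \<inter> W)" "p \<in> V \<inter> W" using V W by auto
    show "g q (T q) (R q) = induced_metric M g q (Y q) (Z q)" if "q \<in> V \<inter> W" for q
      using induced_metric_extension[OF V(3) W(3)] that by simp
  qed
  then show ?thesis by simp
qed

text \<open>Extensions chosen at \<open>p\<close> serve at all nearby points of \<open>M'\<close>,
  so near \<open>p\<close> the product with \<open>Z\<close> is the restriction of one smooth
  function on \<open>M\<close>.\<close>

lemma induced_connection_field:
  assumes D: "affine_connection M D" and X: "X \<in> vector_fields M'" and Y: "Y \<in> vector_fields M'"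
  shows "induced_connection M' M g D X Y \<in> vector_fields M'"
proof (rule vector_field_of_metric[OF M' g'])
  fix p
  show "induced_connection M' M g D X Y p \<in> tangent_space M' p" if p: "p \<in> topspace (mtop M')"
    using extends_near_exists[OF sub p X] extends_near_exists[OF sub p Y] induced_connection(1)[OF D X] by metis
  show "induced_connection M' M g D X Y p = (\<lambda>f. 0)" if "p \<notin> topspace (mtop M')"
    using that by (simp add: induced_connection_def)
next
  fix Z assume Z: "Z \<in> vector_fields M'"
  show "(\<lambda>p. induced_metric M g p (induced_connection M' M g D X Y p) (Z p)) \<in> smooth_functions M'"
  proof (rule smooth_functions_locally[OF M'])
    fix p assume p: "p \<in> topspace (mtop M')"
    obtain S where S: "extends_near M' M p X S" using extends_near_exists[OF sub p X] .
    obtain T where T: "extends_near M' M p Y T" using extends_near_exists[OF sub p Y] .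
    obtain R where R: "extends_near M' M p Z R" using extends_near_exists[OF sub p Z] .
    obtain U where U: "openin (mtop M') U" "p \<in> U" "\<And>q. q \<in> U \<Longrightarrow> extends_near M' M q X S"
      by (rule extends_near_nhd[OF S]) (rule that; assumption)
    obtain V where V: "openin (mtop M') V" "p \<in> V" "\<And>q. q \<in> V \<Longrightarrow> extends_near M' M q Y T"
      by (rule extends_near_nhd[OF T]) (rule that; assumption)
    obtain W where W: "openin (mtop M') W" "p \<in> W" "\<And>q. q \<in> W \<Longrightarrow> extends_near M' M q Z R"
      by (rule extends_near_nhd[OF R]) (rule that; assumption)
    show "\<exists>W F. openin (mtop M') W \<and> p \<in> W \<and> F \<in> smooth_functions M' \<and>
        (\<forall>q\<in>W. induced_metric M g q (induced_connection M' M g D X Y q) (Z q) = F q)"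
    proof (intro exI conjI ballI)
      show "openin (mtop M') (U \<inter> (V \<inter> W))" "p \<in> U \<inter> (V \<inter> W)" using U V W by auto
      show "(\<lambda>q. g q (D S T q) (R q)) \<in> smooth_functions M'"
        by (rule submanifold_smooth_functions[OF sub metricD(4)[OF g connectionD(1)[OF D extends_nearD(1)[OF S] extends_nearD(1)[OF T]]
                extends_nearD(1)[OF R]]])
      show "induced_metric M g q (induced_connection M' M g D X Y q) (Z q) = g q (D S T q) (R q)"
        if "q \<in> U \<inter> (V \<inter> W)" for q
        using induced_connection_metric(1)[OF D X Z U(3) V(3) W(3)] that by blast
    qed
  qed
qed

text \<open>Each law is tested against a field \<open>V\<close> and then read on \<open>M\<close>
  for extensions. In the laws with a function \<open>h\<close>, also \<open>h\<close> is extended to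
  some \<open>H\<close>; in the Leibniz rule its derivative is unchanged, as
  \<open>A p H = X p h\<close>.\<close>

lemma induced_connection_affine:
  assumes D: "affine_connection M D"
  shows "affine_connection M' (induced_connection M' M g D)"
proof -
  let ?D = "induced_connection M' M g D"
  note I = induced_connection_metric(2)[OF D]
  note F = induced_connection_field[OF D]
  have 1: "?D (\<lambda>p f. X p f + Y p f) Z = (\<lambda>p f. ?D X Z p f + ?D Y Z p f)"
    "?D X (\<lambda>p f. Y p f + Z p f) = (\<lambda>p f. ?D X Y p f + ?D X Z p f)"
    if X: "X \<in> vector_fields M'" and Y: "Y \<in> vector_fields M'" and Z: "Z \<in> vector_fields M'" for X Y Z
  proof -
    note XY = vector_fields_add[OF M' X Y] and YZ = vector_fields_add[OF M' Y Z]
    show "?D (\<lambda>p f. X p f + Y p f) Z = (\<lambda>p f. ?D X Z p f + ?D Y Z p f)"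
    proof (rule vector_field_eqI[OF M' g' F[OF XY Z] vector_fields_add[OF M' F[OF X Z] F[OF Y Z]]])
      fix V p assume V: "V \<in> vector_fields M'" and p: "p \<in> topspace (mtop M')"
      note t = vector_fieldsD(1)[OF _ p] and s = vector_fieldsD(1)[OF _ top[OF p]]
      obtain A where A: "extends_near M' M p X A" using extends_near_exists[OF sub p X] .
      obtain B where B: "extends_near M' M p Y B" using extends_near_exists[OF sub p Y] .
      obtain C where C: "extends_near M' M p Z C" using extends_near_exists[OF sub p Z] .
      obtain E where E: "extends_near M' M p V E" using extends_near_exists[OF sub p V] .
      note v = extends_nearD(1)[OF A] extends_nearD(1)[OF B] extends_nearD(1)[OF C] extends_nearD(1)[OF E]
      show "induced_metric M g p (V p) (?D (\<lambda>p f. X p f + Y p f) Z p) =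
          induced_metric M g p (V p) (\<lambda>f. ?D X Z p f + ?D Y Z p f)"
        unfolding I[OF XY V extends_near_add[OF sub A B] C E]
          metric_right(1)[OF M' g' p t[OF F[OF X Z]] t[OF V] t[OF F[OF Y Z]]]
          I[OF X V A C E] I[OF Y V B C E] connectionD(2)[OF D v(1,2,3)]
        by (rule metric_right(1)[OF M g top[OF p] s[OF connectionD(1)[OF D v(1,3)]] s[OF v(4)] s[OF connectionD(1)[OF D v(2,3)]]])
    qed
    show "?D X (\<lambda>p f. Y p f + Z p f) = (\<lambda>p f. ?D X Y p f + ?D X Z p f)"
    proof (rule vector_field_eqI[OF M' g' F[OF X YZ] vector_fields_add[OF M' F[OF X Y] F[OF X Z]]])
      fix V p assume V: "V \<in> vector_fields M'" and p: "p \<in> topspace (mtop M')"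
      note t = vector_fieldsD(1)[OF _ p] and s = vector_fieldsD(1)[OF _ top[OF p]]
      obtain A where A: "extends_near M' M p X A" using extends_near_exists[OF sub p X] .
      obtain B where B: "extends_near M' M p Y B" using extends_near_exists[OF sub p Y] .
      obtain C where C: "extends_near M' M p Z C" using extends_near_exists[OF sub p Z] .
      obtain E where E: "extends_near M' M p V E" using extends_near_exists[OF sub p V] .
      note v = extends_nearD(1)[OF A] extends_nearD(1)[OF B] extends_nearD(1)[OF C] extends_nearD(1)[OF E]
      show "induced_metric M g p (V p) (?D X (\<lambda>p f. Y p f + Z p f) p) =
          induced_metric M g p (V p) (\<lambda>f. ?D X Y p f + ?D X Z p f)"
        unfolding I[OF X V A extends_near_add[OF sub B C] E]
          metric_right(1)[OF M' g' p t[OF F[OF X Y]] t[OF V] t[OF F[OF X Z]]]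
          I[OF X V A B E] I[OF X V A C E] connectionD(3)[OF D v(1,2,3)]
        by (rule metric_right(1)[OF M g top[OF p] s[OF connectionD(1)[OF D v(1,2)]] s[OF v(4)] s[OF connectionD(1)[OF D v(1,3)]]])
    qed
  qed
  have 2: "?D (\<lambda>p f. h p * X p f) Y = (\<lambda>p f. h p * ?D X Y p f)"
    "?D X (\<lambda>p f. h p * Y p f) = (\<lambda>p f. X p h * Y p f + h p * ?D X Y p f)"
    if h: "h \<in> smooth_functions M'" and X: "X \<in> vector_fields M'" and Y: "Y \<in> vector_fields M'" for h X Y
  proof -
    note hX = vector_fields_scale[OF M' h X] and hY = vector_fields_scale[OF M' h Y]
    show "?D (\<lambda>p f. h p * X p f) Y = (\<lambda>p f. h p * ?D X Y p f)"
    proof (rule vector_field_eqI[OF M' g' F[OF hX Y] vector_fields_scale[OF M' h F[OF X Y]]])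
      fix V p assume V: "V \<in> vector_fields M'" and p: "p \<in> topspace (mtop M')"
      note t = vector_fieldsD(1)[OF _ p] and s = vector_fieldsD(1)[OF _ top[OF p]]
      obtain A where A: "extends_near M' M p X A" using extends_near_exists[OF sub p X] .
      obtain B where B: "extends_near M' M p Y B" using extends_near_exists[OF sub p Y] .
      obtain E where E: "extends_near M' M p V E" using extends_near_exists[OF sub p V] .
      obtain H W where H: "H \<in> smooth_functions M" and W: "openin (mtop M') W" "p \<in> W" "\<And>q. q \<in> W \<Longrightarrow> H q = h q"
        by (rule smooth_function_extension[OF sub p h]) (rule that; assumption)
      note v = extends_nearD(1)[OF A] extends_nearD(1)[OF B] extends_nearD(1)[OF E]
      have e: "extends_near M' M p (\<lambda>q f. h q * X q f) (\<lambda>q f. H q * A q f)"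
        by (rule extends_near_scale[OF sub A H W])
      show "induced_metric M g p (V p) (?D (\<lambda>p f. h p * X p f) Y p) =
          induced_metric M g p (V p) (\<lambda>f. h p * ?D X Y p f)"
        unfolding I[OF hX V e B E]
          metric_right(3)[OF M' g' p t[OF F[OF X Y]] t[OF V]]
          I[OF X V A B E] connectionD(4)[OF D H v(1,2)] W(3)[OF W(2)]
        by (rule metric_right(3)[OF M g top[OF p] s[OF connectionD(1)[OF D v(1,2)]] s[OF v(3)]])
    qed
    have f: "(\<lambda>p. X p h) \<in> smooth_functions M'" using vector_fieldsD(3)[OF X h] .
    show "?D X (\<lambda>p f. h p * Y p f) = (\<lambda>p f. X p h * Y p f + h p * ?D X Y p f)"
    proof (rule vector_field_eqI[OF M' g' F[OF X hY]
          vector_fields_add[OF M' vector_fields_scale[OF M' f Y] vector_fields_scale[OF M' h F[OF X Y]]]])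
      fix V p assume V: "V \<in> vector_fields M'" and p: "p \<in> topspace (mtop M')"
      note t = vector_fieldsD(1)[OF _ p] and s = vector_fieldsD(1)[OF _ top[OF p]]
      obtain A where A: "extends_near M' M p X A" using extends_near_exists[OF sub p X] .
      obtain B where B: "extends_near M' M p Y B" using extends_near_exists[OF sub p Y] .
      obtain E where E: "extends_near M' M p V E" using extends_near_exists[OF sub p V] .
      obtain H W where H: "H \<in> smooth_functions M" and W: "openin (mtop M') W" "p \<in> W" "\<And>q. q \<in> W \<Longrightarrow> H q = h q"
        by (rule smooth_function_extension[OF sub p h]) (rule that; assumption)
      note v = extends_nearD(1)[OF A] extends_nearD(1)[OF B] extends_nearD(1)[OF E]
      have XH: "A p H = X p h" by (rule extension_derivative[OF sub X A h H W])
      have e: "extends_near M' M p (\<lambda>q f. h q * Y q f) (\<lambda>q f. H q * B q f)"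
        by (rule extends_near_scale[OF sub B H W])
      show "induced_metric M g p (V p) (?D X (\<lambda>p f. h p * Y p f) p) =
          induced_metric M g p (V p) (\<lambda>f. X p h * Y p f + h p * ?D X Y p f)"
        unfolding I[OF X V A e E]
          metricD(1)[OF g' p t[OF V] tangent_combination[OF M' p t[OF Y] t[OF F[OF X Y]]]]
          metricD(2)[OF g' p t[OF Y] t[OF F[OF X Y]] t[OF V]]
          connectionD(5)[OF D H v(1,2)] XH W(3)[OF W(2)]
          metricD(1)[OF g top[OF p] s[OF v(3)] tangent_combination[OF M top[OF p] s[OF v(2)] s[OF connectionD(1)[OF D v(1,2)]]]]
          metricD(2)[OF g top[OF p] s[OF v(2)] s[OF connectionD(1)[OF D v(1,2)]] s[OF v(3)]]
          induced_metric_extension[OF B E] induced_connection_metric(1)[OF D X V A B E] ..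
    qed
  qed
  show ?thesis
    unfolding affine_connection_def by (intro conjI ballI) (rule F 1 2; assumption)+
qed

text \<open>For smooth \<open>f\<close> on \<open>M\<close>, the function \<open>T q f\<close>
  restricts to \<open>Y q f\<close> near \<open>p\<close> in \<open>M'\<close>, and
  \<open>S p\<close> differentiates it as \<open>X p\<close> does.\<close>

lemma induced_lie_bracket:
  assumes X: "X \<in> vector_fields M'" and Y: "Y \<in> vector_fields M'"
    and S: "extends_near M' M p X S" and T: "extends_near M' M p Y T"
  shows "incl_diff M (lie_bracket M' X Y p) = lie_bracket M S T p"
proof
  fix f
  have *: "S p (\<lambda>q. T q f) = X p (\<lambda>q. Y q f)"
    if f: "f \<in> smooth_functions M" and X: "X \<in> vector_fields M'" and Y: "Y \<in> vector_fields M'"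
      and S: "extends_near M' M p X S" and T: "extends_near M' M p Y T" for X Y S T
  proof -
    obtain V where V: "openin (mtop M') V" "p \<in> V" "\<And>q. q \<in> V \<Longrightarrow> extends_near M' M q Y T"
      by (rule extends_near_nhd[OF T]) (rule that; assumption)
    show ?thesis
      by (rule extension_derivative[OF sub X S vector_fieldsD(3)[OF Y submanifold_smooth_functions[OF sub f]]
            vector_fieldsD(3)[OF extends_nearD(1)[OF T] f] V(1,2)])
        (simp add: extends_nearD(2)[OF V(3)] incl_diff_apply[OF f])
  qed
  show "incl_diff M (lie_bracket M' X Y p) f = lie_bracket M S T p f"
    using *[OF _ X Y S T] *[OF _ Y X T S] submanifold_smooth_functions[OF sub]
    by (simp add: incl_diff_def lie_bracket_def)
qed

text \<open>Metrics are linear on tangent vectors only, so splitting off the bracket term relies on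
  \<open>lie_bracket_tangent\<close>, on \<open>M'\<close> as well as on \<open>M\<close>.\<close>

lemma induced_torsion:
  assumes D: "affine_connection M D" and X: "X \<in> vector_fields M'" and Y: "Y \<in> vector_fields M'" and Z: "Z \<in> vector_fields M'"
    and S: "extends_near M' M p X S" and T: "extends_near M' M p Y T" and R: "extends_near M' M p Z R"
  shows "induced_metric M g p (torsion M' (induced_connection M' M g D) X Y p) (Z p) = g p (torsion M D S T p) (R p)"
proof -
  let ?D = "induced_connection M' M g D"
  note p = extends_nearD(3)[OF S]
  note t = vector_fieldsD(1)[OF _ p] and s = vector_fieldsD(1)[OF _ top[OF p]]
  note F = induced_connection_field[OF D]
  note v = extends_nearD(1)[OF S] extends_nearD(1)[OF T] extends_nearD(1)[OF R]
  note a = t[OF F[OF X Y]] t[OF F[OF Y X]] and b = s[OF connectionD(1)[OF D v(1,2)]] s[OF connectionD(1)[OF D v(2,1)]]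
  have "induced_metric M g p (lie_bracket M' X Y p) (Z p) = g p (lie_bracket M S T p) (R p)"
    using induced_lie_bracket[OF X Y S T] extends_nearD(2)[OF R] by (simp add: induced_metric_def)
  then show ?thesis
    unfolding torsion_def
      metric_left(2)[OF M' g' p tangent_diff[OF M' p a] t[OF Z] lie_bracket_tangent[OF M' p X Y]]
      metric_left(2)[OF M' g' p a(1) t[OF Z] a(2)]
      metric_left(2)[OF M g top[OF p] tangent_diff[OF M top[OF p] b] s[OF v(3)] lie_bracket_tangent[OF M top[OF p] v(1,2)]]
      metric_left(2)[OF M g top[OF p] b(1) s[OF v(3)] b(2)]
      induced_connection_metric(1)[OF D X Z S T R] induced_connection_metric(1)[OF D Y Z T S R]
    by simp
qed

end

theorem proposition4p2:
  fixes M :: "('a, 'm::real_inner) manifold"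
    and M' :: "('a, 'k::real_inner) manifold"
    and g :: "'a \<Rightarrow> 'a tangent \<Rightarrow> 'a tangent \<Rightarrow> real"
    and \<eta> :: "'a \<Rightarrow> 'a tangent \<Rightarrow> real"
    and D :: "'a vfield \<Rightarrow> 'a vfield \<Rightarrow> 'a vfield"
  assumes "semi_weyl_manifold_with_torsion M g \<eta> D"
    and "pseudo_riemannian_submanifold M' M g"
  shows "semi_weyl_manifold_with_torsion M' (induced_metric M g) (induced_form M \<eta>) (induced_connection M' M g D) \<and>
         (\<forall>X\<in>vector_fields M'. \<forall>Y\<in>vector_fields M'.
           semi_dual M' (induced_metric M g) (induced_form M \<eta>) (induced_connection M' M g D) X Y =
           induced_connection M' M g (semi_dual M g \<eta> D) X Y)"
proof (intro conjI ballI)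
  let ?g = "induced_metric M g" and ?\<eta> = "induced_form M \<eta>" and ?D = "induced_connection M' M g D"
  note swm = assms(1)[unfolded semi_weyl_manifold_with_torsion_def]
  have M: "smooth_manifold M" using swm by (rule conjunct1)
  have g: "pseudo_riemannian_metric M g" using swm[THEN conjunct2] by (rule conjunct1)
  have \<eta>: "one_form M \<eta>" using swm[THEN conjunct2, THEN conjunct2] by (rule conjunct1)
  have D: "affine_connection M D" using swm[THEN conjunct2, THEN conjunct2, THEN conjunct2] by (rule conjunct1)
  note swmt = swm[THEN conjunct2, THEN conjunct2, THEN conjunct2, THEN conjunct2, rule_format]
  interpret pseudo_riemannian_pair M M' g by unfold_locales (rule assms(2), rule g)
  have \<eta>': "?\<eta> p (X p) = \<eta> p (S p)" if "extends_near M' M p X S" for p X S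
    using extends_nearD(2)[OF that] by (simp add: induced_form_def)
  \<comment> \<open>In the term with \<open>D X Z\<close> the fields \<open>Y\<close> and
    \<open>Z\<close> exchange their roles, hence the second instance with permuted
    arguments.\<close>
  have nabla: "nabla_metric ?g ?D X Y Z p = nabla_metric g D S T R p"
    if "X \<in> vector_fields M'" "Y \<in> vector_fields M'" "Z \<in> vector_fields M'"
      "extends_near M' M p X S" "extends_near M' M p Y T" "extends_near M' M p Z R" for X Y Z S T R p
    unfolding nabla_metric_def derivative_of_induced_metric[OF that]
      induced_connection_metric(1)[OF D that(1,3,4,5,6)]
      induced_connection_metric(2)[OF D that(1,2,4,6,5)] ..
  show "semi_weyl_manifold_with_torsion M' ?g ?\<eta> ?D"
    unfolding semi_weyl_manifold_with_torsion_def
  proof (intro conjI ballI)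
    fix X Y Z p
    assume X: "X \<in> vector_fields M'" and Y: "Y \<in> vector_fields M'" and Z: "Z \<in> vector_fields M'"
      and p: "p \<in> topspace (mtop M')"
    obtain S where S: "extends_near M' M p X S" using extends_near_exists[OF sub p X] .
    obtain T where T: "extends_near M' M p Y T" using extends_near_exists[OF sub p Y] .
    obtain R where R: "extends_near M' M p Z R" using extends_near_exists[OF sub p Z] .
    show "nabla_metric ?g ?D X Y Z p + ?\<eta> p (X p) * ?g p (Y p) (Z p) =
        nabla_metric ?g ?D Y X Z p + ?\<eta> p (Y p) * ?g p (X p) (Z p) - ?g p (torsion M' ?D X Y p) (Z p)"
      unfolding nabla[OF X Y Z S T R] nabla[OF Y X Z T S R] \<eta>'[OF S] \<eta>'[OF T]
        induced_metric_extension[OF T R] induced_metric_extension[OF S R]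
        induced_torsion[OF D X Y Z S T R]
      by (rule swmt[OF extends_nearD(1)[OF S] extends_nearD(1)[OF T] extends_nearD(1)[OF R] submanifoldD(3)[OF sub p]])
  qed (rule M' g' induced_form_one_form[OF sub \<eta>] induced_connection_affine[OF D])+
  fix X Z assume X: "X \<in> vector_fields M'" and Z: "Z \<in> vector_fields M'"
  let ?S = "semi_dual M g \<eta> D"
  note S = semi_dual_affine_connection[OF M g \<eta> D]
  show "semi_dual M' ?g ?\<eta> ?D X Z = induced_connection M' M g ?S X Z"
  \<comment> \<open>By uniqueness of the semi-dual field it suffices that the induced connection of
    \<open>?S\<close> satisfies the defining identity on \<open>M'\<close>. Read on extensions, this
    is the identity that defines \<open>?S\<close> on \<open>M\<close>.\<close>
  proof (rule semi_dual_eqI[OF M' g' induced_connection_field[OF S X Z]])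
    fix Y p assume Y: "Y \<in> vector_fields M'" and p: "p \<in> topspace (mtop M')"
    obtain A where A: "extends_near M' M p X A" using extends_near_exists[OF sub p X] .
    obtain B where B: "extends_near M' M p Y B" using extends_near_exists[OF sub p Y] .
    obtain C where C: "extends_near M' M p Z C" using extends_near_exists[OF sub p Z] .
    show "X p (\<lambda>q. ?g q (Y q) (Z q)) =
        ?g p (?D X Y p) (Z p) + ?g p (Y p) (induced_connection M' M g ?S X Z p) - ?\<eta> p (X p) * ?g p (Y p) (Z p)"
      unfolding derivative_of_induced_metric[OF X Y Z A B C] induced_connection_metric(1)[OF D X Z A B C]
        induced_connection_metric(2)[OF S X Y A C B] induced_metric_extension[OF B C] \<eta>'[OF A]
        semi_dual(2)[OF M g \<eta> D extends_nearD(1)[OF A] extends_nearD(1)[OF C] extends_nearD(1)[OF B] submanifoldD(3)[OF sub p]]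
      by simp
  qed
qed

end
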